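(* For any $\mu^{\rm in}\in\mathcal M(\mathbb R_+)$, the orbit map $t\mapsto\mu^{\rm in}M_t$ is the unique measure solution to the conservative renewal equation with initial data $\mu^{\rm in}$.
   Context: Notation: $\mathbb R_+=[0,\infty)$; $\mathcal M(\mathbb R_+)$ is the set of finite signed Borel measures on $\mathbb R_+$; $C_b(\mathbb R_+)$ is the space of bounded continuous functions with the sup norm $\|\cdot\|_\infty$, and $C_b(\mathbb R_+\times\mathbb R_+)$ is defined similarly; $C_0(\mathbb R_+)$ is the space of continuous functions on $\mathbb R_+$ tending to $0$ at infinity; $C^1_c(\mathbb R_+)$ is the space of continuously differentiable functions with compact support in $\mathbb R_+$ (they need not vanish at $0$); $C^1_b(\mathbb R_+)=\{f\in C^1(\mathbb R_+): f,f'\in C_b(\mathbb R_+)\}$. For $\mu\in\mathcal M(\mathbb R_+)$ and $f\in C_b(\mathbb R_+)$ write $\mu f=\int_{\mathbb R_+}f\,d\mu$. Standing assumption: $\beta:\mathbb R_+\to\mathbb R$ is continuous and there exist constants $a_*,\beta_{\min},\beta_{\max}>0$ such that $\beta_{\min}\mathbf 1_{[a_*,\infty)}(a)\le\beta(a)\le\beta_{\max}$ for all $a\ge0$. The conservative renewal equation is formally $\partial_t n(t,a)+\partial_a n(t,a)+\beta(a)n(t,a)=0$ for $t,a>0$, with $n(t,0)=\int_0^\infty\beta(a)n(t,a)\,da$ for $t>0$ and $n(0,a)=n^{\rm in}(a)$ for $a\ge 0$. For $f\in C^1_b(\mathbb R_+)$ set $\mathcal A f(a)=f'(a)+\beta(a)(f(0)-f(a))$.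 A family $(\mu_t)_{t\ge0}\subset\mathcal M(\mathbb R_+)$ is a measure solution to the renewal equation with initial data $\mu^{\rm in}\in\mathcal M(\mathbb R_+)$ if $t\mapsto\mu_t$ is narrowly continuous (i.e. $t\mapsto\mu_tf$ is continuous on $[0,\infty)$ for all $f\in C_b(\mathbb R_+)$) and for all $f\in C^1_c(\mathbb R_+)$ and all $t\ge0$, $\mu_tf=\mu^{\rm in}f+\int_0^t\mu_s\mathcal A f\,ds$. Right semigroup: for $f_0\in C_b(\mathbb R_+)$, there is a unique $f\in C_b(\mathbb R_+\times\mathbb R_+)$ satisfying, for all $t,a\ge0$, $$f(t,a)=f_0(a+t)e^{-\int_0^t\beta(a+u)\,du}+\int_0^te^{-\int_0^\tau\beta(a+u)\,du}\beta(a+\tau)f(t-\tau,0)\,d\tau,$$ and one sets $M_tf_0=f(t,\cdot)\in C_b(\mathbb R_+)$. Moreover $\|M_tf_0\|_\infty\le\|f_0\|_\infty$. Left semigroup: for $\mu\in\mathcal M(\mathbb R_+)$ and $t\ge0$, $\mu M_t\in\mathcal M(\mathbb R_+)$ is the unique measure (given by the Riesz representation theorem $\mathcal M(\mathbb R_+)=C_0(\mathbb R_+)'$) such that $\int_{\mathbb R_+}f\,d(\mu M_t)=\int_{\mathbb R_+}M_tf\,d\mu$ for all $f\in C_0(\mathbb R_+)$. *)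

theory Defs
  imports "HOL-Analysis.Analysis"
begin

text \<open>Functions on the half-line \<open>[0,\<infinity>)\<close> are represented by functions on \<open>real\<close> whose values at negative
  arguments are irrelevant.\<close>

abbreviation halfline :: "real set" where
  "halfline \<equiv> {0..}"

abbreviation borel_halfline :: "real measure" where
  "borel_halfline \<equiv> restrict_space borel halfline"


subsection \<open>Function spaces\<close>

definition Cb :: "(real \<Rightarrow> real) set" where
  "Cb = {f. continuous_on halfline f \<and> bounded (f ` halfline)}"

definition Cb2 :: "(real \<times> real \<Rightarrow> real) set" where
  "Cb2 = {f. continuous_on (halfline \<times> halfline) f \<and> bounded (f ` (halfline \<times> halfline))}"

definition C0 :: "(real \<Rightarrow> real) set" where
  "C0 = {f. continuous_on halfline f \<and> (f \<longlongrightarrow> 0) at_top}"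

text \<open>The derivative is one-sided at \<open>0\<close>.\<close>

definition deriv_halfline :: "(real \<Rightarrow> real) \<Rightarrow> real \<Rightarrow> real" where
  "deriv_halfline f a = vector_derivative f (at a within halfline)"

definition C1 :: "(real \<Rightarrow> real) set" where
  "C1 = {f. f differentiable_on halfline \<and> continuous_on halfline (deriv_halfline f)}"

text \<open>The support is taken in \<open>[0,\<infinity>)\<close>, so functions in \<open>C1c\<close> need not vanish at \<open>0\<close>.\<close>

definition C1c :: "(real \<Rightarrow> real) set" where
  "C1c = {f \<in> C1. compact (closure {a \<in> halfline. f a \<noteq> 0})}"


subsection \<open>Finite signed Borel measures\<close>

text \<open>A finite signed Borel measure is a countably additive real-valued set function. It is
  normalised to be \<open>0\<close> outside the Borel sets, so that equality of measures is equality of set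
  functions.\<close>

definition signed_measures :: "(real set \<Rightarrow> real) set" where
  "signed_measures = {\<mu>.
     \<mu> {} = 0 \<and>
     (\<forall>A::nat \<Rightarrow> real set. range A \<subseteq> sets borel_halfline \<longrightarrow> disjoint_family A \<longrightarrow>
        (\<lambda>n. \<mu> (A n)) sums \<mu> (\<Union>n. A n)) \<and>
     (\<forall>A. A \<notin> sets borel_halfline \<longrightarrow> \<mu> A = 0)}"

text \<open>Jordan decomposition: the positive part of \<open>\<mu>\<close> maps \<open>A\<close> to the supremum of \<open>\<mu> B\<close> over the Borel
  sets \<open>B \<subseteq> A\<close>. Negative values of \<open>\<mu> B\<close> are truncated to \<open>0\<close> by \<open>ennreal\<close>, which does not change
  the supremum since \<open>B = {}\<close> is allowed.\<close>

definition jordan_pos :: "(real set \<Rightarrow> real) \<Rightarrow> real measure" where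
  "jordan_pos \<mu> = measure_of halfline (sets borel_halfline)
     (\<lambda>A. SUP B \<in> {B \<in> sets borel_halfline. B \<subseteq> A}. ennreal (\<mu> B))"

definition jordan_neg :: "(real set \<Rightarrow> real) \<Rightarrow> real measure" where
  "jordan_neg \<mu> = jordan_pos (\<lambda>A. - \<mu> A)"

definition signed_integral :: "(real set \<Rightarrow> real) \<Rightarrow> (real \<Rightarrow> real) \<Rightarrow> real" where
  "signed_integral \<mu> f = (\<integral>a. f a \<partial>jordan_pos \<mu>) - (\<integral>a. f a \<partial>jordan_neg \<mu>)"


subsection \<open>Measure solutions of the renewal equation\<close>

definition generator :: "(real \<Rightarrow> real) \<Rightarrow> (real \<Rightarrow> real) \<Rightarrow> real \<Rightarrow> real" where
  "generator \<beta> f a = deriv_halfline f a + \<beta> a * (f 0 - f a)"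

definition narrowly_continuous :: "(real \<Rightarrow> real set \<Rightarrow> real) \<Rightarrow> bool" where
  "narrowly_continuous \<mu> \<longleftrightarrow> (\<forall>f \<in> Cb. continuous_on halfline (\<lambda>t. signed_integral (\<mu> t) f))"

definition measure_solution ::
  "(real \<Rightarrow> real) \<Rightarrow> (real set \<Rightarrow> real) \<Rightarrow> (real \<Rightarrow> real set \<Rightarrow> real) \<Rightarrow> bool" where
  "measure_solution \<beta> \<mu>in \<mu> \<longleftrightarrow>
     (\<forall>t\<ge>0. \<mu> t \<in> signed_measures) \<and>
     narrowly_continuous \<mu> \<and>
     (\<forall>f \<in> C1c. \<forall>t\<ge>0. signed_integral (\<mu> t) f =
        signed_integral \<mu>in f + integral {0..t} (\<lambda>s. signed_integral (\<mu> s) (generator \<beta> f)))"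


subsection \<open>The right and left semigroups\<close>

definition duhamel_solution ::
  "(real \<Rightarrow> real) \<Rightarrow> (real \<Rightarrow> real) \<Rightarrow> (real \<times> real \<Rightarrow> real) \<Rightarrow> bool" where
  "duhamel_solution \<beta> f0 f \<longleftrightarrow> (\<forall>t\<ge>0. \<forall>a\<ge>0.
     f (t, a) = f0 (a + t) * exp (- integral {0..t} (\<lambda>u. \<beta> (a + u)))
       + integral {0..t} (\<lambda>\<tau>. exp (- integral {0..\<tau>} (\<lambda>u. \<beta> (a + u))) * \<beta> (a + \<tau>) * f (t - \<tau>, 0)))"

text \<open>The solution is unique only on the quadrant; \<open>extensional\<close> fixes its values elsewhere, so that
  the definite description is well defined.\<close>

definition right_semigroup :: "(real \<Rightarrow> real) \<Rightarrow> real \<Rightarrow> (real \<Rightarrow> real) \<Rightarrow> real \<Rightarrow> real" where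
  "right_semigroup \<beta> t f0 = (\<lambda>a.
     (THE f. f \<in> Cb2 \<and> f \<in> extensional (halfline \<times> halfline) \<and> duhamel_solution \<beta> f0 f) (t, a))"

definition left_semigroup :: "(real \<Rightarrow> real) \<Rightarrow> (real set \<Rightarrow> real) \<Rightarrow> real \<Rightarrow> real set \<Rightarrow> real" where
  "left_semigroup \<beta> \<mu> t = (THE \<nu>. \<nu> \<in> signed_measures \<and>
     (\<forall>f \<in> C0. signed_integral \<nu> f = signed_integral \<mu> (right_semigroup \<beta> t f)))"

end

theory Submission
  imports Defs
begin

text \<open>Let \<open>S\<^sub>a(t)\<close> be the probability that an individual of age \<open>a\<close> has no renewal up to time \<open>t\<close>.
  The measure \<open>\<mu>M\<^sub>t\<close> is explicit: the image of \<open>S\<^sub>a(t) \<mu>(da)\<close> under \<open>a \<mapsto> a + t\<close>, plus the density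
  \<open>N(t - s) S\<^sub>0(s)\<close> on \<open>[0,t]\<close>, where the birth rate \<open>N\<close> solves the Volterra equation
  \<open>N(t) = \<integral> \<beta>(a + t) S\<^sub>a(t) \<mu>(da) + (\<beta> S\<^sub>0 * N)(t)\<close>. Duality with the right semigroup and the weak
  equation then follow from associativity of convolution, so no Riesz representation is needed.

  For uniqueness, narrow continuity and the uniform boundedness principle allow one to test with
  \<open>exp (- l a) / S\<^sub>0(a)\<close> for \<open>l > sup \<beta>\<close>. The result is a scalar linear equation in \<open>t\<close> driven by the
  birth rate \<open>\<integral> \<beta> d\<mu>\<^sub>t\<close>. By the Weierstrass theorem these functions determine \<open>\<mu>\<^sub>t\<close>, so the difference of
  two solutions is determined by the difference \<open>d\<close> of their birth rates, and testing with \<open>\<beta>\<close> yields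
  \<open>d = \<beta> S\<^sub>0 * d\<close>, hence \<open>d = 0\<close>.\<close>

section \<open>Finite signed measures\<close>

text \<open>The generator of a compactly supported \<open>f\<close> contains
  \<open>\<beta> a * f 0\<close>, which need not decay. Tests against \<beta> itself are therefore
  unavoidable, and identities between measures must hold on \<open>Cb\<close>, not just on
  \<open>C0\<close>. This is why measures are handled as functionals continuous under bounded
  pointwise convergence: once two of them agree on compactly supported functions, they agree on
  every bounded measurable one. The exponentials e = \<open>etest l\<close> satisfy e' = (\<beta> -
  l) e and e(0) = 1, so their generator is \<beta> - l e, and the weak equation becomes a scalar
  equation whose only foreign term is the birth rate. Taking l above sup \<beta> makes e decay, so
  that compactly supported cutoffs approximate both e and its generator uniformly. Narrow continuity
  bounds t \<mapsto> \<mu>_t f for each f separately, whereas the cutoff error stands under a time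
  integral and must be small uniformly in time; this gap is what the uniform boundedness principle
  closes.\<close>

lemma signed_measure_sums:
  assumes "\<mu> \<in> signed_measures" "\<And>n. A n \<in> sets borel_halfline" "disjoint_family A"
  shows "(\<lambda>n. \<mu> (A n)) sums \<mu> (\<Union>n. A n)"
  using assms unfolding signed_measures_def by blast

lemma signed_measure_empty: "\<mu> \<in> signed_measures \<Longrightarrow> \<mu> {} = 0"
  unfolding signed_measures_def by blast

lemma signed_measure_Un:
  assumes "\<mu> \<in> signed_measures" "A \<in> sets borel_halfline" "B \<in> sets borel_halfline" "A \<inter> B = {}"
  shows "\<mu> (A \<union> B) = \<mu> A + \<mu> B"
proof -
  have "(\<lambda>n. \<mu> (binaryset A B n)) sums \<mu> (\<Union>n. binaryset A B n)"
  proof (rule signed_measure_sums[OF assms(1)])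
    show "binaryset A B n \<in> sets borel_halfline" for n
      using assms by (auto simp: binaryset_def)
    show "disjoint_family (binaryset A B)"
      using assms by (auto simp: disjoint_family_on_def binaryset_def)
  qed
  moreover have "(\<lambda>n. \<mu> (binaryset A B n)) sums (\<mu> A + \<mu> B)"
    by (rule binaryset_sums) (rule signed_measure_empty[OF assms(1)])
  ultimately show ?thesis
    unfolding UN_binaryset_eq by (rule sums_unique2)
qed

lemma signed_measure_Diff:
  assumes "\<mu> \<in> signed_measures" "A \<in> sets borel_halfline" "B \<in> sets borel_halfline" "B \<subseteq> A"
  shows "\<mu> (A - B) = \<mu> A - \<mu> B"
proof -
  have "\<mu> (B \<union> (A - B)) = \<mu> B + \<mu> (A - B)"
    using assms by (intro signed_measure_Un) auto
  moreover have "B \<union> (A - B) = A"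
    using assms by auto
  ultimately show ?thesis by simp
qed

lemma signed_measure_uminus: "\<mu> \<in> signed_measures \<Longrightarrow> (\<lambda>A. - \<mu> A) \<in> signed_measures"
  unfolding signed_measures_def by (auto intro: sums_minus)

text \<open>Otherwise one could split off infinitely many disjoint pieces of measure at least \<open>1\<close>.\<close>

lemma signed_measure_bounded:
  assumes mu: "\<mu> \<in> signed_measures"
  obtains C where "\<And>A. A \<in> sets borel_halfline \<Longrightarrow> \<bar>\<mu> A\<bar> \<le> C"
proof -
  \<comment> \<open>Unboundedness on the Borel subsets of \<open>A\<close>: a property that at least
    one part of any splitting of \<open>A\<close> inherits.\<close>
  define U where "U A \<longleftrightarrow> A \<in> sets borel_halfline \<and>
    (\<forall>C. \<exists>B\<in>sets borel_halfline. B \<subseteq> A \<and> \<bar>\<mu> B\<bar> > C)" for A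
  have split: "\<exists>A'. U A' \<and> A' \<subseteq> A \<and> \<bar>\<mu> (A - A')\<bar> \<ge> 1" if A: "U A" for A
  proof -
    have Am: "A \<in> sets borel_halfline" using A U_def by auto
    \<comment> \<open>The surplus of 1 over \<open>\<bar>\<mu> A\<bar>\<close> gives both
      \<open>B\<close> and \<open>A - B\<close> measure at least 1 in absolute value, so whichever
      of them is not kept can be split off.\<close>
    obtain B where B: "B \<in> sets borel_halfline" "B \<subseteq> A" "\<bar>\<mu> B\<bar> > \<bar>\<mu> A\<bar> + 1"
      using A unfolding U_def by blast
    have D: "\<mu> (A - B) = \<mu> A - \<mu> B"
      by (rule signed_measure_Diff) (use mu Am B in auto)
    have "U B \<or> U (A - B)"
    proof (rule ccontr)
      assume "\<not> ?thesis"
      then obtain C1 C2 where C: "\<And>D. D \<in> sets borel_halfline \<Longrightarrow> D \<subseteq> B \<Longrightarrow> \<bar>\<mu> D\<bar> \<le> C1"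
        "\<And>D. D \<in> sets borel_halfline \<Longrightarrow> D \<subseteq> A - B \<Longrightarrow> \<bar>\<mu> D\<bar> \<le> C2"
        unfolding U_def using B Am by (metis sets.Diff not_less)
      obtain D where D: "D \<in> sets borel_halfline" "D \<subseteq> A" "\<bar>\<mu> D\<bar> > C1 + C2"
        using A unfolding U_def by blast
      have "\<mu> ((D \<inter> B) \<union> (D - B)) = \<mu> (D \<inter> B) + \<mu> (D - B)"
        using D B by (intro signed_measure_Un mu) auto
      moreover have "(D \<inter> B) \<union> (D - B) = D" by auto
      moreover have "\<bar>\<mu> (D \<inter> B)\<bar> \<le> C1" using D B by (intro C) auto
      moreover have "\<bar>\<mu> (D - B)\<bar> \<le> C2" using D B by (intro C) auto
      ultimately show False using D by simp
    qed
    then show ?thesis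
    proof
      assume "U B"
      then show ?thesis using B D by (intro exI[of _ B]) auto
    next
      assume "U (A - B)"
      moreover have "A - (A - B) = B" using B by auto
      ultimately show ?thesis using B by (intro exI[of _ "A - B"]) auto
    qed
  qed
  have "\<not> U halfline"
  proof
    assume H: "U halfline"
    have "\<exists>f. \<forall>n. U (f n) \<and> (f (Suc n) \<subseteq> f n \<and> \<bar>\<mu> (f n - f (Suc n))\<bar> \<ge> 1)"
      by (rule dependent_nat_choice) (use H split in auto)
    then obtain f where f: "\<And>n. U (f n)" "\<And>n. f (Suc n) \<subseteq> f n" "\<And>n. \<bar>\<mu> (f n - f (Suc n))\<bar> \<ge> 1"
      by blast
    have dec: "f n \<subseteq> f m" if "m \<le> n" for m n
      using lift_Suc_antimono_le[of f, OF f(2) that] by simp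
    have dis: "disjoint_family (\<lambda>n. f n - f (Suc n))"
      unfolding disjoint_family_on_def
    proof (intro ballI impI)
      fix m n :: nat assume "m \<noteq> n"
      then show "(f m - f (Suc m)) \<inter> (f n - f (Suc n)) = {}"
        using dec[of "Suc m" n] dec[of "Suc n" m] by (cases "m < n") auto
    qed
    \<comment> \<open>The pieces split off are disjoint, so their measures form a convergent series,
      although no term is below 1 in absolute value.\<close>
    have "(\<lambda>n. \<mu> (f n - f (Suc n))) sums \<mu> (\<Union>n. f n - f (Suc n))"
      by (rule signed_measure_sums[OF mu _ dis]) (use f(1) U_def in auto)
    then have "(\<lambda>n. \<mu> (f n - f (Suc n))) \<longlonglongrightarrow> 0"
      by (intro summable_LIMSEQ_zero) (simp add: sums_iff)
    then have "eventually (\<lambda>n. dist (\<mu> (f n - f (Suc n))) 0 < 1) sequentially"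
      by (rule tendstoD) simp
    then obtain n where "dist (\<mu> (f n - f (Suc n))) 0 < 1"
      unfolding eventually_sequentially by blast
    then show False
      using f(3)[of n] by (simp add: dist_real_def)
  qed
  moreover have "halfline \<in> sets borel_halfline"
    using sets.top[of borel_halfline] by (simp add: space_restrict_space)
  ultimately obtain C where C: "\<And>B. B \<in> sets borel_halfline \<Longrightarrow> B \<subseteq> halfline \<Longrightarrow> \<bar>\<mu> B\<bar> \<le> C"
    unfolding U_def by (meson not_less)
  show thesis
    by (rule that[of C], rule C)
       (use sets.sets_into_space[of _ borel_halfline] in \<open>auto simp: space_restrict_space\<close>)
qed

section \<open>Jordan decomposition of a signed measure\<close>

definition pos_variation :: "(real set \<Rightarrow> real) \<Rightarrow> real set \<Rightarrow> real" where
  "pos_variation \<mu> A = (SUP B \<in> {B \<in> sets borel_halfline. B \<subseteq> A}. \<mu> B)"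

lemma pos_variation_bdd:
  assumes "\<mu> \<in> signed_measures"
  shows "bdd_above (\<mu> ` {B \<in> sets borel_halfline. B \<subseteq> A})"
proof -
  obtain C where "\<And>A. A \<in> sets borel_halfline \<Longrightarrow> \<bar>\<mu> A\<bar> \<le> C"
    using signed_measure_bounded[OF assms] by blast
  then show ?thesis
    by (intro bdd_aboveI[of _ C]) (auto simp: abs_le_iff)
qed

lemma pos_variation_upper:
  assumes "\<mu> \<in> signed_measures" "B \<in> sets borel_halfline" "B \<subseteq> A"
  shows "\<mu> B \<le> pos_variation \<mu> A"
  unfolding pos_variation_def by (rule cSUP_upper) (use assms pos_variation_bdd in auto)

lemma pos_variation_least:
  assumes "\<And>B. B \<in> sets borel_halfline \<Longrightarrow> B \<subseteq> A \<Longrightarrow> \<mu> B \<le> c"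
  shows "pos_variation \<mu> A \<le> c"
  unfolding pos_variation_def by (rule cSUP_least) (use assms in auto)

lemma pos_variation_nonneg: "\<mu> \<in> signed_measures \<Longrightarrow> pos_variation \<mu> A \<ge> 0"
  using pos_variation_upper[of \<mu> "{}" A] signed_measure_empty[of \<mu>] by simp

lemma pos_variation_empty:
  assumes "\<mu> \<in> signed_measures"
  shows "pos_variation \<mu> {} = 0"
proof -
  have "{B \<in> sets borel_halfline. B \<subseteq> {}} = {{}}" by auto
  then have "pos_variation \<mu> {} = (SUP B \<in> {{}}. \<mu> B)"
    unfolding pos_variation_def by (rule arg_cong)
  then show ?thesis
    using signed_measure_empty[OF assms] by simp
qed

text \<open>Near-optimal subsets of \<open>A\<close> and of \<open>B\<close> can be chosen
  independently and united. Superadditivity on finite unions is one half of countable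
  additivity.\<close>

lemma pos_variation_Un:
  assumes mu: "\<mu> \<in> signed_measures" and "A \<inter> B = {}"
  shows "pos_variation \<mu> A + pos_variation \<mu> B \<le> pos_variation \<mu> (A \<union> B)"
proof -
  have "pos_variation \<mu> A \<le> pos_variation \<mu> (A \<union> B) - pos_variation \<mu> B"
  proof (rule pos_variation_least)
    fix C assume C: "C \<in> sets borel_halfline" "C \<subseteq> A"
    have "pos_variation \<mu> B \<le> pos_variation \<mu> (A \<union> B) - \<mu> C"
    proof (rule pos_variation_least)
      fix D assume D: "D \<in> sets borel_halfline" "D \<subseteq> B"
      have "\<mu> (C \<union> D) = \<mu> C + \<mu> D"
        using C D assms by (intro signed_measure_Un) auto
      moreover have "\<mu> (C \<union> D) \<le> pos_variation \<mu> (A \<union> B)"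
        using C D by (intro pos_variation_upper mu) auto
      ultimately show "\<mu> D \<le> pos_variation \<mu> (A \<union> B) - \<mu> C" by simp
    qed
    then show "\<mu> C \<le> pos_variation \<mu> (A \<union> B) - pos_variation \<mu> B" by simp
  qed
  then show ?thesis by simp
qed

lemma pos_variation_mono:
  assumes "\<mu> \<in> signed_measures" "A \<subseteq> B"
  shows "pos_variation \<mu> A \<le> pos_variation \<mu> B"
  by (rule pos_variation_least) (use assms in \<open>auto intro: pos_variation_upper\<close>)

text \<open>The sum is at most the value of the union by superadditivity and monotonicity.
  Conversely, a Borel set \<open>B\<close> inside the union is cut into the pieces
  \<open>B \<inter> A n\<close>, to which countable additivity of \<open>\<mu>\<close>
  applies.\<close>

lemma pos_variation_sums:
  assumes mu: "\<mu> \<in> signed_measures"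
    and A: "\<And>n. A n \<in> sets borel_halfline" "disjoint_family A"
  shows "(\<lambda>n. pos_variation \<mu> (A n)) sums pos_variation \<mu> (\<Union>n. A n)"
proof -
  let ?p = "pos_variation \<mu>"
  have part: "(\<Sum>i<n. ?p (A i)) \<le> ?p (\<Union>i<n. A i)" for n
  proof (induction n)
    case 0
    then show ?case using pos_variation_empty[OF mu] by simp
  next
    case (Suc n)
    have "A i \<inter> A n = {}" if "i < n" for i
      using disjoint_family_onD[OF A(2), of i n] that by simp
    then have "(\<Union>i<n. A i) \<inter> A n = {}"
      by auto
    then have "?p (\<Union>i<n. A i) + ?p (A n) \<le> ?p ((\<Union>i<n. A i) \<union> A n)"
      by (rule pos_variation_Un[OF mu])
    moreover have "(\<Union>i<n. A i) \<union> A n = (\<Union>i<Suc n. A i)"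
      by (auto simp: less_Suc_eq)
    ultimately show ?case using Suc by simp
  qed
  have le: "(\<Sum>i<n. ?p (A i)) \<le> ?p (\<Union>i. A i)" for n
    using part[of n] pos_variation_mono[OF mu, of "\<Union>i<n. A i" "\<Union>i. A i"] by fastforce
  have summ: "summable (\<lambda>n. ?p (A n))"
    by (rule summableI_nonneg_bounded[OF pos_variation_nonneg[OF mu] le])
  have "?p (\<Union>i. A i) \<le> (\<Sum>n. ?p (A n))"
  proof (rule pos_variation_least)
    fix B assume B: "B \<in> sets borel_halfline" "B \<subseteq> (\<Union>i. A i)"
    have "(\<lambda>n. \<mu> (B \<inter> A n)) sums \<mu> (\<Union>n. B \<inter> A n)"
      using A B by (intro signed_measure_sums[OF mu]) (auto simp: disjoint_family_on_def)
    moreover have "(\<Union>n. B \<inter> A n) = B" using B by auto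
    ultimately have "(\<lambda>n. \<mu> (B \<inter> A n)) sums \<mu> B" by simp
    then show "\<mu> B \<le> (\<Sum>n. ?p (A n))"
      by (rule sums_le[rotated, OF _ summable_sums[OF summ]])
         (use A B in \<open>auto intro!: pos_variation_upper mu\<close>)
  qed
  moreover have "(\<Sum>n. ?p (A n)) \<le> ?p (\<Union>i. A i)"
    by (rule suminf_le_const[OF summ le])
  ultimately show ?thesis
    using summ by (simp add: sums_iff)
qed

text \<open>Passing from \<open>B\<close> to \<open>A - B\<close> exchanges the two suprema up to
  the constant \<open>\<mu> A\<close>. This yields the Jordan decomposition without a Hahn
  decomposition.\<close>

lemma pos_variation_uminus:
  assumes mu: "\<mu> \<in> signed_measures" and A: "A \<in> sets borel_halfline"
  shows "pos_variation (\<lambda>A. - \<mu> A) A = pos_variation \<mu> A - \<mu> A"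
proof (rule antisym)
  show "pos_variation (\<lambda>A. - \<mu> A) A \<le> pos_variation \<mu> A - \<mu> A"
  proof (rule pos_variation_least)
    fix B assume B: "B \<in> sets borel_halfline" "B \<subseteq> A"
    have "\<mu> (A - B) \<le> pos_variation \<mu> A"
      using A B by (intro pos_variation_upper mu) auto
    then show "- \<mu> B \<le> pos_variation \<mu> A - \<mu> A"
      using signed_measure_Diff[OF mu A B] by simp
  qed
  have "pos_variation \<mu> A \<le> \<mu> A + pos_variation (\<lambda>A. - \<mu> A) A"
  proof (rule pos_variation_least)
    fix B assume B: "B \<in> sets borel_halfline" "B \<subseteq> A"
    have "- \<mu> (A - B) \<le> pos_variation (\<lambda>A. - \<mu> A) A"
      using A B by (intro pos_variation_upper signed_measure_uminus mu) auto
    then show "\<mu> B \<le> \<mu> A + pos_variation (\<lambda>A. - \<mu> A) A"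
      using signed_measure_Diff[OF mu A B] by simp
  qed
  then show "pos_variation \<mu> A - \<mu> A \<le> pos_variation (\<lambda>A. - \<mu> A) A" by simp
qed

text \<open>Links the \<open>ennreal\<close> supremum in the definition of \<open>jordan_pos\<close>
  with a real number, for which subtraction makes sense. The truncation at 0 is harmless: the
  supremum is some \<open>r \<ge> 0\<close>, which also bounds the negative values.\<close>

lemma SUP_ennreal_eq_pos_variation:
  assumes mu: "\<mu> \<in> signed_measures"
  shows "(SUP B \<in> {B \<in> sets borel_halfline. B \<subseteq> A}. ennreal (\<mu> B)) = ennreal (pos_variation \<mu> A)"
    (is "?s = _")
proof (rule antisym)
  show le: "?s \<le> ennreal (pos_variation \<mu> A)"
    by (rule SUP_least) (auto intro!: ennreal_leI pos_variation_upper mu)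
  then have "?s \<noteq> top"
    by (metis ennreal_neq_top top.extremum_unique)
  then obtain r where r: "?s = ennreal r" "r \<ge> 0"
    using ennreal_cases[of ?s] by metis
  have "\<mu> B \<le> r" if B: "B \<in> sets borel_halfline" "B \<subseteq> A" for B
  proof -
    have "ennreal (\<mu> B) \<le> ?s"
      by (rule SUP_upper) (use B in blast)
    then show ?thesis
      unfolding r(1) using ennreal_le_iff[OF r(2)] by blast
  qed
  then have "pos_variation \<mu> A \<le> r"
    by (rule pos_variation_least)
  then show "ennreal (pos_variation \<mu> A) \<le> ?s"
    unfolding r(1) by (rule ennreal_leI)
qed

lemma space_jordan_pos [simp]: "space (jordan_pos \<mu>) = halfline"
  unfolding jordan_pos_def
  by (rule space_measure_of)
     (use sets.space_closed[of borel_halfline] in \<open>simp add: space_restrict_space\<close>)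

lemma sets_jordan_pos [measurable_cong]: "sets (jordan_pos \<mu>) = sets borel_halfline"
  unfolding jordan_pos_def
  using sets.sets_measure_of_eq[of borel_halfline] by (simp add: space_restrict_space)

lemma emeasure_jordan_pos:
  assumes mu: "\<mu> \<in> signed_measures" and A: "A \<in> sets borel_halfline"
  shows "emeasure (jordan_pos \<mu>) A = ennreal (pos_variation \<mu> A)"
proof -
  let ?e = "\<lambda>A. ennreal (pos_variation \<mu> A)"
  have J: "jordan_pos \<mu> = measure_of halfline (sets borel_halfline) ?e"
    unfolding jordan_pos_def SUP_ennreal_eq_pos_variation[OF mu] ..
  show ?thesis
  proof (rule emeasure_measure_of_sigma[of halfline "sets borel_halfline" ?e A, folded J])
    show "sigma_algebra halfline (sets borel_halfline)"
      using sets.sigma_algebra_axioms[of borel_halfline] by (simp add: space_restrict_space)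
    show "positive (sets borel_halfline) ?e"
      by (simp add: positive_def pos_variation_empty[OF mu])
    show "countably_additive (sets borel_halfline) ?e"
      unfolding countably_additive_def
    proof (intro allI impI)
      fix A :: "nat \<Rightarrow> real set"
      assume "range A \<subseteq> sets borel_halfline" "disjoint_family A"
      then have "(\<lambda>n. pos_variation \<mu> (A n)) sums pos_variation \<mu> (\<Union>n. A n)"
        by (intro pos_variation_sums[OF mu]) auto
      then show "(\<Sum>i. ?e (A i)) = ?e (\<Union> (range A))"
        using suminf_ennreal_eq[of "\<lambda>n. pos_variation \<mu> (A n)"] pos_variation_nonneg[OF mu] by blast
    qed
  qed (rule A)
qed

lemma jordan_neg_simps [measurable_cong, simp]:
  "sets (jordan_neg \<mu>) = sets borel_halfline" "space (jordan_neg \<mu>) = halfline"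
  by (simp_all add: jordan_neg_def sets_jordan_pos)

lemma finite_measure_jordan_pos: "\<mu> \<in> signed_measures \<Longrightarrow> finite_measure (jordan_pos \<mu>)"
  using sets.top[of borel_halfline]
  by (intro finite_measureI) (simp add: emeasure_jordan_pos space_restrict_space)

lemma finite_measure_jordan_neg: "\<mu> \<in> signed_measures \<Longrightarrow> finite_measure (jordan_neg \<mu>)"
  unfolding jordan_neg_def by (intro finite_measure_jordan_pos signed_measure_uminus)

lemma jordan_decomposition:
  assumes mu: "\<mu> \<in> signed_measures" and A: "A \<in> sets borel_halfline"
  shows "measure (jordan_pos \<mu>) A - measure (jordan_neg \<mu>) A = \<mu> A"
proof -
  have "measure (jordan_pos \<mu>) A = pos_variation \<mu> A"
    unfolding measure_def emeasure_jordan_pos[OF mu A]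
    by (rule enn2real_ennreal[OF pos_variation_nonneg[OF mu]])
  moreover have "measure (jordan_neg \<mu>) A = pos_variation (\<lambda>A. - \<mu> A) A"
    unfolding measure_def jordan_neg_def emeasure_jordan_pos[OF signed_measure_uminus[OF mu] A]
    by (rule enn2real_ennreal[OF pos_variation_nonneg[OF signed_measure_uminus[OF mu]]])
  ultimately show ?thesis
    using pos_variation_uminus[OF mu A] by simp
qed

section \<open>Bounded measurable functions and functionals continuous under bounded pointwise
  convergence\<close>

definition bounded_measurable :: "(real \<Rightarrow> real) set" where
  "bounded_measurable = {f \<in> borel_measurable borel_halfline. \<exists>C. \<forall>a\<ge>0. \<bar>f a\<bar> \<le> C}"

lemma bounded_measurableI:
  "f \<in> borel_measurable borel_halfline \<Longrightarrow> (\<And>a. a \<ge> 0 \<Longrightarrow> \<bar>f a\<bar> \<le> C) \<Longrightarrow> f \<in> bounded_measurable"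
  unfolding bounded_measurable_def by blast

lemma bounded_measurableE:
  assumes "f \<in> bounded_measurable"
  obtains C where "C > 0" "\<And>a. a \<ge> 0 \<Longrightarrow> \<bar>f a\<bar> \<le> C"
proof -
  obtain C where C: "\<forall>a\<ge>0. \<bar>f a\<bar> \<le> C"
    using assms unfolding bounded_measurable_def by blast
  show thesis
    by (rule that[of "\<bar>C\<bar> + 1"]) (use C in force)+
qed

lemma bounded_measurable_borel: "f \<in> bounded_measurable \<Longrightarrow> f \<in> borel_measurable borel_halfline"
  unfolding bounded_measurable_def by blast

lemma bounded_measurable_indicator:
  "A \<in> sets borel_halfline \<Longrightarrow> indicator A \<in> bounded_measurable"
  by (rule bounded_measurableI[where C = 1]) (auto simp: indicator_def)

lemma bounded_measurable_const: "(\<lambda>_. c) \<in> bounded_measurable"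
  by (rule bounded_measurableI[where C = "\<bar>c\<bar>"]) auto

lemma bounded_measurable_add:
  assumes "f \<in> bounded_measurable" "g \<in> bounded_measurable"
  shows "(\<lambda>a. f a + g a) \<in> bounded_measurable"
proof -
  obtain C where C: "\<And>a. a \<ge> 0 \<Longrightarrow> \<bar>f a\<bar> \<le> C"
    using assms by (meson bounded_measurableE)
  obtain D where D: "\<And>a. a \<ge> 0 \<Longrightarrow> \<bar>g a\<bar> \<le> D"
    using assms by (meson bounded_measurableE)
  show ?thesis
  proof (rule bounded_measurableI)
    show "(\<lambda>a. f a + g a) \<in> borel_measurable borel_halfline"
      using assms[THEN bounded_measurable_borel] by (rule borel_measurable_add)
    show "\<bar>f a + g a\<bar> \<le> C + D" if "a \<ge> 0" for a
      using C[OF that] D[OF that] by linarith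
  qed
qed

lemma bounded_measurable_mult:
  assumes "f \<in> bounded_measurable" "g \<in> bounded_measurable"
  shows "(\<lambda>a. f a * g a) \<in> bounded_measurable"
proof -
  obtain C where C: "C > 0" "\<And>a. a \<ge> 0 \<Longrightarrow> \<bar>f a\<bar> \<le> C"
    using assms by (meson bounded_measurableE)
  obtain D where D: "\<And>a. a \<ge> 0 \<Longrightarrow> \<bar>g a\<bar> \<le> D"
    using assms by (meson bounded_measurableE)
  show ?thesis
  proof (rule bounded_measurableI)
    show "(\<lambda>a. f a * g a) \<in> borel_measurable borel_halfline"
      using assms[THEN bounded_measurable_borel] by (rule borel_measurable_times)
    show "\<bar>f a * g a\<bar> \<le> C * D" if "a \<ge> 0" for a
      unfolding abs_mult using C(2)[OF that] D[OF that] \<open>C > 0\<close> by (intro mult_mono) auto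
  qed
qed

lemma bounded_measurable_cmult: "f \<in> bounded_measurable \<Longrightarrow> (\<lambda>a. c * f a) \<in> bounded_measurable"
  by (rule bounded_measurable_mult[OF bounded_measurable_const])

lemma bounded_measurable_diff:
  assumes "f \<in> bounded_measurable" "g \<in> bounded_measurable"
  shows "(\<lambda>a. f a - g a) \<in> bounded_measurable"
  using bounded_measurable_add[OF assms(1) bounded_measurable_cmult[OF assms(2), of "-1"]] by simp

lemma bounded_measurable_sum:
  "(\<And>i. i \<in> I \<Longrightarrow> f i \<in> bounded_measurable) \<Longrightarrow> (\<lambda>a. \<Sum>i\<in>I. f i a) \<in> bounded_measurable"
  by (induction I rule: infinite_finite_induct)
     (auto intro!: bounded_measurable_const bounded_measurable_add)

lemma bounded_measurable_continuous:
  assumes "continuous_on halfline f" "\<And>a. a \<ge> 0 \<Longrightarrow> \<bar>f a\<bar> \<le> C"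
  shows "f \<in> bounded_measurable"
  by (rule bounded_measurableI[OF borel_measurable_continuous_on_restrict[OF assms(1)] assms(2)])

lemma Cb_bounded_measurable: "f \<in> Cb \<Longrightarrow> f \<in> bounded_measurable"
  unfolding Cb_def bounded_iff
  by (auto intro: bounded_measurable_continuous)

lemma bounded_measurable_shift:
  assumes "f \<in> bounded_measurable" "t \<ge> 0"
  shows "(\<lambda>a. f (a + t)) \<in> bounded_measurable"
proof -
  obtain C where C: "\<And>a. a \<ge> 0 \<Longrightarrow> \<bar>f a\<bar> \<le> C"
    using assms by (meson bounded_measurableE)
  have "(\<lambda>a. a + t) \<in> borel_halfline \<rightarrow>\<^sub>M borel_halfline"
    using assms(2)
    by (intro measurable_restrict_space2 measurable_restrict_space1) (auto simp: space_restrict_space)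
  then have "(\<lambda>a. f (a + t)) \<in> borel_measurable borel_halfline"
    by (rule measurable_compose) (rule bounded_measurable_borel[OF assms(1)])
  then show ?thesis
    by (rule bounded_measurableI[where C = C]) (use C assms(2) in auto)
qed

text \<open>Bounded pointwise convergence is only required on \<^term>\<open>halfline\<close>; applied to constant sequences
  it shows that such a functional depends only on the values there.\<close>

definition sigma_functional :: "((real \<Rightarrow> real) \<Rightarrow> real) \<Rightarrow> bool" where
  "sigma_functional L \<longleftrightarrow>
    (\<forall>f\<in>bounded_measurable. \<forall>g\<in>bounded_measurable. L (\<lambda>a. f a + g a) = L f + L g) \<and>
    (\<forall>c. \<forall>f\<in>bounded_measurable. L (\<lambda>a. c * f a) = c * L f) \<and>
    (\<forall>F f C. (\<forall>n. F n \<in> bounded_measurable) \<longrightarrow> f \<in> bounded_measurable \<longrightarrow>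
      (\<forall>n. \<forall>a\<ge>0. \<bar>F n a\<bar> \<le> C) \<longrightarrow> (\<forall>a\<ge>0. (\<lambda>n. F n a) \<longlonglongrightarrow> f a) \<longrightarrow> (\<lambda>n. L (F n)) \<longlonglongrightarrow> L f)"

lemma sigma_functional_add:
  "sigma_functional L \<Longrightarrow> f \<in> bounded_measurable \<Longrightarrow> g \<in> bounded_measurable \<Longrightarrow>
    L (\<lambda>a. f a + g a) = L f + L g"
  unfolding sigma_functional_def by blast

lemma sigma_functional_cmult:
  "sigma_functional L \<Longrightarrow> f \<in> bounded_measurable \<Longrightarrow> L (\<lambda>a. c * f a) = c * L f"
  unfolding sigma_functional_def by blast

lemma sigma_functional_diff:
  assumes "sigma_functional L" "f \<in> bounded_measurable" "g \<in> bounded_measurable"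
  shows "L (\<lambda>a. f a - g a) = L f - L g"
  using sigma_functional_add[OF assms(1,2) bounded_measurable_cmult[OF assms(3), of "-1"]]
    sigma_functional_cmult[OF assms(1,3), of "-1"] by simp

lemma sigma_functional_tendsto:
  assumes "sigma_functional L" "\<And>n. F n \<in> bounded_measurable" "f \<in> bounded_measurable"
    "\<And>n a. a \<ge> 0 \<Longrightarrow> \<bar>F n a\<bar> \<le> C" "\<And>a. a \<ge> 0 \<Longrightarrow> (\<lambda>n. F n a) \<longlonglongrightarrow> f a"
  shows "(\<lambda>n. L (F n)) \<longlonglongrightarrow> L f"
  using assms unfolding sigma_functional_def by blast

lemma sigma_functional_cong:
  assumes "sigma_functional L" "f \<in> bounded_measurable" "\<And>a. a \<ge> 0 \<Longrightarrow> f a = g a"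
  shows "L f = L g"
proof -
  obtain C where C: "\<And>a. a \<ge> 0 \<Longrightarrow> \<bar>f a\<bar> \<le> C"
    using assms by (meson bounded_measurableE)
  have "g \<in> borel_measurable borel_halfline"
    using bounded_measurable_borel[OF assms(2)] assms(3)
    by (subst measurable_cong[of _ g f]) (auto simp: space_restrict_space)
  then have g: "g \<in> bounded_measurable"
    by (rule bounded_measurableI) (use C assms(3) in auto)
  have "(\<lambda>n::nat. L f) \<longlonglongrightarrow> L g"
    by (rule sigma_functional_tendsto[OF assms(1) _ g C]) (use assms in auto)
  then show ?thesis
    by (simp add: LIMSEQ_const_iff)
qed

lemma sigma_functional_sum:
  assumes "sigma_functional L" "\<And>i. i \<in> I \<Longrightarrow> f i \<in> bounded_measurable"
  shows "L (\<lambda>a. \<Sum>i\<in>I. f i a) = (\<Sum>i\<in>I. L (f i))"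
proof -
  have "L (\<lambda>a. 0) = 0"
    using sigma_functional_cmult[OF assms(1) bounded_measurable_const[of 0], of 0] by simp
  then show ?thesis
    using assms(2)
    by (induction I rule: infinite_finite_induct)
       (auto simp: sigma_functional_add[OF assms(1) _ bounded_measurable_sum])
qed

lemma finite_measure_integrable_bounded_measurable:
  assumes "finite_measure M" "sets M = sets borel_halfline" "f \<in> bounded_measurable"
  shows "integrable M f"
proof -
  interpret finite_measure M by fact
  have "space M = halfline"
    using sets_eq_imp_space_eq[OF assms(2)] by (simp add: space_restrict_space)
  moreover obtain C where "\<And>a. a \<ge> 0 \<Longrightarrow> \<bar>f a\<bar> \<le> C"
    using assms by (meson bounded_measurableE)
  ultimately show ?thesis
    using bounded_measurable_borel[OF assms(3)] measurable_cong_sets[OF assms(2) refl]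
    by (intro integrable_const_bound[where B = C]) auto
qed

lemma sigma_functional_integral:
  assumes M: "finite_measure M" "sets M = sets borel_halfline"
  shows "sigma_functional (\<lambda>f. \<integral>a. f a \<partial>M)"
  unfolding sigma_functional_def
proof (intro conjI ballI allI impI)
  note int = finite_measure_integrable_bounded_measurable[OF M]
  have sp: "space M = halfline"
    using sets_eq_imp_space_eq[OF M(2)] by (simp add: space_restrict_space)
  show "(\<integral>a. f a + g a \<partial>M) = (\<integral>a. f a \<partial>M) + (\<integral>a. g a \<partial>M)"
    if "f \<in> bounded_measurable" "g \<in> bounded_measurable" for f g
    using that by (intro Bochner_Integration.integral_add int)
  show "(\<integral>a. c * f a \<partial>M) = c * (\<integral>a. f a \<partial>M)" if "f \<in> bounded_measurable" for f c
    by simp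
  fix F :: "nat \<Rightarrow> real \<Rightarrow> real" and f C
  assume F: "\<forall>n. F n \<in> bounded_measurable" and f: "f \<in> bounded_measurable"
    and C: "\<forall>n. \<forall>a\<ge>0. \<bar>F n a\<bar> \<le> C" and lim: "\<forall>a\<ge>0. (\<lambda>n. F n a) \<longlonglongrightarrow> f a"
  show "(\<lambda>n. \<integral>a. F n a \<partial>M) \<longlonglongrightarrow> (\<integral>a. f a \<partial>M)"
  proof (rule integral_dominated_convergence[where w = "\<lambda>_. C"])
    show "integrable M (\<lambda>_. C)"
      by (rule int[OF bounded_measurable_const])
    show "f \<in> borel_measurable M" "\<And>n. F n \<in> borel_measurable M"
      using int F f borel_measurable_integrable by blast+
  qed (use sp C lim in auto)
qed

lemma sigma_functional_signed_integral:
  assumes "\<mu> \<in> signed_measures"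
  shows "sigma_functional (signed_integral \<mu>)"
proof -
  note P = sigma_functional_integral[OF finite_measure_jordan_pos[OF assms] sets_jordan_pos]
  note N = sigma_functional_integral[OF finite_measure_jordan_neg[OF assms] jordan_neg_simps(1)]
  show ?thesis
    unfolding sigma_functional_def signed_integral_def
    by (intro conjI ballI allI impI)
       (auto simp: sigma_functional_add[OF P] sigma_functional_add[OF N] right_diff_distrib
         intro!: tendsto_diff sigma_functional_tendsto[OF P] sigma_functional_tendsto[OF N])
qed

lemma signed_integral_indicator:
  assumes "\<mu> \<in> signed_measures" "A \<in> sets borel_halfline"
  shows "signed_integral \<mu> (indicator A) = \<mu> A"
proof -
  have "A \<inter> halfline = A"
    using sets.sets_into_space[OF assms(2)] by (auto simp: space_restrict_space)
  then show ?thesis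
    using jordan_decomposition[OF assms] by (simp add: signed_integral_def)
qed

text \<open>Induction over nonnegative measurable functions. Boundedness is carried along as an
  implication: it descends to summands and to approximants from below because, all being
  nonnegative, they are dominated by the bounded total.\<close>

lemma sigma_functional_eqI:
  assumes L: "sigma_functional L" and J: "sigma_functional J"
    and eq: "\<And>A. A \<in> sets borel_halfline \<Longrightarrow> L (indicator A) = J (indicator A)"
    and f: "f \<in> bounded_measurable"
  shows "L f = J f"
proof -
  have pos: "u \<in> bounded_measurable \<longrightarrow> L u = J u"
    if "u \<in> borel_measurable borel_halfline" "\<And>a. 0 \<le> u a" for u
    using that
  proof (induction rule: borel_measurable_induct_real)
    case (set A)
    then show ?case using eq by blast
  next
    case (mult u c)
    show ?case
    proof
      assume b: "(\<lambda>x. c * u x) \<in> bounded_measurable"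
      show "L (\<lambda>x. c * u x) = J (\<lambda>x. c * u x)"
      proof (cases "c = 0")
        case True
        then show ?thesis
          using sigma_functional_cmult[OF L bounded_measurable_const[of 0], of 0]
            sigma_functional_cmult[OF J bounded_measurable_const[of 0], of 0] by simp
      next
        case False
        then have "(\<lambda>x. inverse c * (c * u x)) = u" by (auto simp: fun_eq_iff)
        then have "u \<in> bounded_measurable"
          using bounded_measurable_cmult[OF b, of "inverse c"] by simp
        then show ?thesis
          using mult by (simp add: sigma_functional_cmult[OF L] sigma_functional_cmult[OF J])
      qed
    qed
  next
    case (add u v)
    show ?case
    proof
      assume "(\<lambda>x. v x + u x) \<in> bounded_measurable"
      then obtain C where C: "\<And>a. a \<ge> 0 \<Longrightarrow> \<bar>v a + u a\<bar> \<le> C"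
        by (meson bounded_measurableE)
      have uv: "u \<in> bounded_measurable" "v \<in> bounded_measurable"
      proof -
        show "u \<in> bounded_measurable"
        proof (rule bounded_measurableI[OF add(1)])
          show "\<bar>u a\<bar> \<le> C" if "a \<ge> 0" for a
            using C[OF that] add(2)[of a] add(4)[of a] by linarith
        qed
        show "v \<in> bounded_measurable"
        proof (rule bounded_measurableI[OF add(3)])
          show "\<bar>v a\<bar> \<le> C" if "a \<ge> 0" for a
            using C[OF that] add(2)[of a] add(4)[of a] by linarith
        qed
      qed
      then show "L (\<lambda>x. v x + u x) = J (\<lambda>x. v x + u x)"
        using add by (simp add: sigma_functional_add[OF L] sigma_functional_add[OF J])
    qed
  next
    case (seq U)
    show ?case
    proof
      assume u: "u \<in> bounded_measurable"
      then obtain C where C: "\<And>a. a \<ge> 0 \<Longrightarrow> \<bar>u a\<bar> \<le> C"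
        by (meson bounded_measurableE)
      have lim: "(\<lambda>i. U i a) \<longlonglongrightarrow> u a" if "a \<ge> 0" for a
        using seq that by (auto simp: space_restrict_space)
      have le: "\<bar>U i a\<bar> \<le> C" if "a \<ge> 0" for i a
      proof -
        have "U i a \<le> u a"
          by (rule incseq_le[OF _ lim[OF that]]) (use \<open>incseq U\<close> in \<open>auto simp: incseq_def le_fun_def\<close>)
        then show ?thesis
          using C[OF that] seq(2)[of i a] by linarith
      qed
      have U: "U i \<in> bounded_measurable" for i
        by (rule bounded_measurableI[OF seq(1) le])
      have "(\<lambda>i. L (U i)) \<longlonglongrightarrow> L u"
        by (rule sigma_functional_tendsto[OF L U u le lim])
      moreover have "(\<lambda>i. J (U i)) \<longlonglongrightarrow> J u"
        by (rule sigma_functional_tendsto[OF J U u le lim])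
      moreover have "L (U i) = J (U i)" for i
        using seq U by blast
      ultimately show "L u = J u"
        by (simp add: LIMSEQ_unique)
    qed
  qed
  obtain C where C: "\<And>a. a \<ge> 0 \<Longrightarrow> \<bar>f a\<bar> \<le> C"
    using f by (meson bounded_measurableE)
  \<comment> \<open>Adding \<open>C\<close> makes \<open>f\<close> nonnegative on the half-line;
    \<open>max 0\<close> does the same at negative arguments, where nothing is known about
    \<open>f\<close>.\<close>
  define g where "g = (\<lambda>a. max 0 (f a + C))"
  have g: "g \<in> bounded_measurable"
  proof (rule bounded_measurableI)
    show "g \<in> borel_measurable borel_halfline"
      unfolding g_def using bounded_measurable_borel[OF f] by measurable
    show "\<bar>g a\<bar> \<le> 2 * C" if "a \<ge> 0" for a
      using C[OF that] by (auto simp: g_def)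
  qed
  have "L g = J g"
    using pos[OF bounded_measurable_borel[OF g]] g by (simp add: g_def)
  moreover have "f a = g a + - C * indicator halfline a" if "a \<ge> 0" for a
    using C[OF that] that by (auto simp: g_def)
  then have "K f = K g + - C * K (indicator halfline)" if K: "sigma_functional K" for K
    using sigma_functional_cong[OF K f, of "\<lambda>a. g a + - C * indicator halfline a"]
      sigma_functional_add[OF K g, of "\<lambda>a. - C * indicator halfline a"]
      sigma_functional_cmult[OF K, of "indicator halfline" "- C"]
      bounded_measurable_cmult[of "indicator halfline" "- C"]
      bounded_measurable_indicator[of halfline] sets.top[of borel_halfline]
    by (simp add: space_restrict_space)
  moreover have "L (indicator halfline) = J (indicator halfline)"
    using eq[of halfline] sets.top[of borel_halfline] by (simp add: space_restrict_space)
  ultimately show ?thesis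
    by (metis L J)
qed

text \<open>The values on indicators form the measure; bounded convergence along finite unions gives
  countable additivity. Measures are constructed below by writing down their action on functions and
  applying this lemma.\<close>

lemma signed_measure_of_functional:
  assumes L: "sigma_functional L"
  obtains \<nu> where "\<nu> \<in> signed_measures"
    "\<And>f. f \<in> bounded_measurable \<Longrightarrow> signed_integral \<nu> f = L f"
proof -
  define \<nu> where "\<nu> A = (if A \<in> sets borel_halfline then L (indicator A) else 0)" for A
  have "\<nu> \<in> signed_measures"
    unfolding signed_measures_def
  proof (intro CollectI conjI allI impI)
    have "L (\<lambda>a. 0 * indicator {} a) = 0 * L (indicator {})"
      by (rule sigma_functional_cmult[OF L bounded_measurable_indicator]) simp
    then show "\<nu> {} = 0"
      by (simp add: \<nu>_def indicator_def[abs_def])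
  next
    fix A :: "nat \<Rightarrow> real set"
    assume "range A \<subseteq> sets borel_halfline" and dis: "disjoint_family A"
    then have A: "A n \<in> sets borel_halfline" for n by auto
    note ind = bounded_measurable_indicator[OF A]
    define U where "U n = (\<Union>i<n. A i)" for n
    have Um: "U n \<in> sets borel_halfline" "(\<Union>n. A n) \<in> sets borel_halfline" for n
      using A unfolding U_def by blast+
    have U: "indicator (U n) = (\<lambda>a. \<Sum>i<n. indicator (A i) a :: real)" for n
      unfolding U_def using dis
      by (intro ext indicator_UN_disjoint) (auto simp: disjoint_family_on_def)
    have "(\<lambda>n. L (indicator (U n))) \<longlonglongrightarrow> L (indicator (\<Union>n. A n))"
    proof (rule sigma_functional_tendsto[OF L bounded_measurable_indicator bounded_measurable_indicator,
          OF Um, where C = 1])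
      show "\<bar>indicator (U n) a\<bar> \<le> (1::real)" for n a
        by (simp add: indicator_def)
      show "(\<lambda>n. indicator (U n) a :: real) \<longlonglongrightarrow> indicator (\<Union>n. A n) a" for a
        unfolding U_def by (rule LIMSEQ_indicator_UN)
    qed
    moreover have "L (indicator (U n)) = (\<Sum>i<n. L (indicator (A i)))" for n
      unfolding U by (rule sigma_functional_sum[OF L ind])
    ultimately show "(\<lambda>n. \<nu> (A n)) sums \<nu> (\<Union>n. A n)"
      using A Um by (simp add: \<nu>_def sums_def)
  qed (simp add: \<nu>_def)
  moreover have "signed_integral \<nu> f = L f" if "f \<in> bounded_measurable" for f
    by (rule sigma_functional_eqI[OF sigma_functional_signed_integral L _ that, OF \<open>\<nu> \<in> _\<close>])
       (use signed_integral_indicator[OF \<open>\<nu> \<in> _\<close>] in \<open>simp add: \<nu>_def\<close>)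
  ultimately show thesis
    by (rule that)
qed

text \<open>On the half-line the test functions are the compactly supported continuous ones. Ramps
  falling to 0 just after \<open>b\<close> converge to the indicator of \<open>{..b}\<close>, so the
  measures agree on a generating class stable under intersection, and a Dynkin induction does the
  rest.\<close>

lemma signed_measure_eqI:
  assumes mu: "\<mu> \<in> signed_measures" and nu: "\<nu> \<in> signed_measures"
    and eq: "\<And>f R. continuous_on UNIV f \<Longrightarrow> (\<And>a. a \<ge> R \<Longrightarrow> f a = 0) \<Longrightarrow>
      signed_integral \<mu> f = signed_integral \<nu> f"
  shows "\<mu> = \<nu>"
proof -
  have S: "A \<inter> halfline \<in> sets borel_halfline" if "A \<in> sets borel" for A
    using that by (auto simp: sets_restrict_space)
  have Icc: "\<mu> ({..b} \<inter> halfline) = \<nu> ({..b} \<inter> halfline)" for b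
  proof -
    define F where "F n a = max 0 (min 1 (1 + real n * (b - a)))" for n a
    have cont: "continuous_on X (F n)" for n X
      unfolding F_def by (intro continuous_intros)
    have bnd: "\<bar>F n a\<bar> \<le> 1" for n a
      by (auto simp: F_def)
    have Fb: "F n \<in> bounded_measurable" for n
      by (rule bounded_measurable_continuous[OF cont bnd])
    have lim: "(\<lambda>n. F n a) \<longlonglongrightarrow> indicator ({..b} \<inter> halfline) a" if "a \<ge> 0" for a
    proof (cases "a \<le> b")
      case True
      then have "F n a = 1" for n by (simp add: F_def)
      then show ?thesis using True that by simp
    next
      case False
      then obtain m where m: "1 < real m * (a - b)"
        using reals_Archimedean3[of "a - b"] by auto
      have "F n a = 0" if "n \<ge> m" for n
      proof -
        have "real m * (a - b) \<le> real n * (a - b)"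
          using that False by (intro mult_right_mono) auto
        then show ?thesis
          using m by (simp add: F_def algebra_simps)
      qed
      then have "(\<lambda>n. F n a) \<longlonglongrightarrow> 0"
        by (intro tendsto_eventually eventually_sequentiallyI)
      then show ?thesis using False by simp
    qed
    have ind: "indicator ({..b} \<inter> halfline) \<in> bounded_measurable"
      by (intro bounded_measurable_indicator S) simp
    \<comment> \<open>\<open>F 0\<close> is constantly 1 and hence not an admissible test function;
      for \<open>n \<ge> 1\<close> the ramp has ended at \<open>b + 1\<close>.\<close>
    have eqF: "signed_integral \<mu> (F n) = signed_integral \<nu> (F n)" if "n \<ge> 1" for n
    proof (rule eq[OF cont])
      show "F n a = 0" if "a \<ge> b + 1" for a
      proof -
        have "1 * 1 \<le> real n * (a - b)"
          using that \<open>n \<ge> 1\<close> by (intro mult_mono) auto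
        then show ?thesis
          by (simp add: F_def algebra_simps)
      qed
    qed
    have "(\<lambda>n. signed_integral \<mu> (F n)) \<longlonglongrightarrow> signed_integral \<mu> (indicator ({..b} \<inter> halfline))"
      by (rule sigma_functional_tendsto[OF sigma_functional_signed_integral[OF mu] Fb ind bnd lim])
    moreover have "(\<lambda>n. signed_integral \<nu> (F n)) \<longlonglongrightarrow> signed_integral \<nu> (indicator ({..b} \<inter> halfline))"
      by (rule sigma_functional_tendsto[OF sigma_functional_signed_integral[OF nu] Fb ind bnd lim])
    then have "(\<lambda>n. signed_integral \<mu> (F n)) \<longlonglongrightarrow> signed_integral \<nu> (indicator ({..b} \<inter> halfline))"
      by (rule Lim_transform_eventually) (use eqF in \<open>auto intro: eventually_sequentiallyI[of 1]\<close>)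
    ultimately have "signed_integral \<mu> (indicator ({..b} \<inter> halfline)) =
        signed_integral \<nu> (indicator ({..b} \<inter> halfline))"
      by (rule LIMSEQ_unique)
    then show ?thesis
      using signed_integral_indicator[OF mu S] signed_integral_indicator[OF nu S] by simp
  qed
  \<comment> \<open>Needed for complements in the Dynkin induction. The constant 1 does not vanish
    far out, so the total mass is reached by exhausting the half-line.\<close>
  have total: "\<mu> halfline = \<nu> halfline"
  proof -
    have ind: "indicator ({..real n} \<inter> halfline) \<in> bounded_measurable"
      "indicator halfline \<in> bounded_measurable" for n
      using S[of UNIV] by (auto intro!: bounded_measurable_indicator S)
    have lim: "(\<lambda>n. indicator ({..real n} \<inter> halfline) a :: real) \<longlonglongrightarrow> indicator halfline a" for a
    proof (rule tendsto_eventually)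
      obtain m where "a \<le> real m" using real_arch_simple by blast
      then show "\<forall>\<^sub>F n in sequentially. indicator ({..real n} \<inter> halfline) a = (indicator halfline a :: real)"
        by (intro eventually_sequentiallyI[of m]) (auto simp: indicator_def)
    qed
    have conv: "(\<lambda>n. signed_integral \<kappa> (indicator ({..real n} \<inter> halfline))) \<longlonglongrightarrow> signed_integral \<kappa> (indicator halfline)"
      if "\<kappa> \<in> signed_measures" for \<kappa>
      by (rule sigma_functional_tendsto[OF sigma_functional_signed_integral[OF that] ind _ lim, where C = 1])
         (simp add: indicator_def)
    have "(\<lambda>n. \<kappa> ({..real n} \<inter> halfline)) \<longlonglongrightarrow> \<kappa> halfline" if "\<kappa> \<in> signed_measures" for \<kappa>
      using conv[OF that] S[of UNIV] signed_integral_indicator[OF that, of halfline]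
      unfolding signed_integral_indicator[OF that S, OF borel_closed[OF closed_atMost]] by simp
    from this[OF mu] this[OF nu] show ?thesis
      unfolding Icc by (rule LIMSEQ_unique)
  qed
  have all: "\<mu> (A \<inter> halfline) = \<nu> (A \<inter> halfline)" if "A \<in> sets borel" for A
  proof -
    have gen: "sets borel = sigma_sets UNIV (range (atMost :: real \<Rightarrow> _))"
      by (subst borel_eq_atMost) simp
    show ?thesis
    proof (rule sigma_sets_induct_disjoint[where G = "range atMost" and \<Omega> = UNIV
          and P = "\<lambda>A. \<mu> (A \<inter> halfline) = \<nu> (A \<inter> halfline)"])
      show "Int_stable (range (atMost :: real \<Rightarrow> _))"
        unfolding Int_stable_def by (auto intro: range_eqI[of _ _ "min a b" for a b :: real])
      show "A \<in> sigma_sets UNIV (range atMost)"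
        using that gen by simp
      show "\<mu> (B \<inter> halfline) = \<nu> (B \<inter> halfline)" if "B \<in> range atMost" for B
        using that Icc by auto
      show "\<mu> ({} \<inter> halfline) = \<nu> ({} \<inter> halfline)"
        by (simp add: signed_measure_empty[OF mu] signed_measure_empty[OF nu])
    next
      fix B assume "B \<in> sigma_sets UNIV (range (atMost :: real \<Rightarrow> _))"
        and e: "\<mu> (B \<inter> halfline) = \<nu> (B \<inter> halfline)"
      then have B: "B \<in> sets borel" using gen by simp
      have "(UNIV - B) \<inter> halfline = halfline - B \<inter> halfline" by auto
      moreover have D: "\<kappa> (halfline - B \<inter> halfline) = \<kappa> halfline - \<kappa> (B \<inter> halfline)"
        if "\<kappa> \<in> signed_measures" for \<kappa>
        using S[OF B] S[of UNIV] by (intro signed_measure_Diff that) auto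
      ultimately show "\<mu> ((UNIV - B) \<inter> halfline) = \<nu> ((UNIV - B) \<inter> halfline)"
        using D[OF mu] D[OF nu] e total by simp
    next
      fix B :: "nat \<Rightarrow> real set"
      assume dis: "disjoint_family B" and "range B \<subseteq> sigma_sets UNIV (range atMost)"
        and e: "\<And>i. \<mu> (B i \<inter> halfline) = \<nu> (B i \<inter> halfline)"
      then have B: "B i \<in> sets borel" for i using gen by auto
      have "(\<Union>i. B i) \<inter> halfline = (\<Union>i. B i \<inter> halfline)" by auto
      moreover have "(\<lambda>i. \<kappa> (B i \<inter> halfline)) sums \<kappa> (\<Union>i. B i \<inter> halfline)"
        if "\<kappa> \<in> signed_measures" for \<kappa>
        using dis by (intro signed_measure_sums that S B) (auto simp: disjoint_family_on_def)
      from this[OF mu] this[OF nu] have "\<mu> (\<Union>i. B i \<inter> halfline) = \<nu> (\<Union>i. B i \<inter> halfline)"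
        unfolding e by (rule sums_unique2)
      ultimately show "\<mu> ((\<Union>i. B i) \<inter> halfline) = \<nu> ((\<Union>i. B i) \<inter> halfline)"
        by simp
    qed simp
  qed
  show ?thesis
  proof
    fix A
    show "\<mu> A = \<nu> A"
    proof (cases "A \<in> sets borel_halfline")
      case True
      then obtain B where "B \<in> sets borel" "A = B \<inter> halfline"
        by (auto simp: sets_restrict_space)
      then show ?thesis using all by simp
    next
      case False
      then show ?thesis
        using mu nu unfolding signed_measures_def by simp
    qed
  qed
qed

section \<open>Dependence on a parameter and interchange of integrals\<close>

lemma sigma_functional_continuous_param:
  fixes g :: "'s::metric_space \<Rightarrow> real \<Rightarrow> real"
  assumes L: "sigma_functional L"
    and g: "\<And>s. s \<in> T \<Longrightarrow> g s \<in> bounded_measurable"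
    and bnd: "\<And>s a. s \<in> T \<Longrightarrow> a \<ge> 0 \<Longrightarrow> \<bar>g s a\<bar> \<le> C"
    and cont: "\<And>a. a \<ge> 0 \<Longrightarrow> continuous_on T (\<lambda>s. g s a)"
  shows "continuous_on T (\<lambda>s. L (g s))"
  unfolding continuous_on_sequentially comp_def
proof (intro allI ballI impI, elim conjE)
  fix x s assume s: "s \<in> T" and x: "\<forall>n. x n \<in> T" "x \<longlonglongrightarrow> s"
  show "(\<lambda>n. L (g (x n))) \<longlonglongrightarrow> L (g s)"
  proof (rule sigma_functional_tendsto[OF L])
    show "(\<lambda>n. g (x n) a) \<longlonglongrightarrow> g s a" if "a \<ge> 0" for a
      using cont[OF that] s x unfolding continuous_on_sequentially comp_def by blast
  qed (use s x g bnd in auto)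
qed

lemma integral_swap_finite_measure:
  fixes g :: "real \<Rightarrow> real \<Rightarrow> real"
  assumes M: "finite_measure M" "sets M = sets borel_halfline"
    and cont: "continuous_on ({0..t} \<times> halfline) (\<lambda>(s, a). g s a)"
    and bnd: "\<And>s a. s \<in> {0..t} \<Longrightarrow> a \<ge> 0 \<Longrightarrow> \<bar>g s a\<bar> \<le> C"
  shows "(\<integral>a. integral {0..t} (\<lambda>s. g s a) \<partial>M) = integral {0..t} (\<lambda>s. \<integral>a. g s a \<partial>M)"
proof -
  interpret M: finite_measure M by fact
  interpret P: pair_sigma_finite M lborel ..
  have sp: "space M = halfline"
    using sets_eq_imp_space_eq[OF M(2)] by (simp add: space_restrict_space)
  have conta: "continuous_on {0..t} (\<lambda>s. g s a)" if "a \<ge> 0" for a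
    by (rule continuous_on_compose2[OF cont, of _ "\<lambda>s. (s, a)", simplified])
       (use that in \<open>auto intro!: continuous_intros\<close>)
  have gb: "g s \<in> bounded_measurable" if "s \<in> {0..t}" for s
    by (rule bounded_measurable_continuous[OF _ bnd[OF that]],
        rule continuous_on_compose2[OF cont, of _ "\<lambda>a. (s, a)", simplified])
       (use that in \<open>auto intro!: continuous_intros\<close>)
  \<comment> \<open>\<open>g\<close> is known to be continuous on the strip only; extension by 0
    makes it measurable on the whole product.\<close>
  define G where "G a s = indicator ({0..t} \<times> halfline) (s, a) *\<^sub>R g s a" for a s
  have "(\<lambda>x. indicator ({0..t} \<times> halfline) x *\<^sub>R (case x of (s, a) \<Rightarrow> g s a)) \<in> borel_measurable borel"
    by (rule borel_measurable_continuous_on_indicator[OF _ cont]) (auto intro!: borel_closed closed_Times)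
  moreover have "(\<lambda>(a, s). (s, a)) \<in> M \<Otimes>\<^sub>M lborel \<rightarrow>\<^sub>M (borel :: (real \<times> real) measure)"
  proof -
    have "(\<lambda>a. a) \<in> M \<rightarrow>\<^sub>M borel"
      unfolding measurable_cong_sets[OF M(2) refl] by (intro measurable_restrict_space1) simp
    then have "fst \<in> M \<Otimes>\<^sub>M lborel \<rightarrow>\<^sub>M borel"
      using measurable_compose[OF measurable_fst] by (simp add: comp_def)
    then show ?thesis
      unfolding borel_prod[symmetric] split_beta'
      by (intro measurable_Pair) auto
  qed
  ultimately have meas: "(\<lambda>(a, s). G a s) \<in> borel_measurable (M \<Otimes>\<^sub>M lborel)"
    by (rule measurable_compose[rotated, THEN measurable_cong[THEN iffD1, rotated]])
       (auto simp: G_def)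
  have int: "integrable (M \<Otimes>\<^sub>M lborel) (\<lambda>(a, s). G a s)"
  proof (rule integrableI_bounded_set[where A = "halfline \<times> {0..t}" and B = C])
    have h: "halfline \<in> sets M"
      using sets.top[of M] sp by simp
    then show "halfline \<times> {0..t} \<in> sets (M \<Otimes>\<^sub>M lborel)"
      by simp
    show "emeasure (M \<Otimes>\<^sub>M lborel) (halfline \<times> {0..t}) < \<infinity>"
      using h by (subst lborel.emeasure_pair_measure_Times)
        (auto simp: ennreal_mult_less_top M.emeasure_eq_measure emeasure_lborel_Icc_eq)
    have "norm (G a s) \<le> C" if "a \<ge> 0" "s \<in> {0..t}" for a s
      using bnd[OF that(2,1)] that by (simp add: G_def)
    then show "AE x in M \<Otimes>\<^sub>M lborel. x \<in> halfline \<times> {0..t} \<longrightarrow> norm (case x of (a, s) \<Rightarrow> G a s) \<le> C"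
      by (intro AE_I2) fastforce
    show "AE x in M \<Otimes>\<^sub>M lborel. x \<notin> halfline \<times> {0..t} \<longrightarrow> (case x of (a, s) \<Rightarrow> G a s) = 0"
      by (intro AE_I2) (auto simp: G_def indicator_def split: if_splits)
  qed (rule meas)
  have L: "(\<integral>s. G a s \<partial>lborel) = integral {0..t} (\<lambda>s. g s a)" if "a \<ge> 0" for a
  proof -
    have "G a s = indicator {0..t} s *\<^sub>R g s a" for s
      using that by (auto simp: G_def indicator_def)
    then show ?thesis
      using set_borel_integral_eq_integral(2)[OF borel_integrable_atLeastAtMost'[OF conta[OF that]]]
      by (simp add: set_lebesgue_integral_def)
  qed
  have contI: "continuous_on {0..t} (\<lambda>s. \<integral>a. g s a \<partial>M)"
    by (rule sigma_functional_continuous_param[OF sigma_functional_integral[OF M] gb bnd conta])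
  have "(\<integral>a. integral {0..t} (\<lambda>s. g s a) \<partial>M) = (\<integral>a. (\<integral>s. G a s \<partial>lborel) \<partial>M)"
    by (rule Bochner_Integration.integral_cong) (auto simp: sp L)
  also have "\<dots> = (\<integral>s. (\<integral>a. G a s \<partial>M) \<partial>lborel)"
    by (rule P.Fubini_integral[OF int, symmetric])
  also have "\<dots> = (\<integral>s. indicator {0..t} s *\<^sub>R (\<integral>a. g s a \<partial>M) \<partial>lborel)"
  proof (rule Bochner_Integration.integral_cong[OF refl])
    fix s
    have "(\<integral>a. G a s \<partial>M) = (\<integral>a. indicator {0..t} s *\<^sub>R g s a \<partial>M)"
      by (rule Bochner_Integration.integral_cong) (auto simp: sp G_def indicator_def)
    then show "(\<integral>a. G a s \<partial>M) = indicator {0..t} s *\<^sub>R (\<integral>a. g s a \<partial>M)"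
      by simp
  qed
  also have "\<dots> = integral {0..t} (\<lambda>s. \<integral>a. g s a \<partial>M)"
    using set_borel_integral_eq_integral(2)[OF borel_integrable_atLeastAtMost'[OF contI]]
    by (simp add: set_lebesgue_integral_def)
  finally show ?thesis .
qed

lemma signed_integral_swap:
  fixes g :: "real \<Rightarrow> real \<Rightarrow> real"
  assumes mu: "\<mu> \<in> signed_measures"
    and cont: "continuous_on ({0..t} \<times> halfline) (\<lambda>(s, a). g s a)"
    and bnd: "\<And>s a. s \<in> {0..t} \<Longrightarrow> a \<ge> 0 \<Longrightarrow> \<bar>g s a\<bar> \<le> C"
  shows "signed_integral \<mu> (\<lambda>a. integral {0..t} (\<lambda>s. g s a)) =
    integral {0..t} (\<lambda>s. signed_integral \<mu> (g s))"
proof -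
  have conta: "continuous_on {0..t} (\<lambda>s. g s a)" if "a \<ge> 0" for a
    by (rule continuous_on_compose2[OF cont, of _ "\<lambda>s. (s, a)", simplified])
       (use that in \<open>auto intro!: continuous_intros\<close>)
  have gb: "g s \<in> bounded_measurable" if "s \<in> {0..t}" for s
    by (rule bounded_measurable_continuous[OF _ bnd[OF that]],
        rule continuous_on_compose2[OF cont, of _ "\<lambda>a. (s, a)", simplified])
       (use that in \<open>auto intro!: continuous_intros\<close>)
  note P = finite_measure_jordan_pos[OF mu] sets_jordan_pos[of \<mu>]
  note N = finite_measure_jordan_neg[OF mu] jordan_neg_simps(1)[of \<mu>]
  \<comment> \<open>Continuity in \<open>s\<close> makes both Jordan parts integrable in time, so
    the integral of their difference splits.\<close>
  have "continuous_on {0..t} (\<lambda>s. \<integral>a. g s a \<partial>jordan_pos \<mu>)"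
    by (rule sigma_functional_continuous_param[OF sigma_functional_integral[OF P] gb bnd conta])
  moreover have "continuous_on {0..t} (\<lambda>s. \<integral>a. g s a \<partial>jordan_neg \<mu>)"
    by (rule sigma_functional_continuous_param[OF sigma_functional_integral[OF N] gb bnd conta])
  ultimately show ?thesis
    using integral_swap_finite_measure[OF P cont bnd] integral_swap_finite_measure[OF N cont bnd]
    by (simp add: signed_integral_def Henstock_Kurzweil_Integration.integral_diff integrable_continuous_real)
qed

section \<open>Convolution on the half-line and Volterra equations\<close>

text \<open>For \<open>t < 0\<close> the interval is empty and the value is 0.\<close>

definition conv :: "(real \<Rightarrow> real) \<Rightarrow> (real \<Rightarrow> real) \<Rightarrow> real \<Rightarrow> real" where
  "conv f g t = integral {0..t} (\<lambda>s. f s * g (t - s))"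

lemma conv_cong:
  assumes "\<And>s. 0 \<le> s \<Longrightarrow> s \<le> t \<Longrightarrow> f s = f' s" "\<And>s. 0 \<le> s \<Longrightarrow> s \<le> t \<Longrightarrow> g s = g' s"
  shows "conv f g t = conv f' g' t"
  unfolding conv_def by (rule integral_cong) (use assms in auto)

lemma conv_integrable:
  fixes f g :: "real \<Rightarrow> real"
  assumes "continuous_on UNIV f" "continuous_on UNIV g"
  shows "(\<lambda>s. f s * g (t - s)) integrable_on {a..b::real}"
  by (intro integrable_continuous_real continuous_intros continuous_on_compose2[OF assms(1)]
      continuous_on_compose2[OF assms(2)]) auto

lemma conv_commute: "conv f g t = conv g f t"
proof -
  have "conv f g t = integral {-t..-0} (\<lambda>x. f (-x) * g (t + x))"
    unfolding conv_def
    by (subst Henstock_Kurzweil_Integration.integral_reflect_real[symmetric]) simp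
  also have "\<dots> = integral {0-t..t-t} (\<lambda>x. f (t - (x + t)) * g (x + t))"
    by (simp add: add.commute)
  also have "\<dots> = integral {0..t} (\<lambda>y. f (t - y) * g y)"
    by (rule integral_shift_real_ivl)
  finally show ?thesis
    by (simp add: conv_def mult.commute)
qed

lemma conv_diff_left:
  assumes "continuous_on UNIV f" "continuous_on UNIV g" "continuous_on UNIV h"
  shows "conv (\<lambda>s. f s - g s) h t = conv f h t - conv g h t"
  unfolding conv_def left_diff_distrib
  by (rule Henstock_Kurzweil_Integration.integral_diff) (intro conv_integrable assms)+

lemma conv_diff_right:
  assumes "continuous_on UNIV f" "continuous_on UNIV g" "continuous_on UNIV h"
  shows "conv h (\<lambda>s. f s - g s) t = conv h f t - conv h g t"
  using conv_diff_left[OF assms] by (simp add: conv_commute[of h])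

text \<open>The substitution \<open>s = t x\<close> moves the variable limit of integration into the integrand.\<close>

lemma continuous_on_integral_upper:
  fixes h :: "'a::topological_space \<Rightarrow> real \<Rightarrow> real"
  assumes cont: "continuous_on (U \<times> halfline) (\<lambda>(x, s). h x s)"
    and t: "continuous_on U t" "\<And>x. x \<in> U \<Longrightarrow> t x \<ge> 0"
  shows "continuous_on U (\<lambda>x. integral {0..t x} (h x))"
proof -
  have eq: "integral {0..t x} (h x) = t x * integral (cbox 0 1) (\<lambda>y. h x (t x * y))" if "x \<in> U" for x
  proof (cases "t x = 0")
    case False
    then have pos: "t x > 0" using t(2)[OF that] by simp
    have "continuous_on {0..t x} (h x)"
      by (rule continuous_on_compose2[OF cont, of _ "\<lambda>s. (x, s)", simplified])
         (use that in \<open>auto intro!: continuous_intros\<close>)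
    then have "(h x has_integral integral {0..t x} (h x)) (cbox 0 (t x))"
      by (simp add: integrable_continuous_real integrable_integral)
    from has_integral_affinity[OF this False, of 0]
    have "((\<lambda>y. h x (t x * y)) has_integral (integral {0..t x} (h x) / t x)) ((\<lambda>y. y / t x) ` {0..t x})"
      using pos by (simp add: divide_inverse mult.commute)
    moreover have "(\<lambda>y. y / t x) ` {0..t x} = cbox 0 1"
      using pos image_divide_atLeastAtMost[of "t x" 0 "t x"] by simp
    ultimately show ?thesis
      using pos by (simp add: integral_unique field_simps)
  qed simp
  have "continuous_on U (\<lambda>x. t x * integral (cbox 0 1) (\<lambda>y. h x (t x * y)))"
  proof (intro continuous_on_mult t integral_continuous_on_param)
    have "continuous_on (U \<times> cbox 0 1) (\<lambda>p. (fst p, t (fst p) * snd p))"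
      by (intro continuous_intros continuous_on_compose2[OF t(1)]) auto
    moreover have "(\<lambda>p. (fst p, t (fst p) * snd p)) ` (U \<times> cbox 0 1) \<subseteq> U \<times> halfline"
      using t(2) by auto
    ultimately have "continuous_on (U \<times> cbox 0 1) (\<lambda>p. case (fst p, t (fst p) * snd p) of (x, s) \<Rightarrow> h x s)"
      by (rule continuous_on_compose2[OF cont])
    then show "continuous_on (U \<times> cbox 0 1) (\<lambda>(x, y). h x (t x * y))"
      by (simp add: split_beta')
  qed
  then show ?thesis
    by (rule continuous_on_eq) (use eq in simp)
qed

lemma conv_continuous:
  assumes "continuous_on UNIV f" "continuous_on UNIV g"
  shows "continuous_on halfline (conv f g)"
  unfolding conv_def
proof (rule continuous_on_integral_upper)
  show "continuous_on (halfline \<times> halfline) (\<lambda>(t, s). f s * g (t - s))"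
    unfolding split_beta'
    by (intro continuous_intros continuous_on_compose2[OF assms(1)] continuous_on_compose2[OF assms(2)]) auto
qed (auto intro: continuous_intros)

text \<open>Freezing a function at its value in 0 extends it from the half-line to the line. Most
  arguments \<open>max 0 s\<close> below are this extension, since the convolution lemmas ask for
  continuity on \<open>UNIV\<close>.\<close>

lemma continuous_on_max0:
  assumes "continuous_on halfline f"
  shows "continuous_on X (\<lambda>x::real. f (max 0 x))"
  by (rule continuous_on_compose2[OF assms]) (auto intro!: continuous_intros)

lemma integral_swap_triangle:
  fixes h :: "real \<Rightarrow> real \<Rightarrow> real"
  assumes cont: "continuous_on UNIV (\<lambda>(t, s). h t s)"
  shows "integral {0..T} (\<lambda>t. integral {0..t} (h t)) = integral {0..T} (\<lambda>s. integral {s..T} (\<lambda>t. h t s))"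
proof -
  \<comment> \<open>The closed triangle of both iterated integrals. Cut off outside this compact
    set, the integrand is integrable on the plane, and its slices are the two inner
    integrals.\<close>
  define D where "D = {p :: real \<times> real. 0 \<le> snd p \<and> snd p \<le> fst p \<and> fst p \<le> T}"
  define G where "G t s = indicator D (t, s) *\<^sub>R h t s" for t s
  have "compact D"
  proof -
    have "closed D"
      unfolding D_def by (intro closed_Collect_conj closed_Collect_le continuous_intros)
    moreover have "D \<subseteq> {0..T} \<times> {0..T}" by (auto simp: D_def)
    ultimately show ?thesis
      by (metis compact_Icc compact_Int_closed compact_Times inf.absorb_iff2)
  qed
  then have int: "integrable (lborel \<Otimes>\<^sub>M lborel) (\<lambda>(t, s). G t s)"
    using borel_integrable_compact[of D "\<lambda>(t, s). h t s"] continuous_on_subset[OF cont, of D]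
    by (simp add: lborel_prod G_def split_beta')
  have ct: "continuous_on X (h t)" "continuous_on X (\<lambda>t. h t s)" for t s X
    by (rule continuous_on_compose2[OF cont, of _ "\<lambda>s. (t, s)", simplified],
        intro continuous_intros)
       (rule continuous_on_compose2[OF cont, of _ "\<lambda>t. (t, s)", simplified],
        intro continuous_intros)
  have I: "(\<integral>s. indicator {a..b} s * f s \<partial>lborel) = integral {a..b} f"
    if "continuous_on {a..b} f" for a b :: real and f :: "real \<Rightarrow> real"
    using set_borel_integral_eq_integral(2)[OF borel_integrable_atLeastAtMost'[OF that]]
    by (simp add: set_lebesgue_integral_def)
  have inner: "(\<integral>s. G t s \<partial>lborel) = indicator {0..T} t * integral {0..t} (h t)" for t
  proof -
    have "G t s = indicator {0..T} t * (indicator {0..t} s * h t s)" for s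
      by (auto simp: G_def D_def indicator_def)
    then show ?thesis
      using I[OF ct(1)] by simp
  qed
  have inner': "(\<integral>t. G t s \<partial>lborel) = indicator {0..T} s * integral {s..T} (\<lambda>t. h t s)" for s
  proof -
    have "G t s = indicator {0..T} s * (indicator {s..T} t * h t s)" for t
      by (auto simp: G_def D_def indicator_def)
    then show ?thesis
      using I[OF ct(2)] by simp
  qed
  have "continuous_on {0..T} (\<lambda>t. integral {0..t} (h t))"
    by (rule continuous_on_integral_upper) (auto intro: continuous_on_subset[OF cont] continuous_intros)
  moreover have "continuous_on {0..T} (\<lambda>s. integral {s..T} (\<lambda>t. h t s))"
  proof -
    \<comment> \<open>The substitution \<open>t = x + s\<close> moves the lower limit to 0, the
      shape covered by \<open>continuous_on_integral_upper\<close>.\<close>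
    have "continuous_on {0..T} (\<lambda>s. integral {0..T - s} (\<lambda>x. h (x + s) s))"
      by (rule continuous_on_integral_upper)
         (auto simp: split_beta' intro!: continuous_intros
           continuous_on_compose2[OF cont, of _ "\<lambda>p. (snd p + fst p, fst p)", simplified split_beta' fst_conv snd_conv])
    moreover have "integral {0..T - s} (\<lambda>x. h (x + s) s) = integral {s..T} (\<lambda>t. h t s)" for s
      using integral_shift_real_ivl[of s s T "\<lambda>t. h t s"] by simp
    ultimately show ?thesis by simp
  qed
  moreover have "(\<integral>t. (\<integral>s. G t s \<partial>lborel) \<partial>lborel) = (\<integral>s. (\<integral>t. G t s \<partial>lborel) \<partial>lborel)"
    by (rule lborel_pair.Fubini_integral[OF int, symmetric])
  ultimately show ?thesis
    unfolding inner inner' by (simp add: I)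
qed

text \<open>Fubini on the triangle, then the shift \<open>t = x + s\<close> in the inner
  integral.\<close>

lemma conv_assoc:
  assumes f: "continuous_on UNIV f" and g: "continuous_on UNIV g" and h: "continuous_on UNIV h"
  shows "conv (conv f g) h T = conv f (conv g h) T"
proof -
  have "conv (conv f g) h T = integral {0..T} (\<lambda>t. integral {0..t} (\<lambda>s. f s * g (t - s) * h (T - t)))"
    by (simp only: conv_def Henstock_Kurzweil_Integration.integral_mult_left)
  also have "\<dots> = integral {0..T} (\<lambda>s. integral {s..T} (\<lambda>t. f s * g (t - s) * h (T - t)))"
    unfolding split_beta'
    by (rule integral_swap_triangle) (auto simp: split_beta' intro!: continuous_intros
        continuous_on_compose2[OF f] continuous_on_compose2[OF g] continuous_on_compose2[OF h])
  also have "\<dots> = integral {0..T} (\<lambda>s. f s * conv g h (T - s))"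
  proof (rule integral_cong)
    fix s
    have "integral {s..T} (\<lambda>t. f s * g (t - s) * h (T - t)) =
        integral {s - s..T - s} (\<lambda>x. f s * g (x + s - s) * h (T - (x + s)))"
      by (rule integral_shift_real_ivl[symmetric])
    also have "\<dots> = integral {0..T - s} (\<lambda>x. f s * (g x * h (T - s - x)))"
      by (simp add: algebra_simps)
    finally show "integral {s..T} (\<lambda>t. f s * g (t - s) * h (T - t)) = f s * conv g h (T - s)"
      by (simp add: conv_def)
  qed
  finally show ?thesis
    by (simp add: conv_def[of f])
qed

text \<open>Banach's fixed point theorem for \<open>exp (- 2 K t) v(t)\<close>: the weighted kernel has mass at most \<open>1/2\<close>.\<close>

lemma volterra_exists:
  assumes k: "continuous_on UNIV k" "\<And>t. t \<ge> 0 \<Longrightarrow> \<bar>k t\<bar> \<le> K" and "K > 0"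
    and g: "continuous_on UNIV g" "\<And>t. t \<ge> 0 \<Longrightarrow> \<bar>g t\<bar> \<le> G"
  obtains v where "continuous_on UNIV v" "\<And>t. t \<ge> 0 \<Longrightarrow> v t = g t + conv k v t"
proof -
  define \<kappa> where "\<kappa> s = exp (- (2 * K * s)) * k s" for s
  define \<gamma> where "\<gamma> s = exp (- (2 * K * s)) * g s" for s
  have \<kappa>: "continuous_on UNIV \<kappa>" and \<gamma>: "continuous_on UNIV \<gamma>"
    unfolding \<kappa>_def \<gamma>_def by (intro continuous_intros k g)+
  \<comment> \<open>Evaluation at \<open>max 0 t\<close> yields an operator on the complete space of
    bounded continuous functions on the whole line.\<close>
  define \<Phi> where "\<Phi> w t = \<gamma> (max 0 t) + conv \<kappa> w (max 0 t)" for w t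
  have mass: "integral {0..t} (\<lambda>s. \<bar>\<kappa> s\<bar>) \<le> 1/2" for t
  proof (cases "t \<ge> 0")
    case True
    \<comment> \<open>The weight \<open>K * exp (- (2 * K * s))\<close> has mass
      \<open>(1 - exp (- (2 * K * t))) / 2\<close>: the factor 2 in the exponent becomes the
      contraction constant.\<close>
    have "((\<lambda>s. K * exp (- (2 * K * s))) has_integral (- exp (- (2 * K * t)) / 2 - - exp (- (2 * K * 0)) / 2)) {0..t}"
      by (rule fundamental_theorem_of_calculus[OF True])
         (use \<open>K > 0\<close> in \<open>auto intro!: derivative_eq_intros simp: has_real_derivative_iff_has_vector_derivative[symmetric]\<close>)
    moreover have "\<bar>\<kappa> s\<bar> \<le> K * exp (- (2 * K * s))" if "s \<in> {0..t}" for s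
      using k(2)[of s] that by (simp add: \<kappa>_def abs_mult mult.commute)
    ultimately have "integral {0..t} (\<lambda>s. \<bar>\<kappa> s\<bar>) \<le> (- exp (- (2 * K * t)) / 2 - - exp (- (2 * K * 0)) / 2)"
      by (intro has_integral_le[OF integrable_integral])
         (auto intro!: integrable_continuous_real continuous_intros continuous_on_subset[OF \<kappa>])
    moreover have "exp (- (2 * K * 0)) = 1" by simp
    ultimately show ?thesis
      using exp_gt_zero[of "- (2 * K * t)"] by linarith
  qed simp
  have bnd: "\<bar>conv \<kappa> w t\<bar> \<le> 1/2 * C" if "continuous_on UNIV w" "\<And>s. \<bar>w s\<bar> \<le> C" for w C t
  proof -
    have "C \<ge> 0" using that(2)[of 0] by linarith
    have "norm (conv \<kappa> w t) \<le> integral {0..t} (\<lambda>s. \<bar>\<kappa> s\<bar> * C)"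
      unfolding conv_def
    proof (rule integral_norm_bound_integral)
      show "(\<lambda>s. \<bar>\<kappa> s\<bar> * C) integrable_on {0..t}"
        by (intro integrable_continuous_real continuous_intros continuous_on_subset[OF \<kappa>]) auto
      show "norm (\<kappa> s * w (t - s)) \<le> \<bar>\<kappa> s\<bar> * C" for s
        using that(2)[of "t - s"] by (simp add: abs_mult mult_left_mono)
    qed (intro conv_integrable \<kappa> that)
    also have "\<dots> = integral {0..t} (\<lambda>s. \<bar>\<kappa> s\<bar>) * C"
      by simp
    also have "\<dots> \<le> 1/2 * C"
      by (intro mult_right_mono mass \<open>C \<ge> 0\<close>)
    finally show ?thesis by simp
  qed
  have \<Phi>: "\<Phi> (apply_bcontfun w) \<in> bcontfun" for w
  proof (rule bcontfun_normI)
    show "continuous_on UNIV (\<Phi> (apply_bcontfun w))"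
      unfolding \<Phi>_def
      by (intro continuous_on_add continuous_on_max0 continuous_on_subset[OF \<gamma>] conv_continuous[OF \<kappa>]) auto
    have "\<bar>\<gamma> (max 0 t)\<bar> \<le> G" for t
    proof -
      have "exp (- (2 * K * max 0 t)) * \<bar>g (max 0 t)\<bar> \<le> 1 * G"
        using \<open>K > 0\<close> g(2)[of "max 0 t"] by (intro mult_mono) auto
      then show ?thesis by (simp add: \<gamma>_def abs_mult)
    qed
    moreover have "\<bar>conv \<kappa> w t\<bar> \<le> 1/2 * norm w" for t
      by (rule bnd) (use norm_bounded[of w] in auto)
    ultimately show "norm (\<Phi> w t) \<le> G + 1/2 * norm w" for t
      unfolding \<Phi>_def real_norm_def by (rule order_trans[OF abs_triangle_ineq add_mono])
  qed
  have "\<exists>!w. Bcontfun (\<Phi> (apply_bcontfun w)) = w"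
  proof (rule banach_fix_type[of "1/2"]; (intro allI)?)
    fix w w' :: "real \<Rightarrow>\<^sub>C real"
    show "dist (Bcontfun (\<Phi> w)) (Bcontfun (\<Phi> w')) \<le> 1/2 * dist w w'"
    proof (rule dist_bound)
      fix t
      have "\<Phi> w t - \<Phi> w' t = conv \<kappa> (apply_bcontfun (w - w')) (max 0 t)"
        by (simp add: \<Phi>_def conv_diff_right[symmetric] \<kappa> minus_bcontfun.rep_eq)
      moreover have "\<bar>conv \<kappa> (apply_bcontfun (w - w')) (max 0 t)\<bar> \<le> 1/2 * norm (w - w')"
        by (rule bnd[OF continuous_on_apply_bcontfun]) (use norm_bounded[of "w - w'"] in auto)
      ultimately show "dist (Bcontfun (\<Phi> w) t) (Bcontfun (\<Phi> w') t) \<le> 1/2 * dist w w'"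
        by (simp add: Bcontfun_inverse \<Phi> dist_norm)
    qed
  qed auto
  then obtain w where w: "Bcontfun (\<Phi> (apply_bcontfun w)) = w" by blast
  have w_eq: "apply_bcontfun w t = \<Phi> w t" for t
    using arg_cong[OF w, of "\<lambda>u. apply_bcontfun u t"] by (simp add: Bcontfun_inverse \<Phi>)
  show thesis
  proof (rule that[of "\<lambda>t. exp (2 * K * t) * w t"])
    show "continuous_on UNIV (\<lambda>t. exp (2 * K * t) * w t)"
      by (intro continuous_intros) auto
    fix t :: real assume "t \<ge> 0"
    \<comment> \<open>The weight is undone by writing \<open>exp (2 * K * t)\<close> as
      \<open>exp (2 * K * s)\<close> times \<open>exp (2 * K * (t - s))\<close>, one factor for each
      function in the convolution.\<close>
    have "exp (2 * K * t) * conv \<kappa> w t = integral {0..t} (\<lambda>s. exp (2 * K * t) * (\<kappa> s * w (t - s)))"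
      by (simp add: conv_def)
    also have "\<dots> = conv k (\<lambda>t. exp (2 * K * t) * w t) t"
      unfolding conv_def
    proof (rule integral_cong)
      fix s
      have "exp (2 * K * t) * exp (- (2 * K * s)) = exp (2 * K * (t - s))"
        by (simp add: exp_add[symmetric] algebra_simps)
      then show "exp (2 * K * t) * (\<kappa> s * w (t - s)) = k s * (exp (2 * K * (t - s)) * w (t - s))"
        by (simp add: \<kappa>_def)
    qed
    moreover have "exp (2 * K * t) * \<gamma> t = g t"
      by (simp add: \<gamma>_def exp_minus field_simps)
    ultimately show "exp (2 * K * t) * w t = g t + conv k (\<lambda>t. exp (2 * K * t) * w t) t"
      using \<open>t \<ge> 0\<close> by (subst w_eq) (simp add: \<Phi>_def distrib_left)
  qed
qed

text \<open>With \<open>S' = -k\<close> the kernel has mass \<open>1 - S(t)\<close> on \<open>[0,t]\<close>; compare at a maximum of \<open>\<bar>v\<bar>\<close>.\<close>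

lemma volterra_bound:
  assumes k: "continuous_on UNIV k" "\<And>t. t \<ge> 0 \<Longrightarrow> k t \<ge> 0"
    and S: "\<And>t. t \<ge> 0 \<Longrightarrow> S t > 0" "\<And>t. t \<ge> 0 \<Longrightarrow> integral {0..t} k = 1 - S t"
    and v: "continuous_on UNIV v" "\<And>t. t \<ge> 0 \<Longrightarrow> v t = g t + conv k v t"
    and g: "\<And>t. t \<ge> 0 \<Longrightarrow> \<bar>g t\<bar> \<le> C * S t" and "T \<ge> 0"
  shows "\<bar>v T\<bar> \<le> C"
proof -
  obtain t where t: "t \<in> {0..T}" and max: "\<And>s. s \<in> {0..T} \<Longrightarrow> \<bar>v s\<bar> \<le> \<bar>v t\<bar>"
    using continuous_attains_sup[of "{0..T}" "\<lambda>s. \<bar>v s\<bar>"] \<open>T \<ge> 0\<close>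
      continuous_on_rabs[OF continuous_on_subset[OF v(1), of "{0..T}"]] by auto
  have "norm (conv k v t) \<le> integral {0..t} (\<lambda>s. k s * \<bar>v t\<bar>)"
    unfolding conv_def
  proof (rule integral_norm_bound_integral)
    show "(\<lambda>s. k s * \<bar>v t\<bar>) integrable_on {0..t}"
      by (intro integrable_continuous_real continuous_intros continuous_on_subset[OF k(1)]) auto
    show "norm (k s * v (t - s)) \<le> k s * \<bar>v t\<bar>" if "s \<in> {0..t}" for s
      using that t k(2)[of s] max[of "t - s"] by (simp add: abs_mult mult_left_mono)
  qed (intro conv_integrable k v)
  also have "\<dots> = (1 - S t) * \<bar>v t\<bar>"
    using S(2) t by simp
  finally have "\<bar>v t\<bar> \<le> C * S t + (1 - S t) * \<bar>v t\<bar>"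
    using v(2)[of t] g[of t] t by simp
  \<comment> \<open>Absorbing the convolution term leaves \<open>S t\<close> in front of
    \<open>\<bar>v t\<bar>\<close>; it is positive and cancels, whatever the length \<open>T\<close>
    of the interval.\<close>
  then have "S t * \<bar>v t\<bar> \<le> S t * C"
    by (simp add: algebra_simps)
  then have "\<bar>v t\<bar> \<le> C"
    using S(1)[of t] t by simp
  then show ?thesis
    using max[of T] \<open>T \<ge> 0\<close> by simp
qed

section \<open>Test functions and functionals\<close>

text \<open>\<open>G\<close> is the sum of the total masses of the two Jordan parts.\<close>

lemma signed_integral_bound:
  assumes mu: "\<mu> \<in> signed_measures"
  obtains G where "G \<ge> 0" "\<And>f C. f \<in> bounded_measurable \<Longrightarrow> (\<And>a. a \<ge> 0 \<Longrightarrow> \<bar>f a\<bar> \<le> C) \<Longrightarrow>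
    \<bar>signed_integral \<mu> f\<bar> \<le> G * C"
proof -
  have bnd: "\<bar>\<integral>a. f a \<partial>M\<bar> \<le> measure M halfline * C"
    if M: "finite_measure M" "sets M = sets borel_halfline"
      and f: "f \<in> bounded_measurable" "\<And>a. a \<ge> 0 \<Longrightarrow> \<bar>f a\<bar> \<le> C" for M f C
  proof -
    interpret finite_measure M by fact
    have sp: "space M = halfline"
      using sets_eq_imp_space_eq[OF M(2)] by (simp add: space_restrict_space)
    have "\<bar>\<integral>a. f a \<partial>M\<bar> \<le> (\<integral>a. \<bar>f a\<bar> \<partial>M)"
      by (rule integral_abs_bound)
    also have "\<dots> \<le> (\<integral>a. C \<partial>M)"
      using finite_measure_integrable_bounded_measurable[OF M f(1)] f(2) sp
      by (intro integral_mono) auto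
    finally show ?thesis using sp by simp
  qed
  show thesis
  proof (rule that[of "measure (jordan_pos \<mu>) halfline + measure (jordan_neg \<mu>) halfline"])
    fix f C assume f: "f \<in> bounded_measurable" "\<And>a. a \<ge> 0 \<Longrightarrow> \<bar>f a\<bar> \<le> C"
    show "\<bar>signed_integral \<mu> f\<bar> \<le> (measure (jordan_pos \<mu>) halfline + measure (jordan_neg \<mu>) halfline) * C"
      using bnd[OF finite_measure_jordan_pos[OF mu] sets_jordan_pos f]
        bnd[OF finite_measure_jordan_neg[OF mu] jordan_neg_simps(1) f]
      by (simp add: signed_integral_def distrib_right)
  qed simp
qed

text \<open>For \<open>L\<close> the integral against a measure, this is the image under translation
  by \<open>t\<close> of that measure weighted with \<open>h\<close>; with the survival probability
  as \<open>h\<close> it describes the survivors of the initial population.\<close>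

lemma sigma_functional_shift_mult:
  assumes L: "sigma_functional L" and h: "h \<in> bounded_measurable" and t: "t \<ge> 0"
  shows "sigma_functional (\<lambda>f. L (\<lambda>a. f (a + t) * h a))"
proof -
  obtain H where H: "H > 0" "\<And>a. a \<ge> 0 \<Longrightarrow> \<bar>h a\<bar> \<le> H"
    using h by (meson bounded_measurableE)
  have bm: "(\<lambda>a. f (a + t) * h a) \<in> bounded_measurable" if "f \<in> bounded_measurable" for f
    by (intro bounded_measurable_mult bounded_measurable_shift that h t)
  show ?thesis
    unfolding sigma_functional_def
  proof (intro conjI ballI allI impI)
    show "L (\<lambda>a. (f (a + t) + g (a + t)) * h a) = L (\<lambda>a. f (a + t) * h a) + L (\<lambda>a. g (a + t) * h a)"
      if "f \<in> bounded_measurable" "g \<in> bounded_measurable" for f g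
      using sigma_functional_add[OF L bm[OF that(1)] bm[OF that(2)]] by (simp add: distrib_right)
    show "L (\<lambda>a. c * f (a + t) * h a) = c * L (\<lambda>a. f (a + t) * h a)"
      if "f \<in> bounded_measurable" for f c
      using sigma_functional_cmult[OF L bm[OF that], of c] by (simp add: mult.assoc)
    fix F :: "nat \<Rightarrow> real \<Rightarrow> real" and f C
    assume F: "\<forall>n. F n \<in> bounded_measurable" "f \<in> bounded_measurable"
      and C: "\<forall>n. \<forall>a\<ge>0. \<bar>F n a\<bar> \<le> C" and lim: "\<forall>a\<ge>0. (\<lambda>n. F n a) \<longlonglongrightarrow> f a"
    show "(\<lambda>n. L (\<lambda>a. F n (a + t) * h a)) \<longlonglongrightarrow> L (\<lambda>a. f (a + t) * h a)"
    proof (rule sigma_functional_tendsto[OF L bm bm])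
      show "\<bar>F n (a + t) * h a\<bar> \<le> C * H" if "a \<ge> 0" for n a
      proof -
        have "\<bar>F n (a + t)\<bar> \<le> C" using C that t by simp
        moreover have "C \<ge> 0" using C by (meson abs_ge_zero order_refl order_trans)
        ultimately show ?thesis
          unfolding abs_mult using H(2)[OF that] by (intro mult_mono) auto
      qed
      show "(\<lambda>n. F n (a + t) * h a) \<longlonglongrightarrow> f (a + t) * h a" if "a \<ge> 0" for a
        using lim that t by (intro tendsto_intros) auto
    qed (use F in auto)
  qed
qed

lemma sigma_functional_plus:
  assumes L: "sigma_functional L" and J: "sigma_functional J"
  shows "sigma_functional (\<lambda>f. L f + J f)"
  unfolding sigma_functional_def
proof (intro conjI ballI allI impI)
  fix F :: "nat \<Rightarrow> real \<Rightarrow> real" and f C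
  assume F: "\<forall>n. F n \<in> bounded_measurable" "f \<in> bounded_measurable"
    "\<forall>n. \<forall>a\<ge>0. \<bar>F n a\<bar> \<le> C" "\<forall>a\<ge>0. (\<lambda>n. F n a) \<longlonglongrightarrow> f a"
  then show "(\<lambda>n. L (F n) + J (F n)) \<longlonglongrightarrow> L f + J f"
    by (intro tendsto_add sigma_functional_tendsto[OF L, where C = C]
        sigma_functional_tendsto[OF J, where C = C]) auto
qed (simp_all add: sigma_functional_add[OF L] sigma_functional_add[OF J]
      sigma_functional_cmult[OF L] sigma_functional_cmult[OF J] distrib_left)

text \<open>Lebesgue measure on \<open>[0,t]\<close>, realised as a finite measure on the half-line.
  For continuous functions its integral is the gauge integral in which \<open>conv\<close> is
  written.\<close>

lemma sigma_functional_Icc: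
  obtains J where "sigma_functional J"
    "\<And>f. continuous_on halfline f \<Longrightarrow> J f = integral {0..t} f"
proof -
  define M where "M = restrict_space (density lborel (\<lambda>s. ennreal (indicator {0..t} s))) halfline"
  have sets: "sets M = sets borel_halfline"
    unfolding M_def by (rule sets_restrict_space_cong) simp
  have "emeasure M (space M) \<le> emeasure (density lborel (\<lambda>s. ennreal (indicator {0..t} s))) UNIV"
    unfolding M_def by (subst emeasure_restrict_space) (auto intro!: emeasure_mono)
  also have "\<dots> = emeasure lborel {0..t}"
    by (subst emeasure_density) (auto simp: ennreal_indicator)
  also have "\<dots> < top"
    by (simp add: emeasure_lborel_Icc_eq)
  finally have fin: "finite_measure M"
    by (intro finite_measureI) simp
  show thesis
  proof (rule that[OF sigma_functional_integral[OF fin sets]])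
    fix f :: "real \<Rightarrow> real" assume f: "continuous_on halfline f"
    have m: "(\<lambda>s. indicator halfline s *\<^sub>R f s) \<in> borel_measurable borel"
      by (rule borel_measurable_continuous_on_indicator[OF _ f]) simp
    have "(\<integral>s. f s \<partial>M) = (\<integral>s. indicator halfline s *\<^sub>R f s \<partial>density lborel (\<lambda>s. ennreal (indicator {0..t} s)))"
      unfolding M_def by (subst integral_restrict_space) auto
    also have "\<dots> = (\<integral>s. indicator {0..t} s *\<^sub>R (indicator halfline s *\<^sub>R f s) \<partial>lborel)"
      by (rule integral_density) (use m in auto)
    also have "\<dots> = (\<integral>s. indicator {0..t} s *\<^sub>R f s \<partial>lborel)"
      by (rule Bochner_Integration.integral_cong) (auto simp: indicator_def)
    also have "\<dots> = integral {0..t} f"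
      using set_borel_integral_eq_integral(2)[OF borel_integrable_atLeastAtMost', of 0 t f]
        continuous_on_subset[OF f, of "{0..t}"] by (simp add: set_lebesgue_integral_def)
    finally show "(\<integral>s. f s \<partial>M) = integral {0..t} f" .
  qed
qed

section \<open>Function classes on the half-line\<close>

lemma CbI: "continuous_on halfline f \<Longrightarrow> (\<And>a. a \<ge> 0 \<Longrightarrow> \<bar>f a\<bar> \<le> C) \<Longrightarrow> f \<in> Cb"
  unfolding Cb_def bounded_iff by auto

lemma Cb_continuous: "f \<in> Cb \<Longrightarrow> continuous_on halfline f"
  unfolding Cb_def by blast

lemma Cb_bound:
  assumes "f \<in> Cb"
  obtains C where "C > 0" "\<And>a. a \<ge> 0 \<Longrightarrow> \<bar>f a\<bar> \<le> C"
  using bounded_measurableE[OF Cb_bounded_measurable[OF assms]] by blast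

lemma C0_subset_Cb: "C0 \<subseteq> Cb"
proof
  fix f :: "real \<Rightarrow> real" assume f: "f \<in> C0"
  then have cont: "continuous_on halfline f" and lim: "(f \<longlongrightarrow> 0) at_top"
    unfolding C0_def by auto
  obtain R where R: "\<And>a. a \<ge> R \<Longrightarrow> \<bar>f a\<bar> < 1"
    using tendstoD[OF lim, of 1] by (auto simp: eventually_at_top_linorder)
  have "bounded (f ` {0..R})"
    by (intro compact_imp_bounded compact_continuous_image continuous_on_subset[OF cont]) auto
  then obtain C where C: "\<And>a. a \<in> {0..R} \<Longrightarrow> \<bar>f a\<bar> \<le> C"
    unfolding bounded_iff by force
  show "f \<in> Cb"
  proof (rule CbI[OF cont])
    show "\<bar>f a\<bar> \<le> max 1 C" if "a \<ge> 0" for a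
      using C[of a] R[of a] that by (cases "a \<ge> R") auto
  qed
qed

lemma Cb_add: "f \<in> Cb \<Longrightarrow> g \<in> Cb \<Longrightarrow> (\<lambda>a. f a + g a) \<in> Cb"
  unfolding Cb_def by (auto intro!: continuous_intros bounded_plus_comp)

lemma Cb_mult:
  assumes "f \<in> Cb" "g \<in> Cb"
  shows "(\<lambda>a. f a * g a) \<in> Cb"
proof -
  obtain C where C: "\<And>a. a \<ge> 0 \<Longrightarrow> \<bar>f a * g a\<bar> \<le> C"
    using bounded_measurableE[OF bounded_measurable_mult[OF assms[THEN Cb_bounded_measurable]]] by blast
  show ?thesis
    by (rule CbI[OF _ C]) (intro continuous_intros Cb_continuous assms)
qed

lemma Cb_cmult: "f \<in> Cb \<Longrightarrow> (\<lambda>a. c * f a) \<in> Cb"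
  by (rule Cb_mult) (auto intro: CbI[where C = "\<bar>c\<bar>"])

lemma Cb_diff: "f \<in> Cb \<Longrightarrow> g \<in> Cb \<Longrightarrow> (\<lambda>a. f a - g a) \<in> Cb"
  using Cb_add[of f "\<lambda>a. -1 * g a"] Cb_cmult[of g "-1"] by simp

lemma C1_has_derivative:
  assumes "f \<in> C1" "a \<ge> 0"
  shows "(f has_real_derivative deriv_halfline f a) (at a within halfline)"
  using assms vector_derivative_works[of f "at a within halfline"]
    differentiable_on_def[of f halfline]
  unfolding C1_def deriv_halfline_def has_real_derivative_iff_has_vector_derivative by auto

text \<open>Every point of the half-line, 0 included, can be approached from the right inside it, so
  the relative derivative is unique.\<close>

lemma deriv_halfline_eqI:
  assumes "(f has_real_derivative D) (at a within halfline)" "a \<ge> 0"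
  shows "deriv_halfline f a = D"
proof -
  have "at_right a \<le> at a within halfline"
    by (rule at_le) (use assms(2) in auto)
  then have "at a within halfline \<noteq> bot"
    using trivial_limit_at_right_real[of a] by (metis bot.extremum_uniqueI)
  then show ?thesis
    unfolding deriv_halfline_def
    using assms(1) by (intro vector_derivative_within) (auto simp: has_real_derivative_iff_has_vector_derivative)
qed

lemma C1I:
  assumes "\<And>a. a \<ge> 0 \<Longrightarrow> (f has_real_derivative D a) (at a within halfline)" "continuous_on halfline D"
  shows "f \<in> C1"
proof -
  have "continuous_on halfline (deriv_halfline f)"
    by (rule continuous_on_eq[OF assms(2)]) (use deriv_halfline_eqI[OF assms(1)] in simp)
  moreover have "f differentiable_on halfline"
    unfolding differentiable_on_def using assms(1) by (auto simp: has_field_derivative_def differentiable_def)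
  ultimately show ?thesis
    unfolding C1_def by blast
qed

lemma C1c_Cb:
  assumes "f \<in> C1c"
  shows "f \<in> Cb" "deriv_halfline f \<in> Cb"
proof -
  have f: "f \<in> C1" and "compact (closure {a \<in> halfline. f a \<noteq> 0})"
    using assms unfolding C1c_def by auto
  then have "bounded {a \<in> halfline. f a \<noteq> 0}"
    using bounded_subset[OF compact_imp_bounded closure_subset] by blast
  then obtain R where R: "\<And>a. a \<ge> 0 \<Longrightarrow> f a \<noteq> 0 \<Longrightarrow> \<bar>a\<bar> \<le> R"
    unfolding bounded_iff by auto
  have fz: "f a = 0" if "a \<ge> \<bar>R\<bar> + 1" for a
    using R[of a] that by force
  \<comment> \<open>One unit further out than in \<open>fz\<close>, so that \<open>f\<close>
    vanishes on an open neighbourhood of \<open>a\<close>.\<close>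
  have dz: "deriv_halfline f a = 0" if "a \<ge> \<bar>R\<bar> + 2" for a
  proof (rule deriv_halfline_eqI)
    have "(f has_real_derivative 0) (at a)"
      by (rule has_field_derivative_transform_within_open[where f = "\<lambda>_. 0" and S = "{\<bar>R\<bar> + 1<..}"])
         (use that fz in auto)
    then show "(f has_real_derivative 0) (at a within halfline)"
      by (rule has_field_derivative_at_within)
  qed (use that in auto)
  have "h \<in> C0" if "continuous_on halfline h" "\<And>a. a \<ge> \<bar>R\<bar> + 2 \<Longrightarrow> h a = 0" for h
    unfolding C0_def using that
    by (auto intro!: tendsto_eventually exI[of _ "\<bar>R\<bar> + 2"] simp: eventually_at_top_linorder)
  moreover have "continuous_on halfline f"
    using DERIV_continuous_on[of halfline f] C1_has_derivative[OF f] by auto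
  moreover have "continuous_on halfline (deriv_halfline f)"
    using f unfolding C1_def by blast
  ultimately show "f \<in> Cb" "deriv_halfline f \<in> Cb"
    using C0_subset_Cb fz dz by auto
qed

lemma conv_continuous_UNIV:
  assumes "continuous_on UNIV f" "continuous_on UNIV g"
  shows "continuous_on UNIV (conv f g)"
proof -
  have "conv f g t = conv f g (max 0 t)" for t
    by (cases "t \<ge> 0") (auto simp: conv_def)
  then show ?thesis
    using continuous_on_max0[OF conv_continuous[OF assms], of UNIV] by simp
qed

section \<open>The renewal semigroup\<close>

text \<open>Continuity and bounds are asked for on the whole line, which spares side conditions on
  ages; the theorem enters the locale with \<open>\<beta> (max 0 a)\<close>.\<close>

locale renewal =
  fixes \<beta> :: "real \<Rightarrow> real" and K :: real
  assumes \<beta>_cont: "continuous_on UNIV \<beta>"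
    and \<beta>_nonneg: "\<And>a. \<beta> a \<ge> 0"
    and \<beta>_le: "\<And>a. \<beta> a \<le> K"
    and K_pos: "K > 0"
begin

definition B :: "real \<Rightarrow> real" where "B a = integral {0..a} \<beta>"

text \<open>The survival probability S_a(t) for nonnegative \<open>a\<close> and \<open>t\<close>.
  Written with the primitive \<open>B\<close>, its joint continuity follows from that of
  \<open>B\<close>.\<close>

definition surv :: "real \<Rightarrow> real \<Rightarrow> real" where "surv a t = exp (B a - B (a + t))"

text \<open>Density of the first renewal time of an individual of age \<open>a\<close>, that is,
  minus the time derivative of \<open>surv a t\<close>.\<close>

definition rate :: "real \<Rightarrow> real \<Rightarrow> real" where "rate a t = \<beta> (a + t) * surv a t"

lemma \<beta>_Cb: "\<beta> \<in> Cb"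
  by (rule CbI[where C = K]) (use \<beta>_nonneg \<beta>_le in \<open>auto intro: continuous_on_subset[OF \<beta>_cont]\<close>)

lemma B_0 [simp]: "B 0 = 0"
  by (simp add: B_def)

lemma B_derivative:
  assumes "a \<ge> 0"
  shows "(B has_real_derivative \<beta> a) (at a within halfline)"
proof -
  have "((\<lambda>u. integral {0..u} \<beta>) has_real_derivative \<beta> a) (at a within {0..a + 1})"
    by (rule integral_has_real_derivative) (use assms in \<open>auto intro: continuous_on_subset[OF \<beta>_cont]\<close>)
  moreover have "at a within {0..a + 1} = at a within halfline"
    by (rule at_within_nhd[of a "{..<a + 1}"]) auto
  ultimately show ?thesis
    by (simp add: B_def[abs_def])
qed

lemma B_cont: "continuous_on X B"
proof -
  have "B a = B (max 0 a)" for a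
    by (cases "a \<ge> 0") (auto simp: B_def)
  moreover have "continuous_on halfline B"
    using DERIV_continuous_on[of halfline B \<beta>] B_derivative by auto
  ultimately show ?thesis
    using continuous_on_max0[of B X] by simp
qed

text \<open>The chain rule stays one-sided, because for \<open>a = 0\<close> and
  \<open>s = 0\<close> only a derivative within the half-line is available.\<close>

lemma shift_derivative:
  assumes "a \<ge> 0" "s \<in> {0..t}" "(f has_real_derivative D) (at (a + s) within halfline)"
  shows "((\<lambda>s. f (a + s)) has_real_derivative D) (at s within {0..t})"
proof -
  have "(f has_real_derivative D) (at (a + s) within (+) a ` {0..t})"
    by (rule has_field_derivative_subset[OF assms(3)]) (use assms in auto)
  then have "(f \<circ> (+) a has_real_derivative D * 1) (at s within {0..t})"
    by (rule DERIV_image_chain) (auto intro!: derivative_eq_intros)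
  then show ?thesis by (simp add: comp_def)
qed

lemma surv_derivative:
  assumes "a \<ge> 0" "s \<in> {0..t}"
  shows "((surv a) has_real_derivative - rate a s) (at s within {0..t})"
  unfolding surv_def[abs_def]
  using assms shift_derivative[OF assms B_derivative]
  by (auto intro!: derivative_eq_intros simp: rate_def surv_def)

lemma surv_0 [simp]: "surv a 0 = 1"
  by (simp add: surv_def)

lemma surv_pos: "surv a t > 0"
  by (simp add: surv_def)

lemma surv_cont [continuous_intros]:
  "continuous_on X f \<Longrightarrow> continuous_on X g \<Longrightarrow> continuous_on X (\<lambda>x. surv (f x) (g x))"
  unfolding surv_def
  by (intro continuous_intros continuous_on_compose2[OF B_cont[of UNIV]]) auto

lemma rate_cont [continuous_intros]:
  "continuous_on X f \<Longrightarrow> continuous_on X g \<Longrightarrow> continuous_on X (\<lambda>x. rate (f x) (g x))"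
  unfolding rate_def
  by (intro continuous_intros continuous_on_compose2[OF \<beta>_cont]) auto

lemma integral_\<beta>:
  assumes "a \<ge> 0" "t \<ge> 0"
  shows "integral {0..t} (\<lambda>u. \<beta> (a + u)) = B (a + t) - B a"
proof -
  have "((\<lambda>u. \<beta> (a + u)) has_integral (B (a + t) - B (a + 0))) {0..t}"
    by (rule fundamental_theorem_of_calculus)
       (use assms in \<open>auto intro!: shift_derivative B_derivative
         simp: has_real_derivative_iff_has_vector_derivative[symmetric]\<close>)
  then show ?thesis by (simp add: integral_unique)
qed

lemma integral_rate:
  assumes "a \<ge> 0" "t \<ge> 0"
  shows "integral {0..t} (rate a) = 1 - surv a t"
proof -
  have "(rate a has_integral ((- surv a t) - (- surv a 0))) {0..t}"
    by (rule fundamental_theorem_of_calculus)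
       (use assms in \<open>auto intro!: derivative_eq_intros surv_derivative
         simp: has_real_derivative_iff_has_vector_derivative[symmetric]\<close>)
  then show ?thesis by (simp add: integral_unique)
qed

lemma rate_nonneg: "rate a t \<ge> 0"
  by (simp add: rate_def \<beta>_nonneg surv_def)

lemma surv_le_1:
  assumes "a \<ge> 0" "t \<ge> 0"
  shows "surv a t \<le> 1"
proof -
  have "integral {0..t} (rate a) \<ge> 0"
    by (rule Henstock_Kurzweil_Integration.integral_nonneg)
       (auto intro!: integrable_continuous_real continuous_intros rate_nonneg)
  then show ?thesis
    using integral_rate[OF assms] by simp
qed

lemma rate_le:
  assumes "a \<ge> 0" "t \<ge> 0"
  shows "\<bar>rate a t\<bar> \<le> K"
  using mult_mono[OF \<beta>_le[of "a + t"] surv_le_1[OF assms]] rate_nonneg[of a t] K_pos surv_pos[of a t]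
  by (simp add: rate_def less_imp_le)

lemma conv_rate_bound:
  assumes v: "continuous_on UNIV v" "\<And>s. s \<ge> 0 \<Longrightarrow> \<bar>v s\<bar> \<le> C" and "a \<ge> 0" "t \<ge> 0"
  shows "\<bar>conv (rate a) v t\<bar> \<le> C * (1 - surv a t)"
proof -
  have r: "continuous_on X (rate a)" for X by (intro continuous_intros)
  have "norm (conv (rate a) v t) \<le> integral {0..t} (\<lambda>s. rate a s * C)"
    unfolding conv_def
  proof (rule integral_norm_bound_integral)
    show "(\<lambda>s. rate a s * C) integrable_on {0..t}"
      by (intro integrable_continuous_real continuous_intros)
    show "norm (rate a s * v (t - s)) \<le> rate a s * C" if "s \<in> {0..t}" for s
      using v(2)[of "t - s"] that rate_nonneg[of a s] by (simp add: abs_mult mult_left_mono)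
  qed (intro conv_integrable r v)
  then show ?thesis
    using integral_rate[OF assms(3,4)] by (simp add: mult.commute)
qed

text \<open>The case \<open>C = 0\<close> of \<open>volterra_bound\<close>, which asks for no growth
  bound on \<open>d\<close>.\<close>

lemma volterra_zero:
  assumes "continuous_on UNIV d" "\<And>t. t \<ge> 0 \<Longrightarrow> d t = conv (rate 0) d t" "t \<ge> 0"
  shows "d t = 0"
  using volterra_bound[of "rate 0" "surv 0" d "\<lambda>_. 0" 0 t] assms
  by (simp add: rate_nonneg surv_pos integral_rate continuous_intros)

lemma volterra_rate:
  assumes "continuous_on UNIV g" "\<And>t. t \<ge> 0 \<Longrightarrow> \<bar>g t\<bar> \<le> G"
  obtains v where "continuous_on UNIV v" "\<And>t. t \<ge> 0 \<Longrightarrow> v t = g t + conv (rate 0) v t"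
  using volterra_exists[of "rate 0" K g G] assms rate_le[of 0] K_pos
  by (auto simp: continuous_intros)

lemma duhamel_iff:
  "duhamel_solution \<beta> f0 f \<longleftrightarrow> (\<forall>t\<ge>0. \<forall>a\<ge>0.
     f (t, a) = f0 (a + t) * surv a t + conv (rate a) (\<lambda>s. f (s, 0)) t)"
proof -
  have "integral {0..t} (\<lambda>\<tau>. exp (- integral {0..\<tau>} (\<lambda>u. \<beta> (a + u))) * \<beta> (a + \<tau>) * f (t - \<tau>, 0)) =
      conv (rate a) (\<lambda>s. f (s, 0)) t" if "a \<ge> 0" for a t
    unfolding conv_def
    by (rule integral_cong) (use that in \<open>auto simp: integral_\<beta> rate_def surv_def\<close>)
  then show ?thesis
    unfolding duhamel_solution_def by (auto simp: integral_\<beta> surv_def)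
qed

text \<open>At \<open>a = 0\<close> the Duhamel formula is a closed Volterra equation for the trace
  \<open>v t = f (t, 0)\<close>, and all other values are explicit in terms of \<open>v\<close>.
  Solving for the trace gives existence, comparing two traces gives uniqueness, and so the definite
  description can be evaluated.\<close>

lemma right_semigroup_formula:
  assumes f0: "f0 \<in> Cb"
  obtains v where "continuous_on UNIV v"
    "\<And>t. t \<ge> 0 \<Longrightarrow> v t = f0 t * surv 0 t + conv (rate 0) v t"
    "\<And>t a. t \<ge> 0 \<Longrightarrow> a \<ge> 0 \<Longrightarrow> right_semigroup \<beta> t f0 a = f0 (a + t) * surv a t + conv (rate a) v t"
proof -
  let ?Q = "halfline \<times> halfline"
  obtain C where C: "C > 0" "\<And>a. a \<ge> 0 \<Longrightarrow> \<bar>f0 a\<bar> \<le> C"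
    using Cb_bound[OF f0] by blast
  define g where "g t = f0 (max 0 t) * surv 0 (max 0 t)" for t
  have g_cont: "continuous_on UNIV g"
    unfolding g_def by (intro continuous_intros continuous_on_max0 Cb_continuous f0)
  have g_le: "\<bar>g t\<bar> \<le> C * surv 0 t" if "t \<ge> 0" for t
    using C(2)[OF that] that surv_pos[of 0 t] by (simp add: g_def abs_mult mult_right_mono)
  have "\<bar>g t\<bar> \<le> C" if "t \<ge> 0" for t
    using order_trans[OF g_le[OF that] mult_left_mono[OF surv_le_1[of 0 t], of C]] C(1) that by simp
  then obtain v where v: "continuous_on UNIV v" "\<And>t. t \<ge> 0 \<Longrightarrow> v t = g t + conv (rate 0) v t"
    using volterra_rate[OF g_cont] by blast
  have v_le: "\<bar>v t\<bar> \<le> C" if "t \<ge> 0" for t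
    by (rule volterra_bound[OF _ _ _ _ v g_le that])
       (auto intro!: continuous_intros simp: rate_nonneg surv_pos integral_rate)
  define F where "F = restrict (\<lambda>(t, a). f0 (a + t) * surv a t + conv (rate a) v t) ?Q"
  have F0: "F (t, 0) = v t" if "t \<ge> 0" for t
    using that v(2)[OF that] by (simp add: F_def g_def)
  have "continuous_on ?Q (\<lambda>x. f0 (snd x + fst x) * surv (snd x) (fst x) + conv (rate (snd x)) v (fst x))"
  proof (intro continuous_on_add continuous_on_mult)
    show "continuous_on ?Q (\<lambda>x. f0 (snd x + fst x))"
      by (rule continuous_on_compose2[OF Cb_continuous[OF f0]]) (auto intro!: continuous_intros)
    show "continuous_on ?Q (\<lambda>x. conv (rate (snd x)) v (fst x))"
      unfolding conv_def
      by (rule continuous_on_integral_upper)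
         (auto simp: split_beta' intro!: continuous_intros continuous_on_compose2[OF v(1)])
  qed (intro continuous_intros)
  then have "continuous_on ?Q F"
    by (rule continuous_on_eq) (auto simp: F_def)
  moreover have "\<bar>F (t, a)\<bar> \<le> C" if "t \<ge> 0" "a \<ge> 0" for t a
  proof -
    \<comment> \<open>The two Duhamel terms carry the weights \<open>surv a t\<close> and
      \<open>1 - surv a t\<close>, so the bound \<open>C\<close> is preserved.\<close>
    have "\<bar>f0 (a + t) * surv a t\<bar> \<le> C * surv a t"
      using C(2)[of "a + t"] that surv_pos[of a t] by (simp add: abs_mult mult_right_mono)
    then show ?thesis
      using conv_rate_bound[OF v(1) v_le that(2,1)] that by (simp add: F_def right_diff_distrib)
  qed
  ultimately have "F \<in> Cb2"
    unfolding Cb2_def bounded_iff by auto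
  moreover have "F \<in> extensional ?Q"
    unfolding F_def by simp
  moreover have "duhamel_solution \<beta> f0 F"
    unfolding duhamel_iff
  proof (intro allI impI)
    fix t a :: real assume "t \<ge> 0" "a \<ge> 0"
    moreover have "conv (rate a) (\<lambda>s. F (s, 0)) t = conv (rate a) v t"
      by (rule conv_cong) (auto simp: F0)
    ultimately show "F (t, a) = f0 (a + t) * surv a t + conv (rate a) (\<lambda>s. F (s, 0)) t"
      by (simp add: F_def)
  qed
  moreover have "F' = F" if F': "F' \<in> Cb2" "F' \<in> extensional ?Q" "duhamel_solution \<beta> f0 F'" for F'
  proof -
    define w where "w t = F' (max 0 t, 0)" for t
    have "continuous_on halfline (\<lambda>t. F' (t, 0))"
      using F'(1) unfolding Cb2_def
      by (auto intro!: continuous_on_compose2[of ?Q F' halfline "\<lambda>t. (t, 0)"] continuous_intros)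
    then have w: "continuous_on UNIV w"
      unfolding w_def by (rule continuous_on_max0)
    have F'_eq: "F' (t, a) = f0 (a + t) * surv a t + conv (rate a) w t" if "t \<ge> 0" "a \<ge> 0" for t a
    proof -
      have "conv (rate a) (\<lambda>s. F' (s, 0)) t = conv (rate a) w t"
        by (rule conv_cong) (auto simp: w_def)
      then show ?thesis
        using F'(3) that unfolding duhamel_iff by simp
    qed
    have vw: "v t - w t = 0" if "t \<ge> 0" for t
    proof (rule volterra_zero[OF _ _ that])
      fix t :: real assume t: "t \<ge> 0"
      then have "w t = f0 t * surv 0 t + conv (rate 0) w t"
        using F'_eq[of t 0] by (simp add: w_def)
      then show "v t - w t = conv (rate 0) (\<lambda>t. v t - w t) t"
        using v(2)[OF t] t by (subst conv_diff_right) (auto simp: v w g_def continuous_intros)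
    qed (intro continuous_intros v w)
    show "F' = F"
    proof (rule extensionalityI[OF F'(2) \<open>F \<in> extensional ?Q\<close>])
      fix x assume "x \<in> ?Q"
      then obtain t a where x: "x = (t, a)" "t \<ge> 0" "a \<ge> 0" by auto
      have "conv (rate a) w t = conv (rate a) v t"
        by (rule conv_cong) (use vw in auto)
      then show "F' x = F x"
        using F'_eq[of t a] x by (simp add: F_def)
    qed
  qed
  ultimately have "(THE f. f \<in> Cb2 \<and> f \<in> extensional ?Q \<and> duhamel_solution \<beta> f0 f) = F"
    by (intro the_equality) blast+
  then have "right_semigroup \<beta> t f0 a = f0 (a + t) * surv a t + conv (rate a) v t"
    if "t \<ge> 0" "a \<ge> 0" for t a
    unfolding right_semigroup_def using that by (simp add: F_def)
  with v show thesis
    by (intro that[of v]) (auto simp: g_def)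
qed

section \<open>Birth rate and explicit form of the left semigroup\<close>

definition flux0 :: "(real set \<Rightarrow> real) \<Rightarrow> real \<Rightarrow> real" where
  "flux0 \<mu> t = signed_integral \<mu> (\<lambda>a. rate a (max 0 t))"

lemma rate_bounded_measurable: "t \<ge> 0 \<Longrightarrow> (\<lambda>a. rate a t) \<in> bounded_measurable"
  by (rule bounded_measurable_continuous[where C = K]) (auto intro!: continuous_intros rate_le)

lemma surv_bounded_measurable: "t \<ge> 0 \<Longrightarrow> (\<lambda>a. surv a t) \<in> bounded_measurable"
  by (rule bounded_measurable_continuous[where C = 1])
     (auto intro!: continuous_intros surv_le_1 simp: surv_pos less_imp_le)

text \<open>\<open>flux0\<close> counts the first renewals of the initial population,
  \<open>N\<close> all births; the convolution adds the renewals that follow an earlier birth. The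
  datum is bounded by \<open>K\<close> times the total variation, as \<open>volterra_rate\<close>
  requires.\<close>

lemma flux_exists:
  assumes mu: "\<mu> \<in> signed_measures"
  obtains N where "continuous_on UNIV (flux0 \<mu>)" "continuous_on UNIV N"
    "\<And>t. t \<ge> 0 \<Longrightarrow> N t = flux0 \<mu> t + conv (rate 0) N t"
proof -
  have cont: "continuous_on UNIV (flux0 \<mu>)"
    unfolding flux0_def
    by (rule sigma_functional_continuous_param[OF sigma_functional_signed_integral[OF mu], where C = K])
       (auto intro!: rate_bounded_measurable rate_le continuous_intros)
  obtain G where G: "\<And>f C. f \<in> bounded_measurable \<Longrightarrow> (\<And>a. a \<ge> 0 \<Longrightarrow> \<bar>f a\<bar> \<le> C) \<Longrightarrow>
      \<bar>signed_integral \<mu> f\<bar> \<le> G * C"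
    using signed_integral_bound[OF mu] by blast
  have "\<bar>flux0 \<mu> t\<bar> \<le> G * K" for t
    unfolding flux0_def by (rule G) (auto intro!: rate_bounded_measurable rate_le)
  then obtain N where "continuous_on UNIV N" "\<And>t. t \<ge> 0 \<Longrightarrow> N t = flux0 \<mu> t + conv (rate 0) N t"
    using volterra_rate[OF cont] by blast
  then show thesis
    by (rule that[OF cont])
qed

text \<open>The individuals born since time 0, as a measure: density
  \<open>N (t - s) * surv 0 s\<close> at age \<open>s\<close> in \<open>[0,t]\<close>.\<close>

lemma sigma_functional_conv:
  assumes N: "continuous_on UNIV N" and t: "t \<ge> 0"
  obtains J where "sigma_functional J"
    "\<And>f. f \<in> Cb \<Longrightarrow> J f = conv N (\<lambda>s. f (max 0 s) * surv 0 (max 0 s)) t"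
proof -
  \<comment> \<open>The outer \<open>max 0\<close> keeps the argument of \<open>N\<close> inside
    \<open>[0,t]\<close>, so \<open>w\<close> is bounded although \<open>N\<close> is not assumed to
    be.\<close>
  define w where "w s = N (max 0 (t - max 0 s)) * surv 0 (max 0 s)" for s
  have wc: "continuous_on X w" for X
    unfolding w_def by (intro continuous_intros continuous_on_compose2[OF N]) auto
  have "bounded (N ` {0..t})"
    by (intro compact_imp_bounded compact_continuous_image continuous_on_subset[OF N]) auto
  then obtain C where C: "\<And>s. s \<in> {0..t} \<Longrightarrow> \<bar>N s\<bar> \<le> C"
    unfolding bounded_iff by force
  have wb: "w \<in> Cb"
  proof (rule CbI[OF wc])
    show "\<bar>w s\<bar> \<le> C * 1" if "s \<ge> 0" for s
    proof -
      have "max 0 (t - max 0 s) \<in> {0..t}"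
        using that t by auto
      from C[OF this] show ?thesis
        unfolding w_def abs_mult using surv_le_1[of 0 "max 0 s"] surv_pos[of 0 "max 0 s"]
        by (intro mult_mono) auto
    qed
  qed
  obtain J where J: "sigma_functional J" "\<And>f. continuous_on halfline f \<Longrightarrow> J f = integral {0..t} f"
    using sigma_functional_Icc[of t] by blast
  show thesis
  proof (rule that)
    \<comment> \<open>With shift 0, \<open>sigma_functional_shift_mult\<close> is multiplication by
      the weight \<open>w\<close>.\<close>
    show "sigma_functional (\<lambda>f. J (\<lambda>a. f (a + 0) * w a))"
      by (intro sigma_functional_shift_mult J Cb_bounded_measurable wb) simp
    fix f assume f: "f \<in> Cb"
    have "J (\<lambda>a. f (a + 0) * w a) = integral {0..t} (\<lambda>a. f a * w a)"
      using J(2)[OF Cb_continuous[OF Cb_mult[OF f wb]]] by simp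
    also have "\<dots> = conv (\<lambda>s. f (max 0 s) * surv 0 (max 0 s)) N t"
      unfolding conv_def by (rule integral_cong) (auto simp: w_def)
    finally show "J (\<lambda>a. f (a + 0) * w a) = conv N (\<lambda>s. f (max 0 s) * surv 0 (max 0 s)) t"
      by (simp add: conv_commute[of N])
  qed
qed

lemma transported_measure:
  assumes mu: "\<mu> \<in> signed_measures" and N: "continuous_on UNIV N" and t: "t \<ge> 0"
  obtains \<nu> where "\<nu> \<in> signed_measures"
    "\<And>f. f \<in> Cb \<Longrightarrow> signed_integral \<nu> f =
      signed_integral \<mu> (\<lambda>a. f (a + t) * surv a t) + conv N (\<lambda>s. f (max 0 s) * surv 0 (max 0 s)) t"
proof -
  obtain J where J: "sigma_functional J"
    "\<And>f. f \<in> Cb \<Longrightarrow> J f = conv N (\<lambda>s. f (max 0 s) * surv 0 (max 0 s)) t"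
    using sigma_functional_conv[OF N t] by blast
  have "sigma_functional (\<lambda>f. signed_integral \<mu> (\<lambda>a. f (a + t) * surv a t) + J f)"
    by (intro sigma_functional_plus sigma_functional_shift_mult sigma_functional_signed_integral mu J
        surv_bounded_measurable t)
  then obtain \<nu> where "\<nu> \<in> signed_measures" "\<And>f. f \<in> bounded_measurable \<Longrightarrow>
      signed_integral \<nu> f = signed_integral \<mu> (\<lambda>a. f (a + t) * surv a t) + J f"
    using signed_measure_of_functional by blast
  then show thesis
    using that J(2) Cb_bounded_measurable by simp
qed

lemma Cb_shift_surv:
  assumes f: "f \<in> Cb"
  shows "continuous_on (halfline \<times> halfline) (\<lambda>(t, a). f (a + t) * surv a t)"
    and "\<exists>C. \<forall>t\<ge>0. \<forall>a\<ge>0. \<bar>f (a + t) * surv a t\<bar> \<le> C"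
proof -
  have "continuous_on (halfline \<times> halfline) (\<lambda>x. f (snd x + fst x))"
    by (rule continuous_on_compose2[OF Cb_continuous[OF f]]) (auto intro!: continuous_intros)
  then show "continuous_on (halfline \<times> halfline) (\<lambda>(t, a). f (a + t) * surv a t)"
    unfolding split_beta' by (intro continuous_intros)
  obtain C where C: "C > 0" "\<And>a. a \<ge> 0 \<Longrightarrow> \<bar>f a\<bar> \<le> C"
    using Cb_bound[OF f] by blast
  have "\<bar>f (a + t) * surv a t\<bar> \<le> C * 1" if "t \<ge> 0" "a \<ge> 0" for t a
    unfolding abs_mult using C that surv_le_1[of a t] surv_pos[of a t] by (intro mult_mono) auto
  then show "\<exists>C. \<forall>t\<ge>0. \<forall>a\<ge>0. \<bar>f (a + t) * surv a t\<bar> \<le> C" by auto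
qed

lemma Cb_shift_surv_section:
  assumes f: "f \<in> Cb"
  shows "t \<ge> 0 \<Longrightarrow> (\<lambda>a. f (a + t) * surv a t) \<in> bounded_measurable"
    and "a \<ge> 0 \<Longrightarrow> continuous_on halfline (\<lambda>t. f (a + t) * surv a t)"
proof -
  note c = Cb_shift_surv(1)[OF f]
  show "(\<lambda>a. f (a + t) * surv a t) \<in> bounded_measurable" if "t \<ge> 0"
    by (intro bounded_measurable_mult bounded_measurable_shift surv_bounded_measurable
        Cb_bounded_measurable f that)
  show "continuous_on halfline (\<lambda>t. f (a + t) * surv a t)" if "a \<ge> 0"
  proof -
    have "continuous_on halfline (\<lambda>t. (t, a))" "(\<lambda>t. (t, a)) ` halfline \<subseteq> halfline \<times> halfline"
      using that by (auto intro!: continuous_intros)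
    from continuous_on_compose2[OF c this] show ?thesis by simp
  qed
qed

text \<open>Birth rate and trace solve Volterra equations with the same kernel k =
  \<open>rate 0\<close>: N = n + k * N with n = \<open>flux0 \<mu>\<close>, and v = g + k * v, where
  * is convolution. Hence n * v = (N - N * k) * v = N * (v - k * v) = N * g, which trades the trace
  of the test function for the birth rate of the measure.\<close>

lemma signed_integral_right_semigroup:
  assumes mu: "\<mu> \<in> signed_measures" and f: "f \<in> Cb" and t: "t \<ge> 0"
    and N: "continuous_on UNIV (flux0 \<mu>)" "continuous_on UNIV N"
      "\<And>t. t \<ge> 0 \<Longrightarrow> N t = flux0 \<mu> t + conv (rate 0) N t"
  shows "signed_integral \<mu> (right_semigroup \<beta> t f) =
    signed_integral \<mu> (\<lambda>a. f (a + t) * surv a t) + conv N (\<lambda>s. f (max 0 s) * surv 0 (max 0 s)) t"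
proof -
  note L = sigma_functional_signed_integral[OF mu]
  define g where "g s = f (max 0 s) * surv 0 (max 0 s)" for s
  obtain v where v: "continuous_on UNIV v" "\<And>t. t \<ge> 0 \<Longrightarrow> v t = f t * surv 0 t + conv (rate 0) v t"
    "\<And>t a. t \<ge> 0 \<Longrightarrow> a \<ge> 0 \<Longrightarrow> right_semigroup \<beta> t f a = f (a + t) * surv a t + conv (rate a) v t"
    using right_semigroup_formula[OF f] by blast
  have rc: "continuous_on UNIV (rate 0)" by (intro continuous_intros)
  have gc: "continuous_on UNIV g"
    unfolding g_def by (intro continuous_intros continuous_on_max0 Cb_continuous f)
  have "bounded (v ` {0..t})"
    by (intro compact_imp_bounded compact_continuous_image continuous_on_subset[OF v(1)]) auto
  then obtain C where C: "\<And>s. s \<in> {0..t} \<Longrightarrow> \<bar>v s\<bar> \<le> C"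
    unfolding bounded_iff by force
  have cont: "continuous_on X (\<lambda>(s, a). rate a s * v (t - s))" for X
    unfolding split_beta' by (intro continuous_intros continuous_on_compose2[OF v(1)]) auto
  have bnd: "\<bar>rate a s * v (t - s)\<bar> \<le> K * C" if "s \<in> {0..t}" "a \<ge> 0" for s a
    unfolding abs_mult using rate_le[of a s] C[of "t - s"] that by (intro mult_mono) auto
  have conv_bm: "(\<lambda>a. conv (rate a) v t) \<in> bounded_measurable"
  proof (rule bounded_measurable_continuous)
    show "continuous_on halfline (\<lambda>a. conv (rate a) v t)"
      unfolding conv_def
      by (rule continuous_on_integral_upper)
         (auto simp: split_beta' t intro!: continuous_intros continuous_on_compose2[OF v(1)])
    show "\<bar>conv (rate a) v t\<bar> \<le> integral {0..t} (\<lambda>s. K * C)" if "a \<ge> 0" for a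
      unfolding conv_def real_norm_def[symmetric]
      by (rule integral_norm_bound_integral)
         (use bnd that in \<open>auto intro!: integrable_continuous_real continuous_intros
           continuous_on_compose2[OF v(1)]\<close>)
  qed
  have "signed_integral \<mu> (\<lambda>a. conv (rate a) v t) = integral {0..t} (\<lambda>s. signed_integral \<mu> (\<lambda>a. rate a s * v (t - s)))"
    unfolding conv_def by (rule signed_integral_swap[OF mu cont bnd])
  also have "\<dots> = conv (flux0 \<mu>) v t"
    unfolding conv_def
  proof (rule integral_cong)
    fix s assume "s \<in> {0..t}"
    then show "signed_integral \<mu> (\<lambda>a. rate a s * v (t - s)) = flux0 \<mu> s * v (t - s)"
      using sigma_functional_cmult[OF L rate_bounded_measurable[of s], of "v (t - s)"]
      by (simp add: flux0_def mult.commute)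
  qed
  also have "\<dots> = conv (\<lambda>s. N s - conv N (rate 0) s) v t"
    by (rule conv_cong) (use N(3) in \<open>auto simp: conv_commute[of N]\<close>)
  also have "\<dots> = conv N v t - conv (conv N (rate 0)) v t"
    by (intro conv_diff_left conv_continuous_UNIV N rc v)
  also have "\<dots> = conv N v t - conv N (conv (rate 0) v) t"
    by (simp add: conv_assoc N rc v)
  also have "\<dots> = conv N (\<lambda>s. v s - conv (rate 0) v s) t"
    by (intro conv_diff_right[symmetric] conv_continuous_UNIV N rc v)
  also have "\<dots> = conv N g t"
    by (rule conv_cong) (use v(2) in \<open>auto simp: g_def\<close>)
  finally have c: "signed_integral \<mu> (\<lambda>a. conv (rate a) v t) = conv N g t" .
  have "signed_integral \<mu> (right_semigroup \<beta> t f) =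
      signed_integral \<mu> (\<lambda>a. f (a + t) * surv a t + conv (rate a) v t)"
    by (rule sigma_functional_cong[OF L, symmetric])
       (auto intro: bounded_measurable_add conv_bm Cb_shift_surv_section(1)[OF f t] simp: v(3) t)
  also have "\<dots> = signed_integral \<mu> (\<lambda>a. f (a + t) * surv a t) + conv N g t"
    by (simp add: sigma_functional_add[OF L Cb_shift_surv_section(1)[OF f t] conv_bm] c)
  finally show ?thesis
    unfolding g_def .
qed

text \<open>The definition of \<open>left_semigroup\<close> tests with \<open>C0\<close> only. That
  already singles out the explicit measure, since \<open>C0\<close> contains the test functions of
  \<open>signed_measure_eqI\<close>; the formula then holds on all of \<open>Cb\<close>, in
  particular for \<beta>.\<close>

lemma left_semigroup_formula:
  assumes mu: "\<mu> \<in> signed_measures"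
  obtains N where "continuous_on UNIV N" "\<And>t. t \<ge> 0 \<Longrightarrow> N t = flux0 \<mu> t + conv (rate 0) N t"
    "\<And>t. t \<ge> 0 \<Longrightarrow> left_semigroup \<beta> \<mu> t \<in> signed_measures"
    "\<And>t f. t \<ge> 0 \<Longrightarrow> f \<in> Cb \<Longrightarrow> signed_integral (left_semigroup \<beta> \<mu> t) f =
      signed_integral \<mu> (\<lambda>a. f (a + t) * surv a t) + conv N (\<lambda>s. f (max 0 s) * surv 0 (max 0 s)) t"
proof -
  obtain N where N: "continuous_on UNIV (flux0 \<mu>)" "continuous_on UNIV N"
    "\<And>t. t \<ge> 0 \<Longrightarrow> N t = flux0 \<mu> t + conv (rate 0) N t"
    using flux_exists[OF mu] by blast
  have "left_semigroup \<beta> \<mu> t \<in> signed_measures \<and> (\<forall>f\<in>Cb. signed_integral (left_semigroup \<beta> \<mu> t) f =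
      signed_integral \<mu> (\<lambda>a. f (a + t) * surv a t) + conv N (\<lambda>s. f (max 0 s) * surv 0 (max 0 s)) t)"
    if t: "t \<ge> 0" for t
  proof -
    obtain \<nu> where \<nu>: "\<nu> \<in> signed_measures" "\<And>f. f \<in> Cb \<Longrightarrow> signed_integral \<nu> f =
      signed_integral \<mu> (\<lambda>a. f (a + t) * surv a t) + conv N (\<lambda>s. f (max 0 s) * surv 0 (max 0 s)) t"
      using transported_measure[OF mu N(2) t] by blast
    have dual: "signed_integral \<nu> f = signed_integral \<mu> (right_semigroup \<beta> t f)" if "f \<in> C0" for f
      using that C0_subset_Cb \<nu>(2) signed_integral_right_semigroup[OF mu _ t N] by (metis subsetD)
    have "left_semigroup \<beta> \<mu> t = \<nu>"
      unfolding left_semigroup_def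
    proof (rule the_equality)
      fix \<nu>' assume \<nu>': "\<nu>' \<in> signed_measures \<and>
        (\<forall>f\<in>C0. signed_integral \<nu>' f = signed_integral \<mu> (right_semigroup \<beta> t f))"
      show "\<nu>' = \<nu>"
      proof (rule signed_measure_eqI)
        fix f :: "real \<Rightarrow> real" and R
        assume "continuous_on UNIV f" "\<And>a. a \<ge> R \<Longrightarrow> f a = 0"
        then have "f \<in> C0"
          unfolding C0_def using eventually_at_top_linorder[of "\<lambda>a. f a = 0"]
          by (auto intro: continuous_on_subset tendsto_eventually)
        then show "signed_integral \<nu>' f = signed_integral \<nu> f"
          using \<nu>' dual by simp
      qed (use \<nu> \<nu>' in auto)
    qed (use \<nu> dual in auto)
    then show ?thesis using \<nu> by simp
  qed
  then show thesis
    using that N by blast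
qed

text \<open>The explicit formula reduces the weak equation to two identities, \<open>I1\<close> for
  the survivors and \<open>I2\<close> for the individuals born since time 0.\<close>

lemma left_semigroup_measure_solution:
  assumes mu: "\<mu> \<in> signed_measures"
  shows "measure_solution \<beta> \<mu> (left_semigroup \<beta> \<mu>)"
proof -
  note L = sigma_functional_signed_integral[OF mu]
  let ?\<nu> = "left_semigroup \<beta> \<mu>"
  obtain N where N: "continuous_on UNIV N" "\<And>t. t \<ge> 0 \<Longrightarrow> N t = flux0 \<mu> t + conv (rate 0) N t"
    and \<nu>: "\<And>t. t \<ge> 0 \<Longrightarrow> ?\<nu> t \<in> signed_measures"
    and \<nu>f: "\<And>t f. t \<ge> 0 \<Longrightarrow> f \<in> Cb \<Longrightarrow> signed_integral (?\<nu> t) f =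
      signed_integral \<mu> (\<lambda>a. f (a + t) * surv a t) + conv N (\<lambda>s. f (max 0 s) * surv 0 (max 0 s)) t"
    using left_semigroup_formula[OF mu] by blast
  have ext: "continuous_on UNIV (\<lambda>s. f (max 0 s) * surv 0 (max 0 s))" if "f \<in> Cb" for f
    by (intro continuous_intros continuous_on_max0 Cb_continuous that)
  have \<mu>_cont: "continuous_on halfline (\<lambda>t. signed_integral \<mu> (\<lambda>a. f (a + t) * surv a t))" if f: "f \<in> Cb" for f
  proof -
    obtain C where "\<And>t a. t \<ge> 0 \<Longrightarrow> a \<ge> 0 \<Longrightarrow> \<bar>f (a + t) * surv a t\<bar> \<le> C"
      using Cb_shift_surv(2)[OF f] by blast
    then show ?thesis
      by (intro sigma_functional_continuous_param[OF L, where C = C] Cb_shift_surv_section[OF f]) auto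
  qed
  have "narrowly_continuous ?\<nu>"
    unfolding narrowly_continuous_def
  proof
    fix f assume f: "f \<in> Cb"
    have "continuous_on halfline (\<lambda>t. signed_integral \<mu> (\<lambda>a. f (a + t) * surv a t) +
        conv N (\<lambda>s. f (max 0 s) * surv 0 (max 0 s)) t)"
      by (intro continuous_on_add \<mu>_cont f conv_continuous N ext)
    then show "continuous_on halfline (\<lambda>t. signed_integral (?\<nu> t) f)"
      by (rule continuous_on_eq) (simp add: \<nu>f f)
  qed
  moreover have "signed_integral (?\<nu> t) f = signed_integral \<mu> f +
      integral {0..t} (\<lambda>s. signed_integral (?\<nu> s) (generator \<beta> f))"
    if f: "f \<in> C1c" and t: "t \<ge> 0" for f t
  proof -
    have f1: "f \<in> C1" using f unfolding C1c_def by blast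
    note fb = C1c_Cb[OF f]
    \<comment> \<open>The generator splits into \<open>\<gamma>\<close> and
      \<open>f 0 * \<beta>\<close>. Along a characteristic the weighted transport part has the exact
      primitive \<open>f (a + s) * surv a s\<close>; the renewal part is evaluated by
      \<open>N_eq\<close>.\<close>
    define \<gamma> where "\<gamma> a = deriv_halfline f a - \<beta> a * f a" for a
    have \<gamma>: "\<gamma> \<in> Cb"
      unfolding \<gamma>_def by (intro Cb_diff Cb_mult fb \<beta>_Cb)
    let ?\<phi> = "\<lambda>s. f (max 0 s) * surv 0 (max 0 s)" and ?\<psi> = "\<lambda>s. \<gamma> (max 0 s) * surv 0 (max 0 s)"
    have ftc: "integral {0..t} (\<lambda>s. \<gamma> (a + s) * surv a s) = f (a + t) * surv a t - f a"
      if "a \<ge> 0" "t \<ge> 0" for a t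
    proof -
      have "((\<lambda>s. \<gamma> (a + s) * surv a s) has_integral (f (a + t) * surv a t - f (a + 0) * surv a 0)) {0..t}"
      proof (rule fundamental_theorem_of_calculus[OF \<open>t \<ge> 0\<close>])
        fix s assume s: "s \<in> {0..t}"
        have "((\<lambda>s. f (a + s)) has_real_derivative deriv_halfline f (a + s)) (at s within {0..t})"
          using s that by (intro shift_derivative C1_has_derivative f1) auto
        from DERIV_mult[OF this surv_derivative[OF \<open>a \<ge> 0\<close> s]]
        show "((\<lambda>s. f (a + s) * surv a s) has_vector_derivative \<gamma> (a + s) * surv a s) (at s within {0..t})"
          by (simp add: has_real_derivative_iff_has_vector_derivative[symmetric] \<gamma>_def rate_def algebra_simps)
      qed
      then show ?thesis by (simp add: integral_unique)
    qed
    \<comment> \<open>Here the Volterra solution \<open>N\<close> is recognised as the birth rate of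
      the measure itself.\<close>
    have N_eq: "signed_integral (?\<nu> s) \<beta> = N s" if "s \<ge> 0" for s
    proof -
      have "conv N (\<lambda>s. \<beta> (max 0 s) * surv 0 (max 0 s)) s = conv (rate 0) N s"
        unfolding conv_commute[of N] by (rule conv_cong) (auto simp: rate_def)
      then show ?thesis
        using \<nu>f[OF that \<beta>_Cb] N(2)[OF that] that by (simp add: flux0_def rate_def)
    qed
    have gen: "signed_integral (?\<nu> s) (generator \<beta> f) =
        signed_integral \<mu> (\<lambda>a. \<gamma> (a + s) * surv a s) + conv N ?\<psi> s + f 0 * N s" if "s \<ge> 0" for s
    proof -
      have "generator \<beta> f = (\<lambda>a. \<gamma> a + f 0 * \<beta> a)"
        by (auto simp: generator_def \<gamma>_def algebra_simps)
      then show ?thesis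
        using \<nu>f[OF that \<gamma>] N_eq[OF that] sigma_functional_cmult[OF sigma_functional_signed_integral[OF \<nu>[OF that]],
            OF Cb_bounded_measurable[OF \<beta>_Cb], of "f 0"]
          sigma_functional_add[OF sigma_functional_signed_integral[OF \<nu>[OF that]] Cb_bounded_measurable[OF \<gamma>]
            Cb_bounded_measurable[OF Cb_cmult[OF \<beta>_Cb, of "f 0"]]] by simp
    qed
    have I1: "integral {0..t} (\<lambda>s. signed_integral \<mu> (\<lambda>a. \<gamma> (a + s) * surv a s)) =
        signed_integral \<mu> (\<lambda>a. f (a + t) * surv a t) - signed_integral \<mu> f"
    proof -
      obtain C where C: "\<And>t a. t \<ge> 0 \<Longrightarrow> a \<ge> 0 \<Longrightarrow> \<bar>\<gamma> (a + t) * surv a t\<bar> \<le> C"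
        using Cb_shift_surv(2)[OF \<gamma>] by blast
      have "integral {0..t} (\<lambda>s. signed_integral \<mu> (\<lambda>a. \<gamma> (a + s) * surv a s)) =
          signed_integral \<mu> (\<lambda>a. integral {0..t} (\<lambda>s. \<gamma> (a + s) * surv a s))"
        by (rule signed_integral_swap[OF mu, symmetric, where C = C])
           (use C in \<open>auto intro: continuous_on_subset[OF Cb_shift_surv(1)[OF \<gamma>]]\<close>)
      also have "\<dots> = signed_integral \<mu> (\<lambda>a. f (a + t) * surv a t - f a)"
        by (rule sigma_functional_cong[OF L, symmetric],
            rule bounded_measurable_diff[OF Cb_shift_surv_section(1)[OF fb(1) t] Cb_bounded_measurable[OF fb(1)]])
           (use ftc t in auto)
      finally show ?thesis
        using sigma_functional_diff[OF L] Cb_shift_surv_section(1)[OF fb(1) t] Cb_bounded_measurable[OF fb(1)]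
        by simp
    qed
    have one: "continuous_on UNIV (\<lambda>_::real. 1::real)" by simp
    \<comment> \<open>Integration over \<open>[0,t]\<close> is convolution with the constant 1.
      Associativity moves it onto \<open>?\<psi>\<close>, whose primitive is \<open>?\<phi>\<close>
      minus \<open>f 0\<close>; the resulting term with \<open>f 0\<close> cancels the renewal part
      of the generator.\<close>
    have "integral {0..t} (conv N ?\<psi>) = conv (conv N ?\<psi>) (\<lambda>_. 1) t"
      by (simp add: conv_def[of "conv N ?\<psi>"])
    also have "\<dots> = conv N (conv ?\<psi> (\<lambda>_. 1)) t"
      by (intro conv_assoc N ext \<gamma> one)
    also have "\<dots> = conv N (\<lambda>s. ?\<phi> s - f 0) t"
    proof (rule conv_cong)
      fix s :: real assume "0 \<le> s"
      moreover have "conv ?\<psi> (\<lambda>_. 1) s = integral {0..s} (\<lambda>s. \<gamma> (0 + s) * surv 0 s)"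
        unfolding conv_def by (rule integral_cong) auto
      ultimately show "conv ?\<psi> (\<lambda>_. 1) s = ?\<phi> s - f 0"
        using ftc[of 0 s] by simp
    qed simp
    also have "\<dots> = conv N ?\<phi> t - conv N (\<lambda>_. f 0) t"
      by (rule conv_diff_right) (intro ext fb N continuous_intros)+
    also have "conv N (\<lambda>_. f 0) t = f 0 * integral {0..t} N"
      by (simp add: conv_def mult.commute)
    finally have I2: "integral {0..t} (conv N ?\<psi>) = conv N ?\<phi> t - f 0 * integral {0..t} N" .
    have "integral {0..t} (\<lambda>s. signed_integral (?\<nu> s) (generator \<beta> f)) =
        integral {0..t} (\<lambda>s. signed_integral \<mu> (\<lambda>a. \<gamma> (a + s) * surv a s) + conv N ?\<psi> s + f 0 * N s)"
      by (rule integral_cong) (simp add: gen)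
    also have "\<dots> = integral {0..t} (\<lambda>s. signed_integral \<mu> (\<lambda>a. \<gamma> (a + s) * surv a s)) +
        integral {0..t} (conv N ?\<psi>) + integral {0..t} (\<lambda>s. f 0 * N s)"
    proof -
      have i1: "(\<lambda>s. signed_integral \<mu> (\<lambda>a. \<gamma> (a + s) * surv a s)) integrable_on {0..t}"
        by (intro integrable_continuous_real continuous_on_subset[OF \<mu>_cont[OF \<gamma>]]) auto
      have i2: "conv N ?\<psi> integrable_on {0..t}"
        by (intro integrable_continuous_real continuous_on_subset[OF conv_continuous_UNIV[OF N(1) ext[OF \<gamma>]]]) auto
      have i3: "(\<lambda>s. f 0 * N s) integrable_on {0..t}"
        by (intro integrable_continuous_real continuous_intros continuous_on_subset[OF N(1)]) auto
      show ?thesis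
        by (simp only: Henstock_Kurzweil_Integration.integral_add integrable_add i1 i2 i3)
    qed
    finally show ?thesis
      using \<nu>f[OF t fb(1)] I1 I2 by simp
  qed
  ultimately show ?thesis
    unfolding measure_solution_def using \<nu> by blast
qed

end

section \<open>Uniform bounds in time and a scalar linear equation\<close>

lemma uniform_boundedness:
  fixes T :: "'i \<Rightarrow> 'a::{real_normed_vector, complete_space} \<Rightarrow> real"
  assumes lin: "\<And>i. i \<in> I \<Longrightarrow> bounded_linear (T i)"
    and pw: "\<And>x. \<exists>C. \<forall>i\<in>I. \<bar>T i x\<bar> \<le> C"
  shows "\<exists>C. \<forall>i\<in>I. \<forall>x. \<bar>T i x\<bar> \<le> C * norm x"
proof -
  \<comment> \<open>Baire category: these sets are closed and by pointwise boundedness exhaust the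
    space, so one of them contains a ball.\<close>
  define A where "A n = {x. \<forall>i\<in>I. \<bar>T i x\<bar> \<le> real n}" for n :: nat
  have closed: "closed (A n)" for n
  proof -
    have "A n = (\<Inter>i\<in>I. {x. \<bar>T i x\<bar> \<le> real n})"
      by (auto simp: A_def)
    moreover have "closed {x. \<bar>T i x\<bar> \<le> real n}" if "i \<in> I" for i
      by (intro closed_Collect_le continuous_intros linear_continuous_on lin that)
    ultimately show ?thesis by auto
  qed
  have "(\<Union>n. A n) = UNIV"
  proof -
    have "\<exists>n. x \<in> A n" for x
    proof -
      obtain C where C: "\<forall>i\<in>I. \<bar>T i x\<bar> \<le> C" using pw by blast
      obtain n where "C \<le> real n" using real_arch_simple by blast
      then have "x \<in> A n" using C by (auto simp: A_def)
      then show ?thesis by blast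
    qed
    then show ?thesis by blast
  qed
  then have "euclidean interior_of \<Union> (range A) \<noteq> {}"
    by simp
  then have "\<exists>n. interior (A n) \<noteq> {}"
    using Baire_category_alt[of euclidean "range A"] closed completely_metrizable_space_euclidean
    by auto
  then obtain n x0 r where r: "r > 0" "ball x0 r \<subseteq> A n"
    by (metis all_not_in_conv mem_interior)
  show ?thesis
  \<comment> \<open>A vector of length \<open>r / 2\<close> added to the centre stays in the ball,
    so each \<open>T i\<close> is at most \<open>2 * real n\<close> on it; scaling to length
    \<open>norm x\<close> gives the constant.\<close>
  proof (intro exI[of _ "4 * real n / r"] ballI allI)
    fix i x assume i: "i \<in> I"
    interpret bounded_linear "T i" by (rule lin[OF i])
    show "\<bar>T i x\<bar> \<le> 4 * real n / r * norm x"
    proof (cases "x = 0")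
      case False
      define y where "y = (r / (2 * norm x)) *\<^sub>R x"
      have "x0 + y \<in> ball x0 r" "x0 \<in> ball x0 r"
        using r False by (auto simp: y_def dist_norm)
      then have "\<bar>T i (x0 + y)\<bar> \<le> real n" "\<bar>T i x0\<bar> \<le> real n"
        using r i unfolding A_def by blast+
      then have "\<bar>T i y\<bar> \<le> 2 * real n"
        by (simp add: add)
      moreover have "T i y = r / (2 * norm x) * T i x"
        by (simp add: y_def scale)
      ultimately have "r / (2 * norm x) * \<bar>T i x\<bar> \<le> 2 * real n"
        using r by (simp add: abs_mult)
      then show ?thesis
        using r False by (simp add: field_simps)
    qed (simp add: zero)
  qed
qed

text \<open>For fixed \<open>f\<close> the integrals are continuous in time, hence bounded on
  \<open>[0,t]\<close> by a constant depending on \<open>f\<close>; Banach-Steinhaus makes it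
  proportional to the sup norm.\<close>

lemma narrowly_continuous_bounded:
  assumes mu: "\<And>s. s \<ge> 0 \<Longrightarrow> \<mu> s \<in> signed_measures" and nc: "narrowly_continuous \<mu>"
  obtains C where "C \<ge> 0" "\<And>s f c. 0 \<le> s \<Longrightarrow> s \<le> t \<Longrightarrow> f \<in> Cb \<Longrightarrow> (\<And>a. a \<ge> 0 \<Longrightarrow> \<bar>f a\<bar> \<le> c) \<Longrightarrow>
    \<bar>signed_integral (\<mu> s) f\<bar> \<le> C * c"
proof -
  define T where "T s w = signed_integral (\<mu> s) (apply_bcontfun w)" for s and w :: "real \<Rightarrow>\<^sub>C real"
  have Cb: "apply_bcontfun w \<in> Cb" for w :: "real \<Rightarrow>\<^sub>C real"
    by (rule CbI[OF continuous_on_apply_bcontfun]) (use norm_bounded[of w] in auto)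
  have "\<exists>C. \<forall>s\<in>{0..t}. \<forall>w. \<bar>T s w\<bar> \<le> C * norm w"
  proof (rule uniform_boundedness)
    fix s assume "s \<in> {0..t}"
    then have s: "\<mu> s \<in> signed_measures" using mu by simp
    note L = sigma_functional_signed_integral[OF s]
    obtain G where G: "\<And>f C. f \<in> bounded_measurable \<Longrightarrow> (\<And>a. a \<ge> 0 \<Longrightarrow> \<bar>f a\<bar> \<le> C) \<Longrightarrow>
        \<bar>signed_integral (\<mu> s) f\<bar> \<le> G * C"
      using signed_integral_bound[OF s] by blast
    show "bounded_linear (T s)"
    proof (rule bounded_linear_intro[where K = G])
      fix w w' :: "real \<Rightarrow>\<^sub>C real" and c
      show "T s (w + w') = T s w + T s w'"
        using sigma_functional_add[OF L Cb[THEN Cb_bounded_measurable] Cb[THEN Cb_bounded_measurable], of w w']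
        by (simp add: T_def plus_bcontfun.rep_eq)
      show "T s (c *\<^sub>R w) = c *\<^sub>R T s w"
        using sigma_functional_cmult[OF L Cb[THEN Cb_bounded_measurable], of c w]
        by (simp add: T_def scaleR_bcontfun.rep_eq)
      show "norm (T s w) \<le> norm w * G"
        using G[OF Cb[THEN Cb_bounded_measurable], of w "norm w"] norm_bounded[of w]
        by (simp add: T_def mult.commute)
    qed
  next
    fix w :: "real \<Rightarrow>\<^sub>C real"
    have "continuous_on halfline (\<lambda>s. T s w)"
      using nc Cb unfolding narrowly_continuous_def T_def by blast
    then have "bounded ((\<lambda>s. T s w) ` {0..t})"
      by (intro compact_imp_bounded compact_continuous_image) (auto intro: continuous_on_subset)
    then show "\<exists>C. \<forall>s\<in>{0..t}. \<bar>T s w\<bar> \<le> C"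
      unfolding bounded_iff by auto
  qed
  then obtain C where C: "\<And>s w. s \<in> {0..t} \<Longrightarrow> \<bar>T s w\<bar> \<le> C * norm w" by blast
  show thesis
  \<comment> \<open>The constant found so far may be negative; a nonnegative one is needed to
    replace the norm by its upper bound \<open>c\<close>.\<close>
  proof (rule that[of "max 0 C"])
    fix s f c assume s: "0 \<le> s" "s \<le> t" and f: "f \<in> Cb" and c: "\<And>a. a \<ge> 0 \<Longrightarrow> \<bar>f a\<bar> \<le> c"
    have b: "(\<lambda>a. f (max 0 a)) \<in> bcontfun"
      by (rule bcontfun_normI[where b = c]) (use c continuous_on_max0[OF Cb_continuous[OF f]] in auto)
    have n: "norm (Bcontfun (\<lambda>a. f (max 0 a))) \<le> c"
      by (rule norm_bound) (use c in \<open>simp add: Bcontfun_inverse[OF b]\<close>)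
    have "signed_integral (\<mu> s) f = T s (Bcontfun (\<lambda>a. f (max 0 a)))"
      unfolding T_def Bcontfun_inverse[OF b]
      by (rule sigma_functional_cong[OF sigma_functional_signed_integral[OF mu[OF s(1)]] Cb_bounded_measurable[OF f]]) simp
    also have "\<bar>\<dots>\<bar> \<le> C * norm (Bcontfun (\<lambda>a. f (max 0 a)))"
      using C s by simp
    also have "\<dots> \<le> max 0 C * c"
      by (rule mult_mono) (use n in auto)
    finally show "\<bar>signed_integral (\<mu> s) f\<bar> \<le> max 0 C * c" by simp
  qed simp
qed

text \<open>Integrating factor: \<open>exp (- l * (t - s)) * m s\<close> has derivative
  \<open>exp (- l * (t - s)) * b s\<close> in \<open>s\<close>. The initial value
  \<open>m 0 = 0\<close> is contained in the integral equation.\<close>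

lemma linear_ode_solution:
  assumes m: "continuous_on halfline m" and b: "continuous_on halfline b"
    and eq: "\<And>t. t \<ge> 0 \<Longrightarrow> m t = integral {0..t} (\<lambda>s. b s - l * m s)" and t: "t \<ge> 0"
  shows "m t = integral {0..t} (\<lambda>s. b s * exp (- l * (t - s)))"
proof -
  have "((\<lambda>s. exp (- l * (t - s)) * b s) has_integral
      (exp (- l * (t - t)) * m t - exp (- l * (t - 0)) * m 0)) {0..t}"
  proof (rule fundamental_theorem_of_calculus[OF t])
    fix s assume s: "s \<in> {0..t}"
    have "((\<lambda>s. integral {0..s} (\<lambda>s. b s - l * m s)) has_real_derivative b s - l * m s) (at s within {0..t})"
      by (rule integral_has_real_derivative)
         (use s in \<open>auto intro!: continuous_intros continuous_on_subset[OF m] continuous_on_subset[OF b]\<close>)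
    then have "(m has_real_derivative b s - l * m s) (at s within {0..t})"
      by (rule has_field_derivative_transform_within[where d = 1]) (use s eq in auto)
    then show "((\<lambda>s. exp (- l * (t - s)) * m s) has_vector_derivative exp (- l * (t - s)) * b s) (at s within {0..t})"
      unfolding has_real_derivative_iff_has_vector_derivative[symmetric]
      by (auto intro!: derivative_eq_intros simp: algebra_simps)
  qed
  then show ?thesis
    using eq[of 0] by (simp add: integral_unique mult.commute)
qed

section \<open>Uniqueness of measure solutions\<close>

context renewal
begin

definition etest :: "real \<Rightarrow> real \<Rightarrow> real" where
  "etest l a = exp (B a - l * a)"

lemma B_le:
  assumes "a \<ge> 0"
  shows "B a \<le> K * a"
proof -
  have "integral {0..a} \<beta> \<le> integral {0..a} (\<lambda>_. K)"
    by (rule integral_le) (auto intro!: integrable_continuous_real continuous_on_subset[OF \<beta>_cont] \<beta>_le)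
  then show ?thesis
    using assms by (simp add: B_def mult.commute)
qed

lemma etest_cont: "continuous_on X (etest l)"
  unfolding etest_def by (intro continuous_intros B_cont)

text \<open>The excess of 1 over the bound \<open>K\<close> of \<beta> leaves a factor
  \<open>exp (- a)\<close>. It keeps \<open>etest l a * a\<close> bounded, which absorbs the growth
  of the cutoff error in \<open>a\<close>.\<close>

lemma etest_le:
  assumes "l \<ge> K + 1" "a \<ge> 0"
  shows "etest l a \<le> exp (- a)" "etest l a * a \<le> 1" "etest l a \<le> 1"
proof -
  have "(K + 1) * a \<le> l * a"
    using assms by (intro mult_right_mono)
  then show e: "etest l a \<le> exp (- a)"
    using B_le[OF assms(2)] by (simp add: etest_def algebra_simps)
  then have "etest l a * a \<le> exp (- a) * exp a"
    using assms(2) order_trans[OF _ exp_ge_add_one_self[of a], of a] by (intro mult_mono) auto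
  then show "etest l a * a \<le> 1"
    by (simp add: exp_minus)
  show "etest l a \<le> 1"
    using e assms(2) by (smt (verit) exp_le_one_iff)
qed

lemma etest_Cb: "l \<ge> K + 1 \<Longrightarrow> etest l \<in> Cb"
  by (rule CbI[OF etest_cont, where C = 1]) (use etest_le(3) in \<open>auto simp: etest_def\<close>)

text \<open>The factor 1 / S_0 in \<open>etest\<close> is chosen for this cancellation: tested
  against the individuals born since time 0, it gives exactly the kernel in
  \<open>linear_ode_solution\<close>.\<close>

lemma etest_surv: "etest l s * surv 0 s = exp (- (l * s))"
  by (simp add: etest_def surv_def exp_add[symmetric])

lemma etest_derivative:
  assumes "a \<ge> 0"
  shows "(etest l has_real_derivative (\<beta> a - l) * etest l a) (at a within halfline)"
  unfolding etest_def[abs_def]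
  using B_derivative[OF assms] by (auto intro!: derivative_eq_intros)

text \<open>The square is what makes the cutoff continuously differentiable at the end of its
  support.\<close>

lemma max_square_derivative:
  fixes x :: real
  shows "((\<lambda>x. (max 0 x)\<^sup>2) has_real_derivative 2 * max 0 x) (at x)"
proof -
  consider "x > 0" | "x < 0" | "x = 0" by linarith
  then show ?thesis
  proof cases
    case 1
    have "((\<lambda>x. x\<^sup>2) has_real_derivative 2 * max 0 x) (at x)"
      using 1 by (auto intro!: derivative_eq_intros)
    then show ?thesis
      by (rule has_field_derivative_transform_within_open[where S = "{0<..}"]) (use 1 in auto)
  next
    case 2
    have "((\<lambda>x. 0) has_real_derivative 2 * max 0 x) (at x)"
      using 2 by simp
    then show ?thesis
      by (rule has_field_derivative_transform_within_open[where S = "{..<0}"]) (use 2 in auto)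
  next
    case 3
    have "(\<lambda>h::real. (max 0 h)\<^sup>2 / h) \<midarrow>0\<rightarrow> 0"
    proof (rule Lim_null_comparison[where g = "\<lambda>h. \<bar>h\<bar>"])
      show "\<forall>\<^sub>F h in at 0. norm ((max 0 h)\<^sup>2 / h) \<le> \<bar>h :: real\<bar>"
        by (rule always_eventually) (auto simp: max_def power2_eq_square)
      show "(\<lambda>h. \<bar>h\<bar>) \<midarrow>(0::real)\<rightarrow> 0"
        by (rule tendsto_rabs_zero) simp
    qed
    then show ?thesis
      using 3 by (simp add: DERIV_def)
  qed
qed

text \<open>The exponential \<^term>\<open>etest l\<close> is an eigenfunction of \<open>f \<mapsto> f' - \<beta> f\<close>. It is not compactly
  supported; the cutoff \<open>(max 0 (1 - a / n))\<^sup>2\<close> changes the generator by \<open>O(1 / n)\<close> uniformly.\<close>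

lemma etest_cutoff:
  assumes l: "l \<ge> K + 1" and n: "n \<ge> (1::real)"
  obtains g where "g \<in> C1c" "\<And>a. a \<ge> 0 \<Longrightarrow> \<bar>g a - etest l a\<bar> \<le> 2 / n"
    "\<And>a. a \<ge> 0 \<Longrightarrow> \<bar>generator \<beta> g a - (\<beta> a - l * etest l a)\<bar> \<le> (2 * l + 2) / n"
proof -
  define \<theta> where "\<theta> a = max 0 (1 - a / n)" for a
  define g where "g a = etest l a * (\<theta> a)\<^sup>2" for a
  define g' where "g' a = (\<beta> a - l) * g a - 2 / n * (etest l a * \<theta> a)" for a
  have \<theta>: "0 \<le> \<theta> a" "\<theta> a \<le> 1" if "a \<ge> 0" for a
    using that n by (auto simp: \<theta>_def)
  have der: "(g has_real_derivative g' a) (at a within halfline)" if "a \<ge> 0" for a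
  proof -
    have "((\<lambda>a. 1 - a / n) has_real_derivative - (1 / n)) (at a within halfline)"
      using n by (auto intro!: derivative_eq_intros)
    from DERIV_chain2[OF max_square_derivative this]
    have "((\<lambda>a. (\<theta> a)\<^sup>2) has_real_derivative 2 * \<theta> a * - (1 / n)) (at a within halfline)"
      by (simp add: \<theta>_def)
    from DERIV_mult[OF etest_derivative[OF that, of l] this]
    show ?thesis
      by (simp add: g_def[abs_def] g'_def algebra_simps)
  qed
  have "g \<in> C1"
    by (rule C1I[OF der])
       (use n in \<open>auto simp: g'_def g_def \<theta>_def intro!: continuous_intros etest_cont continuous_on_subset[OF \<beta>_cont]\<close>)
  moreover have "compact (closure {a \<in> halfline. g a \<noteq> 0})"
  proof -
    have "{a \<in> halfline. g a \<noteq> 0} \<subseteq> {0..n}"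
      using n by (auto simp: g_def \<theta>_def max_def field_simps split: if_splits)
    then have "bounded {a \<in> halfline. g a \<noteq> 0}"
      by (rule bounded_subset[OF bounded_closed_interval])
    then show ?thesis by simp
  qed
  ultimately have g: "g \<in> C1c"
    unfolding C1c_def by blast
  have diff: "\<bar>g a - etest l a\<bar> \<le> 2 / n" if "a \<ge> 0" for a
  proof -
    \<comment> \<open>Here \<open>1 - \<theta> a \<le> a / n\<close> and
      \<open>1 + \<theta> a \<le> 2\<close>; the factor \<open>a\<close> is absorbed by
      \<open>etest_le(2)\<close>.\<close>
    have "(1 - \<theta> a) * (1 + \<theta> a) \<le> a / n * 2"
      using \<theta>[OF that] n that by (intro mult_mono) (auto simp: \<theta>_def)
    then have "1 - (\<theta> a)\<^sup>2 \<le> 2 * a / n"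
      by (simp add: power2_eq_square algebra_simps)
    then have "etest l a * (1 - (\<theta> a)\<^sup>2) \<le> etest l a * (2 * a / n)"
      by (rule mult_left_mono) (simp add: etest_def)
    also have "\<dots> = 2 * (etest l a * a) / n"
      by simp
    also have "\<dots> \<le> 2 / n"
      using etest_le(2)[OF l that] n by (intro divide_right_mono) auto
    finally have "etest l a - g a \<le> 2 / n"
      by (simp add: g_def algebra_simps)
    moreover have "g a \<le> etest l a * 1"
      unfolding g_def using \<theta>[OF that] by (intro mult_left_mono power_le_one) (auto simp: etest_def)
    ultimately show ?thesis by simp
  qed
  have "\<bar>generator \<beta> g a - (\<beta> a - l * etest l a)\<bar> \<le> (2 * l + 2) / n" if "a \<ge> 0" for a
  proof -
    \<comment> \<open>With this value the terms \<open>\<beta> a * g a\<close> cancel and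
      \<open>\<beta> a\<close> is matched exactly, so the error involves only \<open>l\<close> and
      the slope of the cutoff.\<close>
    have "g 0 = 1"
      by (simp add: g_def \<theta>_def etest_def)
    then have eq: "generator \<beta> g a - (\<beta> a - l * etest l a) = - (l * (g a - etest l a)) - 2 / n * (etest l a * \<theta> a)"
      using deriv_halfline_eqI[OF der[OF that] that]
      by (simp add: generator_def g'_def algebra_simps)
    have "etest l a * \<theta> a \<le> 1 * 1"
      using etest_le(3)[OF l that] \<theta>[OF that] by (intro mult_mono) auto
    then have "2 / n * (etest l a * \<theta> a) \<le> 2 / n * 1"
      using n by (intro mult_left_mono) auto
    moreover have "2 / n * (etest l a * \<theta> a) \<ge> 0"
      using n \<theta>[OF that] by (simp add: etest_def)
    moreover have "\<bar>l * (g a - etest l a)\<bar> \<le> l * (2 / n)"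
      unfolding abs_mult using diff[OF that] l K_pos by (intro mult_mono) auto
    ultimately have "\<bar>generator \<beta> g a - (\<beta> a - l * etest l a)\<bar> \<le> l * (2 / n) + 2 / n"
      unfolding eq by linarith
    then show ?thesis by (simp add: add_divide_distrib mult.commute)
  qed
  then show thesis
    using that[OF g diff] by blast
qed

lemma generator_Cb:
  assumes "f \<in> C1c"
  shows "generator \<beta> f \<in> Cb"
proof -
  have "(\<lambda>a. deriv_halfline f a + \<beta> a * (f 0 - f a)) \<in> Cb"
    by (intro Cb_add Cb_mult Cb_diff C1c_Cb[OF assms] \<beta>_Cb) (rule CbI[where C = "\<bar>f 0\<bar>"], auto)
  then show ?thesis
    by (simp add: generator_def[abs_def])
qed

text \<open>The cutoffs approximate the exponential and its generator at rate 1/n, and the measures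
  are bounded uniformly on \<open>[0,t]\<close>, so the weak equation passes to the limit.\<close>

lemma measure_solution_etest:
  assumes sol: "measure_solution \<beta> \<mu>0 \<mu>" and mu0: "\<mu>0 \<in> signed_measures"
    and l: "l \<ge> K + 1" and t: "t \<ge> 0"
  shows "signed_integral (\<mu> t) (etest l) = signed_integral \<mu>0 (etest l) +
    integral {0..t} (\<lambda>s. signed_integral (\<mu> s) \<beta> - l * signed_integral (\<mu> s) (etest l))"
proof -
  let ?e = "etest l"
  have mu: "\<And>s. s \<ge> 0 \<Longrightarrow> \<mu> s \<in> signed_measures" and nc: "narrowly_continuous \<mu>"
    and weak: "\<And>f t. f \<in> C1c \<Longrightarrow> t \<ge> 0 \<Longrightarrow> signed_integral (\<mu> t) f =
      signed_integral \<mu>0 f + integral {0..t} (\<lambda>s. signed_integral (\<mu> s) (generator \<beta> f))"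
    using sol unfolding measure_solution_def by blast+
  obtain C where C: "C \<ge> 0" "\<And>s f c. 0 \<le> s \<Longrightarrow> s \<le> t \<Longrightarrow> f \<in> Cb \<Longrightarrow> (\<And>a. a \<ge> 0 \<Longrightarrow> \<bar>f a\<bar> \<le> c) \<Longrightarrow>
      \<bar>signed_integral (\<mu> s) f\<bar> \<le> C * c"
    using narrowly_continuous_bounded[OF mu nc, where t = t] by blast
  obtain G where G: "G \<ge> 0" "\<And>f C. f \<in> bounded_measurable \<Longrightarrow> (\<And>a. a \<ge> 0 \<Longrightarrow> \<bar>f a\<bar> \<le> C) \<Longrightarrow>
      \<bar>signed_integral \<mu>0 f\<bar> \<le> G * C"
    using signed_integral_bound[OF mu0] by blast
  note bm = Cb_bounded_measurable
  have e: "?e \<in> Cb" by (rule etest_Cb[OF l])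
  have cont: "continuous_on {0..t} (\<lambda>s. signed_integral (\<mu> s) f)" if "f \<in> Cb" for f
    using nc that unfolding narrowly_continuous_def by (auto intro: continuous_on_subset)
  define X where "X = signed_integral (\<mu> t) ?e - signed_integral \<mu>0 ?e -
    integral {0..t} (\<lambda>s. signed_integral (\<mu> s) \<beta> - l * signed_integral (\<mu> s) ?e)"
  \<comment> \<open>Three errors: at time \<open>t\<close>, at the initial measure, and in the
    generator under the time integral.\<close>
  define M where "M = C * 2 + G * 2 + C * (2 * l + 2) * t"
  have bound: "\<bar>X\<bar> \<le> M / n" if n: "n \<ge> 1" for n
  proof -
    obtain g where g: "g \<in> C1c" "\<And>a. a \<ge> 0 \<Longrightarrow> \<bar>g a - ?e a\<bar> \<le> 2 / n"
      "\<And>a. a \<ge> 0 \<Longrightarrow> \<bar>generator \<beta> g a - (\<beta> a - l * ?e a)\<bar> \<le> (2 * l + 2) / n"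
      using etest_cutoff[OF l n] by blast
    have gC: "g \<in> Cb" by (rule C1c_Cb[OF g(1)])
    note GC = generator_Cb[OF g(1)]
    have be: "(\<lambda>a. \<beta> a - l * ?e a) \<in> Cb"
      by (intro Cb_diff Cb_cmult \<beta>_Cb e)
    have lin: "signed_integral (\<mu> s) (\<lambda>a. \<beta> a - l * ?e a) = signed_integral (\<mu> s) \<beta> - l * signed_integral (\<mu> s) ?e"
      if "s \<ge> 0" for s
      by (simp add: sigma_functional_diff[OF sigma_functional_signed_integral[OF mu[OF that]] bm[OF \<beta>_Cb] bm[OF Cb_cmult[OF e]]]
          sigma_functional_cmult[OF sigma_functional_signed_integral[OF mu[OF that]] bm[OF e]])
    have 1: "\<bar>signed_integral (\<mu> t) g - signed_integral (\<mu> t) ?e\<bar> \<le> C * (2 / n)"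
      unfolding sigma_functional_diff[OF sigma_functional_signed_integral[OF mu[OF t]] bm[OF gC] bm[OF e], symmetric]
      by (rule C(2)[OF t order_refl Cb_diff[OF gC e] g(2)])
    have 2: "\<bar>signed_integral \<mu>0 g - signed_integral \<mu>0 ?e\<bar> \<le> G * (2 / n)"
      unfolding sigma_functional_diff[OF sigma_functional_signed_integral[OF mu0] bm[OF gC] bm[OF e], symmetric]
      by (rule G(2)[OF bm[OF Cb_diff[OF gC e]] g(2)])
    have 3: "\<bar>signed_integral (\<mu> s) (generator \<beta> g) - (signed_integral (\<mu> s) \<beta> - l * signed_integral (\<mu> s) ?e)\<bar>
        \<le> C * ((2 * l + 2) / n)" if "s \<in> {0..t}" for s
    proof -
      have s: "0 \<le> s" "s \<le> t" using that by auto
      show ?thesis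
        unfolding lin[OF s(1), symmetric]
          sigma_functional_diff[OF sigma_functional_signed_integral[OF mu[OF s(1)]] bm[OF GC] bm[OF be], symmetric]
        by (rule C(2)[OF s Cb_diff[OF GC be] g(3)])
    qed
    have i1: "(\<lambda>s. signed_integral (\<mu> s) (generator \<beta> g)) integrable_on {0..t}"
      by (intro integrable_continuous_real cont GC)
    have i2: "(\<lambda>s. signed_integral (\<mu> s) \<beta> - l * signed_integral (\<mu> s) ?e) integrable_on {0..t}"
      by (intro integrable_continuous_real continuous_intros cont \<beta>_Cb e)
    have "norm (integral {0..t} (\<lambda>s. signed_integral (\<mu> s) (generator \<beta> g) -
        (signed_integral (\<mu> s) \<beta> - l * signed_integral (\<mu> s) ?e))) \<le> integral {0..t} (\<lambda>_. C * ((2 * l + 2) / n))"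
      by (rule integral_norm_bound_integral[OF integrable_diff[OF i1 i2]]) (use 3 in auto)
    then have "\<bar>integral {0..t} (\<lambda>s. signed_integral (\<mu> s) (generator \<beta> g)) -
        integral {0..t} (\<lambda>s. signed_integral (\<mu> s) \<beta> - l * signed_integral (\<mu> s) ?e)\<bar> \<le> C * ((2 * l + 2) / n) * t"
      using t by (simp add: Henstock_Kurzweil_Integration.integral_diff[OF i1 i2] mult_ac)
    then have "\<bar>X\<bar> \<le> C * (2 / n) + G * (2 / n) + C * ((2 * l + 2) / n) * t"
      using 1 2 weak[OF g(1) t] unfolding X_def by linarith
    also have "\<dots> = M / n"
      using n by (simp add: M_def field_simps)
    finally show ?thesis .
  qed
  have "\<bar>X\<bar> \<le> 0"
  proof (rule tendsto_lowerbound)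
    show "(\<lambda>n. M / real n) \<longlonglongrightarrow> 0"
      by (rule lim_const_over_n)
    show "\<forall>\<^sub>F n in sequentially. \<bar>X\<bar> \<le> M / real n"
      using bound by (intro eventually_sequentiallyI[of 1]) auto
  qed simp
  then show ?thesis
    by (simp add: X_def)
qed

text \<open>In the variable \<open>y = e\<^sup>-\<^sup>a\<close> the span of the functions \<^term>\<open>etest (K + 1 + real n)\<close> is
  \<^term>\<open>etest (K + 1)\<close> times the polynomials.\<close>

lemma etest_dense:
  assumes g: "continuous_on UNIV g" "\<And>a. a \<ge> R \<Longrightarrow> g a = 0" and "\<epsilon> > 0"
  obtains c and n :: nat where
    "\<And>a. a \<ge> 0 \<Longrightarrow> \<bar>g a - (\<Sum>i\<le>n. c i * etest (K + 1 + real i) a)\<bar> \<le> \<epsilon>"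
proof -
  define R' where "R' = max 0 R"
  define q where "q a = g a / etest (K + 1) a" for a
  \<comment> \<open>This is \<open>q\<close> in the variable \<open>y = exp (- a)\<close>. Since
    \<open>q\<close> vanishes from \<open>R'\<close> on, freezing \<open>y\<close> below
    \<open>exp (- R')\<close> changes nothing for \<open>y > 0\<close> and makes \<open>h\<close>
    continuous at \<open>y = 0\<close>.\<close>
  define h where "h y = q (- ln (max y (exp (- R'))))" for y
  have q: "continuous_on UNIV q"
    unfolding q_def by (intro continuous_intros g etest_cont) (simp add: etest_def)
  have "max y (exp (- R')) \<noteq> 0" for y :: real
    by (smt (verit) exp_gt_zero)
  then have "continuous_on {0..1} h"
    unfolding h_def by (intro continuous_on_compose2[OF q] continuous_intros) auto
  then obtain p where p: "real_polynomial_function p" "\<And>y. y \<in> {0..1} \<Longrightarrow> \<bar>h y - p y\<bar> < \<epsilon>"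
    using Stone_Weierstrass_real_polynomial_function[OF compact_Icc _ \<open>\<epsilon> > 0\<close>] by blast
  then obtain c n where c: "p = (\<lambda>y. \<Sum>i\<le>n. c i * y ^ i)"
    unfolding real_polynomial_function_iff_sum by blast
  show thesis
  proof (rule that)
    fix a :: real assume a: "a \<ge> 0"
    have h: "h (exp (- a)) = q a"
    proof (cases "a \<le> R'")
      case True
      then show ?thesis by (simp add: h_def max_def)
    next
      case False
      then have "h (exp (- a)) = q R'"
        by (simp add: h_def max_def)
      then show ?thesis
        using False g(2) by (simp add: q_def R'_def)
    qed
    have "etest (K + 1 + real i) a = etest (K + 1) a * exp (- a) ^ i" for i
      by (simp add: etest_def exp_of_nat_mult[symmetric] exp_add[symmetric] algebra_simps)
    then have "(\<Sum>i\<le>n. c i * etest (K + 1 + real i) a) = etest (K + 1) a * p (exp (- a))"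
      by (simp add: c sum_distrib_left algebra_simps)
    moreover have "g a = etest (K + 1) a * h (exp (- a))"
      by (simp add: h q_def etest_def)
    ultimately have "\<bar>g a - (\<Sum>i\<le>n. c i * etest (K + 1 + real i) a)\<bar> =
        etest (K + 1) a * \<bar>h (exp (- a)) - p (exp (- a))\<bar>"
      by (simp add: right_diff_distrib[symmetric] abs_mult etest_def)
    also have "\<dots> \<le> 1 * \<epsilon>"
      using etest_le(3)[of "K + 1" a] p(2)[of "exp (- a)"] a
      by (intro mult_mono) auto
    finally show "\<bar>g a - (\<Sum>i\<le>n. c i * etest (K + 1 + real i) a)\<bar> \<le> \<epsilon>"
      by simp
  qed
qed

text \<open>The approximation in \<open>etest_dense\<close> is uniform on the half-line and
  integration against a signed measure is continuous in the sup norm, so the measures agree on all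
  test functions of \<open>signed_measure_eqI\<close>.\<close>

lemma signed_measure_eqI_etest:
  assumes mu: "\<mu> \<in> signed_measures" and nu: "\<nu> \<in> signed_measures"
    and eq: "\<And>l. l \<ge> K + 1 \<Longrightarrow> signed_integral \<mu> (etest l) = signed_integral \<nu> (etest l)"
  shows "\<mu> = \<nu>"
proof (rule signed_measure_eqI[OF mu nu])
  fix g :: "real \<Rightarrow> real" and R assume g: "continuous_on UNIV g" "\<And>a. a \<ge> R \<Longrightarrow> g a = 0"
  then have "g \<in> C0"
    unfolding C0_def using eventually_at_top_linorder[of "\<lambda>a. g a = 0"]
    by (auto intro: continuous_on_subset tendsto_eventually)
  then have gb: "g \<in> bounded_measurable"
    using C0_subset_Cb Cb_bounded_measurable by blast
  note L = sigma_functional_signed_integral[OF mu] and J = sigma_functional_signed_integral[OF nu]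
  obtain G where G: "G \<ge> 0" "\<And>f C. f \<in> bounded_measurable \<Longrightarrow> (\<And>a. a \<ge> 0 \<Longrightarrow> \<bar>f a\<bar> \<le> C) \<Longrightarrow>
      \<bar>signed_integral \<mu> f\<bar> \<le> G * C"
    using signed_integral_bound[OF mu] by blast
  obtain G' where G': "G' \<ge> 0" "\<And>f C. f \<in> bounded_measurable \<Longrightarrow> (\<And>a. a \<ge> 0 \<Longrightarrow> \<bar>f a\<bar> \<le> C) \<Longrightarrow>
      \<bar>signed_integral \<nu> f\<bar> \<le> G' * C"
    using signed_integral_bound[OF nu] by blast
  \<comment> \<open>The accuracy of approximation is \<open>1 / \<epsilon>\<close>, so
    \<open>\<epsilon>\<close> can later run through the natural numbers to infinity.\<close>
  have bound: "\<bar>signed_integral \<mu> g - signed_integral \<nu> g\<bar> \<le> (G + G') / \<epsilon>" if "\<epsilon> > 0" for \<epsilon>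
  proof -
    have "1 / \<epsilon> > 0" using that by simp
    then obtain c and n :: nat where a: "\<And>a. a \<ge> 0 \<Longrightarrow> \<bar>g a - (\<Sum>i\<le>n. c i * etest (K + 1 + real i) a)\<bar> \<le> 1 / \<epsilon>"
      using etest_dense[OF g] by blast
    define p where "p a = (\<Sum>i\<le>n. c i * etest (K + 1 + real i) a)" for a
    have eb: "etest (K + 1 + real i) \<in> bounded_measurable" for i
      by (intro Cb_bounded_measurable etest_Cb) simp
    have pb: "p \<in> bounded_measurable"
      unfolding p_def by (intro bounded_measurable_sum bounded_measurable_cmult eb)
    have p: "signed_integral \<mu> p = signed_integral \<nu> p"
      unfolding p_def sigma_functional_sum[OF L bounded_measurable_cmult[OF eb]]
        sigma_functional_sum[OF J bounded_measurable_cmult[OF eb]]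
        sigma_functional_cmult[OF L eb] sigma_functional_cmult[OF J eb]
      using eq by simp
    have "\<bar>signed_integral \<mu> g - signed_integral \<mu> p\<bar> \<le> G * (1 / \<epsilon>)"
      unfolding sigma_functional_diff[OF L gb pb, symmetric]
      by (rule G(2)[OF bounded_measurable_diff[OF gb pb]]) (use a in \<open>simp add: p_def\<close>)
    moreover have "\<bar>signed_integral \<nu> g - signed_integral \<nu> p\<bar> \<le> G' * (1 / \<epsilon>)"
      unfolding sigma_functional_diff[OF J gb pb, symmetric]
      by (rule G'(2)[OF bounded_measurable_diff[OF gb pb]]) (use a in \<open>simp add: p_def\<close>)
    ultimately have "\<bar>signed_integral \<mu> g - signed_integral \<nu> g\<bar> \<le> G * (1 / \<epsilon>) + G' * (1 / \<epsilon>)"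
      using p by linarith
    then show ?thesis
      by (simp add: add_divide_distrib)
  qed
  have "\<bar>signed_integral \<mu> g - signed_integral \<nu> g\<bar> \<le> 0"
  proof (rule tendsto_lowerbound)
    show "(\<lambda>n. (G + G') / real n) \<longlonglongrightarrow> 0"
      by (rule lim_const_over_n)
    show "\<forall>\<^sub>F n in sequentially. \<bar>signed_integral \<mu> g - signed_integral \<nu> g\<bar> \<le> (G + G') / real n"
      using bound by (intro eventually_sequentiallyI[of 1]) auto
  qed simp
  then show "signed_integral \<mu> g = signed_integral \<nu> g" by simp
qed

text \<open>The difference of two solutions is the measure generated by the difference \<open>d\<close> of their birth
  rates alone; testing it against \<open>\<beta>\<close> gives a homogeneous Volterra equation for \<open>d\<close>.\<close>

lemma measure_solution_unique:
  assumes mu0: "\<mu>0 \<in> signed_measures"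
    and mu: "measure_solution \<beta> \<mu>0 \<mu>" and nu: "measure_solution \<beta> \<mu>0 \<nu>" and "t \<ge> 0"
  shows "\<mu> t = \<nu> t"
proof -
  have ms: "\<And>s. s \<ge> 0 \<Longrightarrow> \<mu> s \<in> signed_measures" "\<And>s. s \<ge> 0 \<Longrightarrow> \<nu> s \<in> signed_measures"
    using mu nu unfolding measure_solution_def by blast+
  have cont: "continuous_on halfline (\<lambda>s. signed_integral (\<mu> s) f)"
    "continuous_on halfline (\<lambda>s. signed_integral (\<nu> s) f)" if "f \<in> Cb" for f
    using mu nu that unfolding measure_solution_def narrowly_continuous_def by blast+
  define D where "D f s = signed_integral (\<mu> s) f - signed_integral (\<nu> s) f" for f s
  define d where "d s = D \<beta> (max 0 s)" for s
  have D_cont: "continuous_on halfline (D f)" if "f \<in> Cb" for f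
    unfolding D_def by (intro continuous_intros cont that)
  have d_cont: "continuous_on UNIV d"
    unfolding d_def by (rule continuous_on_max0[OF D_cont[OF \<beta>_Cb]])
  have etest_eq: "D (etest l) t = conv d (\<lambda>s. etest l (max 0 s) * surv 0 (max 0 s)) t"
    if l: "l \<ge> K + 1" and t: "t \<ge> 0" for l t
  proof -
    \<comment> \<open>The common initial measure cancels, which gives the zero initial value
      required by \<open>linear_ode_solution\<close>.\<close>
    have "D (etest l) t = integral {0..t} (\<lambda>s. D \<beta> s - l * D (etest l) s)" if t: "t \<ge> 0" for t
    proof -
      have i: "(\<lambda>s. signed_integral (\<kappa> s) \<beta> - l * signed_integral (\<kappa> s) (etest l)) integrable_on {0..t}"
        if "\<And>f. f \<in> Cb \<Longrightarrow> continuous_on halfline (\<lambda>s. signed_integral (\<kappa> s) f)" for \<kappa>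
        by (intro integrable_continuous_real continuous_intros
            continuous_on_subset[OF that[OF \<beta>_Cb]] continuous_on_subset[OF that[OF etest_Cb[OF l]]]) auto
      have "D (etest l) t = integral {0..t} (\<lambda>s. (signed_integral (\<mu> s) \<beta> - l * signed_integral (\<mu> s) (etest l)) -
          (signed_integral (\<nu> s) \<beta> - l * signed_integral (\<nu> s) (etest l)))"
        using measure_solution_etest[OF mu mu0 l t] measure_solution_etest[OF nu mu0 l t]
        by (subst Henstock_Kurzweil_Integration.integral_diff[OF i[OF cont(1)] i[OF cont(2)]])
           (simp_all add: D_def)
      then show ?thesis
        by (simp add: D_def algebra_simps)
    qed
    then have "D (etest l) t = integral {0..t} (\<lambda>s. D \<beta> s * exp (- l * (t - s)))"
      by (rule linear_ode_solution[OF D_cont[OF etest_Cb[OF l]] D_cont[OF \<beta>_Cb]]) (use t in auto)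
    also have "\<dots> = conv d (\<lambda>s. etest l (max 0 s) * surv 0 (max 0 s)) t"
      unfolding conv_def by (rule integral_cong) (auto simp: d_def etest_surv)
    finally show ?thesis .
  qed
  \<comment> \<open>The identity is wanted for \<beta>, which need not be a uniform limit of the
    decaying exponentials. The right-hand side is therefore realised by a measure:
    \<open>\<kappa>\<close> is \<open>\<nu> t\<close> plus the individuals born at rate
    \<open>d\<close>. It equals \<open>\<mu> t\<close> since the exponentials separate measures, and
    then every \<open>f\<close> in \<open>Cb\<close> may be tested.\<close>
  have main: "D f t = conv d (\<lambda>s. f (max 0 s) * surv 0 (max 0 s)) t" if f: "f \<in> Cb" and t: "t \<ge> 0" for f t
  proof -
    obtain J where J: "sigma_functional J"
      "\<And>f. f \<in> Cb \<Longrightarrow> J f = conv d (\<lambda>s. f (max 0 s) * surv 0 (max 0 s)) t"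
      using sigma_functional_conv[OF d_cont t] by blast
    obtain \<kappa> where \<kappa>: "\<kappa> \<in> signed_measures" "\<And>f. f \<in> bounded_measurable \<Longrightarrow>
        signed_integral \<kappa> f = signed_integral (\<nu> t) f + J f"
      using signed_measure_of_functional[OF sigma_functional_plus[OF
            sigma_functional_signed_integral[OF ms(2)[OF t]] J(1)]] by blast
    have "\<mu> t = \<kappa>"
    proof (rule signed_measure_eqI_etest[OF ms(1)[OF t] \<kappa>(1)])
      show "signed_integral (\<mu> t) (etest l) = signed_integral \<kappa> (etest l)" if "l \<ge> K + 1" for l
        using etest_eq[OF that t] \<kappa>(2)[OF Cb_bounded_measurable[OF etest_Cb[OF that]]] J(2)[OF etest_Cb[OF that]]
        by (simp add: D_def)
    qed
    then show ?thesis
      using \<kappa>(2)[OF Cb_bounded_measurable[OF f]] J(2)[OF f] by (simp add: D_def)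
  qed
  have d0: "d t = 0" if "t \<ge> 0" for t
  proof (rule volterra_zero[OF d_cont _ that])
    fix t :: real assume t: "t \<ge> 0"
    have "conv d (\<lambda>s. \<beta> (max 0 s) * surv 0 (max 0 s)) t = conv (rate 0) d t"
      unfolding conv_commute[of d] by (rule conv_cong) (auto simp: rate_def)
    then show "d t = conv (rate 0) d t"
      using main[OF \<beta>_Cb t] t by (simp add: d_def)
  qed
  show ?thesis
  proof (rule signed_measure_eqI_etest[OF ms(1)[OF \<open>t \<ge> 0\<close>] ms(2)[OF \<open>t \<ge> 0\<close>]])
    fix l assume l: "l \<ge> K + 1"
    have "conv d (\<lambda>s. etest l (max 0 s) * surv 0 (max 0 s)) t = 0"
      by (subst conv_cong[of t d "\<lambda>_. 0", OF d0 refl]) (auto simp: conv_def)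
    then show "signed_integral (\<mu> t) (etest l) = signed_integral (\<nu> t) (etest l)"
      using main[OF etest_Cb[OF l] \<open>t \<ge> 0\<close>] by (simp add: D_def)
  qed
qed

end

section \<open>Reduction to a rate defined on the whole line\<close>

lemma signed_integral_cong:
  "(\<And>a. a \<ge> 0 \<Longrightarrow> f a = g a) \<Longrightarrow> signed_integral \<mu> f = signed_integral \<mu> g"
  unfolding signed_integral_def
  by (intro arg_cong2[where f = "(-)"] Bochner_Integration.integral_cong) auto

lemma measure_solution_max0: "measure_solution (\<lambda>a. \<beta> (max 0 a)) = measure_solution \<beta>"
proof -
  have "signed_integral \<mu> (generator (\<lambda>a. \<beta> (max 0 a)) f) = signed_integral \<mu> (generator \<beta> f)" for \<mu> f
    by (rule signed_integral_cong) (simp add: generator_def)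
  then show ?thesis
    unfolding measure_solution_def by simp
qed

text \<open>At nonnegative ages every argument of \<beta> in the Duhamel formula is nonnegative. The
  two Duhamel equations coincide, and with them the definite descriptions.\<close>

lemma left_semigroup_max0: "left_semigroup (\<lambda>a. \<beta> (max 0 a)) = left_semigroup \<beta>"
proof -
  have "integral {0..t} (\<lambda>u. \<beta> (max 0 (a + u))) = integral {0..t} (\<lambda>u. \<beta> (a + u))" if "a \<ge> 0" for t a
    by (rule integral_cong) (use that in auto)
  moreover have "integral {0..t} (\<lambda>\<tau>. exp (- integral {0..\<tau>} (\<lambda>u. \<beta> (a + u))) * \<beta> (max 0 (a + \<tau>)) * f (t - \<tau>, 0)) =
      integral {0..t} (\<lambda>\<tau>. exp (- integral {0..\<tau>} (\<lambda>u. \<beta> (a + u))) * \<beta> (a + \<tau>) * f (t - \<tau>, 0))"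
    if "a \<ge> 0" for t a and f :: "real \<times> real \<Rightarrow> real"
    by (rule integral_cong) (use that in auto)
  ultimately have "duhamel_solution (\<lambda>a. \<beta> (max 0 a)) = duhamel_solution \<beta>"
    unfolding duhamel_solution_def by (intro ext) simp
  then show ?thesis
    by (intro ext) (simp add: left_semigroup_def right_semigroup_def)
qed

theorem theorem10:
  fixes \<beta> :: "real \<Rightarrow> real" and a_star \<beta>min \<beta>max :: real and \<mu>in :: "real set \<Rightarrow> real"
  assumes "continuous_on {0..} \<beta>"
    and "a_star > 0" and "\<beta>min > 0" and "\<beta>max > 0"
    and "\<And>a. a \<ge> 0 \<Longrightarrow> \<beta>min * indicator {a_star..} a \<le> \<beta> a \<and> \<beta> a \<le> \<beta>max"
    and "\<mu>in \<in> signed_measures"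
  shows "measure_solution \<beta> \<mu>in (left_semigroup \<beta> \<mu>in) \<and>
    (\<forall>\<mu>. measure_solution \<beta> \<mu>in \<mu> \<longrightarrow> (\<forall>t\<ge>0. \<mu> t = left_semigroup \<beta> \<mu>in t))"
proof -
  \<comment> \<open>Freezing \<beta> at negative ages supplies the continuity and bounds on the
    whole line; nonnegativity comes from the lower bound on \<beta>.\<close>
  interpret renewal "\<lambda>a. \<beta> (max 0 a)" \<beta>max
  proof
    show "continuous_on UNIV (\<lambda>a. \<beta> (max 0 a))"
      by (rule continuous_on_max0[OF assms(1)])
    fix a :: real
    have "0 \<le> \<beta>min * indicator {a_star..} (max 0 a)"
      using assms(3) by (simp add: indicator_def)
    then show "\<beta> (max 0 a) \<ge> 0" "\<beta> (max 0 a) \<le> \<beta>max"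
      using assms(5)[of "max 0 a"] by linarith+
  qed (rule assms(4))
  note sol = left_semigroup_measure_solution[OF assms(6)]
  show ?thesis
    using sol measure_solution_unique[OF assms(6) _ sol]
    unfolding measure_solution_max0 left_semigroup_max0 by blast
qed

end
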